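(* Let $d_1,d_2\in\mathbb{N}$ and let $\Phi:\mathbb{M}_{d_1}\to\mathbb{M}_{d_2}$ be a PPT-channel with $\operatorname{rank}(\Phi(I))\le d_1$. Then the following are equivalent: (i) The Choi matrix $C_\Phi$ is a projection. (ii) $\Phi$ is entanglement breaking with $ER(\Phi)=d_1$ (and hence $CR(\Phi)=d_1$). (iii) $\Phi^*$ is a $C^*$-extreme point of $\mathrm{UEB}(d_2,d_1)$. (iv) There exist unit vectors $\{v_j\}_{j=1}^{d_1}\subseteq\mathbb{C}^{d_2}$ and an orthonormal basis $\{u_j\}_{j=1}^{d_1}$ of $\mathbb{C}^{d_1}$ such that $$\Phi(X)=\sum_{j=1}^{d_1}\langle u_j,Xu_j\rangle\,|v_j\rangle\langle v_j|\qquad\text{for all }X\in\mathbb{M}_{d_1}.$$ (v) There exist a positive semidefinite $A\in\mathbb{M}_{d_1}$ with all diagonal entries equal to $1$, a unitary $U\in\mathbb{M}_{d_1}$, and a CP map $S_A^c:\mathbb{M}_{d_1}\to\mathbb{M}_{d_2}$ complementary to the Schur map $S_A:\mathbb{M}_{d_1}\to\mathbb{M}_{d_1}$, such that $\Phi=S_A^c\circ\mathrm{Ad}_U$. Further, if $d_1=d_2$ and $\Phi$ is unital, then each of the conditions (i), (ii), (iii), (iv), (v) is equivalent to: (vi) $\Phi$ is degradable.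
   Context: $\mathbb{M}_d=\mathscr{B}(\mathbb{C}^d)$; inner products are linear in the second variable; $|x\rangle\langle y|$ is the operator $z\mapsto\langle y,z\rangle x$; $\mathrm{Ad}_V(X)=V^*XV$; "projection" means self-adjoint idempotent. A PPT-channel is a trace-preserving linear map $\Phi:\mathbb{M}_{d_1}\to\mathbb{M}_{d_2}$ that is completely positive (CP) and co-completely positive (i.e. $\mathsf{T}\otimes\Phi$ is positive on $\mathbb{M}_k\otimes\mathbb{M}_{d_1}$ for all $k$, $\mathsf{T}$ the transpose on $\mathbb{M}_k$). $C_\Phi=\sum_{i,j=1}^{d_1}|e_i\rangle\langle e_j|\otimes\Phi(|e_i\rangle\langle e_j|)$ with $\{e_i\}$ the standard basis. $\Phi^*:\mathbb{M}_{d_2}\to\mathbb{M}_{d_1}$ is the dual: $\operatorname{tr}(\Phi^*(X)T)=\operatorname{tr}(X\Phi(T))$. A CP map $\Phi:\mathbb{M}_{d_1}\to\mathbb{M}_{d_2}$ is entanglement breaking (EB) if for all $k$ and all positive semidefinite $\rho\in\mathbb{M}_k\otimes\mathbb{M}_{d_1}$, $(\mathrm{id}_k\otimes\Phi)(\rho)$ is a finite sum of $P\otimes Q$ with $P,Q$ positive semidefinite; equivalently, $\Phi$ has a Kraus decomposition with rank-one Kraus operators. $CR(\Phi)$ (Choi rank) is the minimum number of Kraus operators needed to represent $\Phi$, and for EB $\Phi$, $ER(\Phi)$ (entanglement breaking rank) is the minimum number of rank-one Kraus operators needed to represent $\Phi$. $\mathrm{UEB}(d_2,d_1)$ is the set of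 unital EB maps $\mathbb{M}_{d_2}\to\mathbb{M}_{d_1}$. $\Psi\in\mathrm{UEB}(d_2,d_1)$ is a $C^*$-extreme point if whenever $\Psi=\sum_{i=1}^n\mathrm{Ad}_{T_i}\circ\Psi_i$ with $T_i\in\mathbb{M}_{d_1}$ invertible, $\sum_iT_i^*T_i=I$, $\Psi_i\in\mathrm{UEB}(d_2,d_1)$, there are unitaries $U_i\in\mathbb{M}_{d_1}$ with $\Psi_i=\mathrm{Ad}_{U_i}\circ\Psi$ for all $i$. For positive semidefinite $A\in\mathbb{M}_{d}$, the Schur map is $S_A(X)=A\odot X$ (entrywise product). A CP map $\Psi:\mathbb{M}_{m}\to\mathbb{M}_{q}$ is complementary to a CP map $\Theta:\mathbb{M}_{m}\to\mathbb{M}_{p}$ if there is a linear $B:\mathbb{C}^{m}\to\mathbb{C}^{p}\otimes\mathbb{C}^{q}$ with $\Theta(X)=(\mathrm{id}\otimes\operatorname{tr})(BXB^* )$ and $\Psi(X)=(\operatorname{tr}\otimes\mathrm{id})(BXB^* )$ for all $X$. $\Theta$ is degradable if there is a CP map $\Gamma$ on $\mathbb{M}_p$ (into some $\mathbb{M}_q$) such that $\Gamma\circ\Theta$ is complementary to $\Theta$. *)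

theory Defs
  imports
    "Jordan_Normal_Form.Matrix"
    "Jordan_Normal_Form.Schur_Decomposition"
    "Jordan_Normal_Form.DL_Rank"
begin

text \<open>
  The algebra of complex \<open>d \<times> d\<close> matrices is \<open>carrier_mat d d\<close>.  Maps between matrix algebras are
  total HOL functions of which only the values on the carrier matter; accordingly, equality of two
  such maps is always stated on the carrier.
\<close>

section \<open>Matrices\<close>

text \<open>Inner product of \<open>\<complex>^d\<close>, linear in the second variable (\<open>\<bullet>c\<close> conjugates its second argument).\<close>
definition cinner :: "complex vec \<Rightarrow> complex vec \<Rightarrow> complex" where
  "cinner x y = y \<bullet>c x"

definition ketbra :: "complex vec \<Rightarrow> complex vec \<Rightarrow> complex mat" where
  "ketbra x y = mat (dim_vec x) (dim_vec y) (\<lambda>(i, j). x $ i * cnj (y $ j))"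

abbreviation mat_unit :: "nat \<Rightarrow> nat \<Rightarrow> nat \<Rightarrow> complex mat" where
  "mat_unit d i j \<equiv> ketbra (unit_vec d i) (unit_vec d j)"

definition mat_trace :: "complex mat \<Rightarrow> complex" where
  "mat_trace A = (\<Sum>i<dim_row A. A $$ (i, i))"

text \<open>Sums of \<open>r \<times> c\<close> matrices; the dimensions are needed because the type has no single zero.\<close>
definition mat_sum :: "nat \<Rightarrow> nat \<Rightarrow> ('i \<Rightarrow> complex mat) \<Rightarrow> 'i set \<Rightarrow> complex mat" where
  "mat_sum r c f I = mat r c (\<lambda>(a, b). \<Sum>i\<in>I. f i $$ (a, b))"

text \<open>The order on complex numbers is the one of Complex_Order: \<open>0 \<le> z\<close> says that \<open>z\<close> is
  real and nonnegative.\<close>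
definition psd :: "nat \<Rightarrow> complex mat \<Rightarrow> bool" where
  "psd d A \<longleftrightarrow> A \<in> carrier_mat d d \<and> (\<forall>x\<in>carrier_vec d. 0 \<le> cinner x (A *\<^sub>v x))"

definition is_projection :: "complex mat \<Rightarrow> bool" where
  "is_projection A \<longleftrightarrow> square_mat A \<and> mat_adjoint A = A \<and> A * A = A"

definition unitary :: "nat \<Rightarrow> complex mat \<Rightarrow> bool" where
  "unitary d U \<longleftrightarrow> U \<in> carrier_mat d d \<and> mat_adjoint U * U = 1\<^sub>m d \<and> U * mat_adjoint U = 1\<^sub>m d"

definition orthonormal_basis :: "nat \<Rightarrow> (nat \<Rightarrow> complex vec) \<Rightarrow> bool" where
  "orthonormal_basis d u \<longleftrightarrow>
     (\<forall>i<d. u i \<in> carrier_vec d) \<and>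
     (\<forall>i<d. \<forall>j<d. cinner (u i) (u j) = (if i = j then 1 else 0)) \<and>
     vectorspace.basis class_ring (module_vec TYPE(complex) d) (u ` {..<d})"

text \<open>\<open>\<complex>^k \<otimes> \<complex>^d\<close> is identified with \<open>\<complex>^(k * d)\<close> through \<open>e\<^sub>i \<otimes> e\<^sub>a \<mapsto> e\<close> at position \<open>i * d + a\<close>.\<close>
definition kron :: "complex mat \<Rightarrow> complex mat \<Rightarrow> complex mat" where
  "kron A B = mat (dim_row A * dim_row B) (dim_col A * dim_col B)
     (\<lambda>(r, s). A $$ (r div dim_row B, s div dim_col B) * B $$ (r mod dim_row B, s mod dim_col B))"

definition mat_block :: "nat \<Rightarrow> nat \<Rightarrow> nat \<Rightarrow> complex mat \<Rightarrow> complex mat" where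
  "mat_block d i j R = mat d d (\<lambda>(a, b). R $$ (i * d + a, j * d + b))"

text \<open>\<open>id \<otimes> tr\<close> and \<open>tr \<otimes> id\<close> on \<open>M\<^sub>p \<otimes> M\<^sub>q\<close>.\<close>
definition ptrace_right :: "nat \<Rightarrow> nat \<Rightarrow> complex mat \<Rightarrow> complex mat" where
  "ptrace_right p q Y = mat p p (\<lambda>(a, b). \<Sum>c<q. Y $$ (a * q + c, b * q + c))"

definition ptrace_left :: "nat \<Rightarrow> nat \<Rightarrow> complex mat \<Rightarrow> complex mat" where
  "ptrace_left p q Y = mat q q (\<lambda>(c, d). \<Sum>a<p. Y $$ (a * q + c, a * q + d))"


section \<open>Linear maps between matrix algebras\<close>

abbreviation mat_maps :: "nat \<Rightarrow> nat \<Rightarrow> (complex mat \<Rightarrow> complex mat) set" where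
  "mat_maps m n \<equiv> LinearCombinations.module_hom class_ring
     (module_mat TYPE(complex) m m) (module_mat TYPE(complex) n n)"

lemma mat_maps_iff:
  "F \<in> mat_maps m n \<longleftrightarrow>
     (\<forall>X\<in>carrier_mat m m. F X \<in> carrier_mat n n) \<and>
     (\<forall>X\<in>carrier_mat m m. \<forall>Y\<in>carrier_mat m m. F (X + Y) = F X + F Y) \<and>
     (\<forall>c. \<forall>X\<in>carrier_mat m m. F (c \<cdot>\<^sub>m X) = c \<cdot>\<^sub>m F X)"
  by (auto simp: LinearCombinations.module_hom_def module_mat_simps class_ring_simps)

text \<open>
  \<open>F \<otimes> G\<close> on \<open>M\<^sub>k \<otimes> M\<^sub>m\<close>, for \<open>F : M\<^sub>k \<rightarrow> M\<^sub>p\<close> and \<open>G : M\<^sub>m \<rightarrow> M\<^sub>n\<close>: every \<open>R\<close> is the sum of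
  \<open>|e\<^sub>i><e\<^sub>j| \<otimes> R\<^sub>i\<^sub>j\<close> over its \<open>m \<times> m\<close> blocks.
\<close>
definition tensor_map ::
  "nat \<Rightarrow> nat \<Rightarrow> nat \<Rightarrow> nat \<Rightarrow> (complex mat \<Rightarrow> complex mat) \<Rightarrow> (complex mat \<Rightarrow> complex mat) \<Rightarrow>
   complex mat \<Rightarrow> complex mat" where
  "tensor_map k p m n F G R =
     mat_sum (p * n) (p * n)
       (\<lambda>(i, j). kron (F (mat_unit k i j)) (G (mat_block m i j R))) ({..<k} \<times> {..<k})"

definition Ad :: "complex mat \<Rightarrow> complex mat \<Rightarrow> complex mat" where
  "Ad V X = mat_adjoint V * X * V"

definition CP :: "nat \<Rightarrow> nat \<Rightarrow> (complex mat \<Rightarrow> complex mat) \<Rightarrow> bool" where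
  "CP m n F \<longleftrightarrow> F \<in> mat_maps m n \<and>
     (\<forall>k R. psd (k * m) R \<longrightarrow> psd (k * n) (tensor_map k k m n (\<lambda>X. X) F R))"

definition coCP :: "nat \<Rightarrow> nat \<Rightarrow> (complex mat \<Rightarrow> complex mat) \<Rightarrow> bool" where
  "coCP m n F \<longleftrightarrow> F \<in> mat_maps m n \<and>
     (\<forall>k R. psd (k * m) R \<longrightarrow> psd (k * n) (tensor_map k k m n transpose_mat F R))"

definition trace_preserving :: "nat \<Rightarrow> (complex mat \<Rightarrow> complex mat) \<Rightarrow> bool" where
  "trace_preserving m F \<longleftrightarrow> (\<forall>X\<in>carrier_mat m m. mat_trace (F X) = mat_trace X)"

definition unital :: "nat \<Rightarrow> nat \<Rightarrow> (complex mat \<Rightarrow> complex mat) \<Rightarrow> bool" where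
  "unital m n F \<longleftrightarrow> F (1\<^sub>m m) = 1\<^sub>m n"

definition PPT_channel :: "nat \<Rightarrow> nat \<Rightarrow> (complex mat \<Rightarrow> complex mat) \<Rightarrow> bool" where
  "PPT_channel m n F \<longleftrightarrow> CP m n F \<and> coCP m n F \<and> trace_preserving m F"

definition choi :: "nat \<Rightarrow> nat \<Rightarrow> (complex mat \<Rightarrow> complex mat) \<Rightarrow> complex mat" where
  "choi m n F = mat_sum (m * n) (m * n)
     (\<lambda>(i, j). kron (mat_unit m i j) (F (mat_unit m i j))) ({..<m} \<times> {..<m})"

text \<open>The dual \<open>M\<^sub>n \<rightarrow> M\<^sub>m\<close> of \<open>F : M\<^sub>m \<rightarrow> M\<^sub>n\<close>; see \<open>dual_map\<close> below for existence and uniqueness.\<close>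
definition dual_map ::
  "nat \<Rightarrow> (complex mat \<Rightarrow> complex mat) \<Rightarrow> complex mat \<Rightarrow> complex mat" where
  "dual_map m F X = (THE Y. Y \<in> carrier_mat m m \<and>
     (\<forall>T\<in>carrier_mat m m. mat_trace (Y * T) = mat_trace (X * F T)))"


section \<open>Entanglement breaking maps\<close>

definition EB :: "nat \<Rightarrow> nat \<Rightarrow> (complex mat \<Rightarrow> complex mat) \<Rightarrow> bool" where
  "EB m n F \<longleftrightarrow> CP m n F \<and>
     (\<forall>k R. psd (k * m) R \<longrightarrow>
        (\<exists>(l::nat) P Q. (\<forall>i<l. psd k (P i) \<and> psd n (Q i)) \<and>
           tensor_map k k m n (\<lambda>X. X) F R =
             mat_sum (k * n) (k * n) (\<lambda>i. kron (P i) (Q i)) {..<l}))"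

definition kraus_family ::
  "nat \<Rightarrow> nat \<Rightarrow> (complex mat \<Rightarrow> complex mat) \<Rightarrow> nat \<Rightarrow> (nat \<Rightarrow> complex mat) \<Rightarrow> bool" where
  "kraus_family m n F l V \<longleftrightarrow> (\<forall>i<l. V i \<in> carrier_mat m n) \<and>
     (\<forall>X\<in>carrier_mat m m. F X = mat_sum n n (\<lambda>i. Ad (V i) X) {..<l})"

text \<open>The minima exist only for maps having such decompositions, i.e. for CP maps and for EB maps,
  respectively; \<open>CR\<close> and \<open>ER\<close> are unspecified otherwise.\<close>
definition CR :: "nat \<Rightarrow> nat \<Rightarrow> (complex mat \<Rightarrow> complex mat) \<Rightarrow> nat" where
  "CR m n F = (LEAST l. \<exists>V. kraus_family m n F l V)"

definition ER :: "nat \<Rightarrow> nat \<Rightarrow> (complex mat \<Rightarrow> complex mat) \<Rightarrow> nat" where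
  "ER m n F = (LEAST l. \<exists>V. kraus_family m n F l V \<and> (\<forall>i<l. vec_space.rank m (V i) = 1))"

definition UEB :: "nat \<Rightarrow> nat \<Rightarrow> (complex mat \<Rightarrow> complex mat) set" where
  "UEB m n = {F. EB m n F \<and> unital m n F}"

definition Cstar_extreme_UEB :: "nat \<Rightarrow> nat \<Rightarrow> (complex mat \<Rightarrow> complex mat) \<Rightarrow> bool" where
  "Cstar_extreme_UEB m n F \<longleftrightarrow> F \<in> UEB m n \<and>
     (\<forall>(l::nat) T G.
        (\<forall>i<l. T i \<in> carrier_mat n n \<and> invertible_mat (T i) \<and> G i \<in> UEB m n) \<and>
        mat_sum n n (\<lambda>i. mat_adjoint (T i) * T i) {..<l} = 1\<^sub>m n \<and>
        (\<forall>X\<in>carrier_mat m m. F X = mat_sum n n (\<lambda>i. Ad (T i) (G i X)) {..<l})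
        \<longrightarrow> (\<exists>U. \<forall>i<l. unitary n (U i) \<and> (\<forall>X\<in>carrier_mat m m. G i X = Ad (U i) (F X))))"


section \<open>Schur maps, complementary and degradable maps\<close>

definition schur_map :: "complex mat \<Rightarrow> complex mat \<Rightarrow> complex mat" where
  "schur_map A X = mat (dim_row A) (dim_col A) (\<lambda>(i, j). A $$ (i, j) * X $$ (i, j))"

text \<open>\<open>complementary m p q F G\<close>: the map \<open>G : M\<^sub>m \<rightarrow> M\<^sub>q\<close> is complementary to \<open>F : M\<^sub>m \<rightarrow> M\<^sub>p\<close>.\<close>
definition complementary ::
  "nat \<Rightarrow> nat \<Rightarrow> nat \<Rightarrow> (complex mat \<Rightarrow> complex mat) \<Rightarrow> (complex mat \<Rightarrow> complex mat) \<Rightarrow> bool" where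
  "complementary m p q F G \<longleftrightarrow> CP m p F \<and> CP m q G \<and>
     (\<exists>B\<in>carrier_mat (p * q) m. \<forall>X\<in>carrier_mat m m.
        F X = ptrace_right p q (B * X * mat_adjoint B) \<and>
        G X = ptrace_left p q (B * X * mat_adjoint B))"

definition degradable :: "nat \<Rightarrow> nat \<Rightarrow> (complex mat \<Rightarrow> complex mat) \<Rightarrow> bool" where
  "degradable m p F \<longleftrightarrow> (\<exists>q G. CP p q G \<and> complementary m p q F (G \<circ> F))"


section \<open>Well-definedness of the tensor product and of the dual\<close>

lemma mat_sum_index [simp]:
  "a < r \<Longrightarrow> b < c \<Longrightarrow> mat_sum r c f I $$ (a, b) = (\<Sum>i\<in>I. f i $$ (a, b))"
  "dim_row (mat_sum r c f I) = r" "dim_col (mat_sum r c f I) = c"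
  by (auto simp: mat_sum_def)

lemma mat_unit_index [simp]:
  "a < d \<Longrightarrow> b < d \<Longrightarrow> i < d \<Longrightarrow> j < d \<Longrightarrow>
     mat_unit d i j $$ (a, b) = (if a = i \<and> b = j then 1 else 0)"
  "dim_row (mat_unit d i j) = d" "dim_col (mat_unit d i j) = d"
  by (auto simp: ketbra_def unit_vec_def)

lemma mat_maps_mat_sum:
  assumes F: "F \<in> mat_maps m n" and I: "finite I"
    and f: "\<And>i. i \<in> I \<Longrightarrow> f i \<in> carrier_mat m m"
  shows "F (mat_sum m m f I) = mat_sum n n (\<lambda>i. F (f i)) I"
  using I f
proof (induction I rule: finite_induct)
  case empty
  have "F (0 \<cdot>\<^sub>m 0\<^sub>m m m) = 0 \<cdot>\<^sub>m F (0\<^sub>m m m)" and c: "F (0\<^sub>m m m) \<in> carrier_mat n n"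
    using F by (simp_all add: mat_maps_iff del: smult_zero_mat)
  moreover have "0 \<cdot>\<^sub>m 0\<^sub>m m m = (0\<^sub>m m m :: complex mat)" by (intro eq_matI) auto
  moreover have "0 \<cdot>\<^sub>m F (0\<^sub>m m m) = 0\<^sub>m n n" using c by (intro eq_matI) auto
  moreover have "mat_sum m m f {} = 0\<^sub>m m m" "mat_sum n n (\<lambda>i. F (f i)) {} = 0\<^sub>m n n"
    by (intro eq_matI; simp)+
  ultimately show ?case by simp
next
  case (insert i I)
  have "mat_sum m m f (insert i I) = f i + mat_sum m m f I"
    using insert by (intro eq_matI) (auto simp: mat_sum_def)
  moreover have "mat_sum m m f I \<in> carrier_mat m m" by (simp add: mat_sum_def)
  moreover have "mat_sum n n (\<lambda>i. F (f i)) (insert i I) = F (f i) + mat_sum n n (\<lambda>i. F (f i)) I"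
    using insert F by (intro eq_matI) (auto simp: mat_maps_iff mat_sum_def)
  ultimately show ?case using insert F by (simp add: mat_maps_iff)
qed

lemma mat_unit_expansion:
  assumes X: "X \<in> carrier_mat m m"
  shows "X = mat_sum m m (\<lambda>(i, j). X $$ (i, j) \<cdot>\<^sub>m mat_unit m i j) ({..<m} \<times> {..<m})"
    (is "_ = ?S")
proof (rule eq_matI)
  fix a b assume ab: "a < dim_row ?S" "b < dim_col ?S"
  then have ab: "a < m" "b < m" by simp_all
  have "?S $$ (a, b) = (\<Sum>p\<in>{..<m} \<times> {..<m}. (if p = (a, b) then X $$ (a, b) else 0))"
    unfolding mat_sum_index(1)[OF ab]
  proof (intro sum.cong refl)
    fix p assume "p \<in> {..<m} \<times> {..<m}"
    then obtain i j where "p = (i, j)" "i < m" "j < m" by auto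
    then show "(case p of (i, j) \<Rightarrow> X $$ (i, j) \<cdot>\<^sub>m mat_unit m i j) $$ (a, b) =
        (if p = (a, b) then X $$ (a, b) else 0)"
      using ab by auto
  qed
  also have "\<dots> = X $$ (a, b)" using ab by simp
  finally show "X $$ (a, b) = ?S $$ (a, b)" ..
qed (use X in auto)

lemma kron_index:
  assumes "A \<in> carrier_mat p p" "B \<in> carrier_mat n n" "r < p * n" "s < p * n"
  shows "kron A B $$ (r, s) = A $$ (r div n, s div n) * B $$ (r mod n, s mod n)"
  using assms by (auto simp: kron_def)

lemma tensor_map_kron:
  assumes F: "F \<in> mat_maps k p" and G: "G \<in> mat_maps m n"
    and A: "A \<in> carrier_mat k k" and B: "B \<in> carrier_mat m m"
  shows "tensor_map k p m n F G (kron A B) = kron (F A) (G B)"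
proof -
  have blk: "mat_block m i j (kron A B) = A $$ (i, j) \<cdot>\<^sub>m B" if "i < k" "j < k" for i j
  proof (rule eq_matI)
    fix a b assume ab: "a < dim_row (A $$ (i, j) \<cdot>\<^sub>m B)" "b < dim_col (A $$ (i, j) \<cdot>\<^sub>m B)"
    have le: "x * m + c < k * m" if "x < k" "c < m" for x c
    proof -
      have "x * m + c < Suc x * m" using that by simp
      also have "\<dots> \<le> k * m" using that by (intro mult_right_mono) auto
      finally show ?thesis .
    qed
    show "mat_block m i j (kron A B) $$ (a, b) = (A $$ (i, j) \<cdot>\<^sub>m B) $$ (a, b)"
      using ab A B that le[of i a] le[of j b] by (simp add: mat_block_def kron_def)
  qed (use A B in \<open>auto simp: mat_block_def\<close>)
  have U: "mat_unit k i j \<in> carrier_mat k k" for i j by (simp add: carrier_matI)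
  have FA: "F A = mat_sum p p (\<lambda>(i, j). A $$ (i, j) \<cdot>\<^sub>m F (mat_unit k i j)) ({..<k} \<times> {..<k})"
  proof -
    have "F A = F (mat_sum k k (\<lambda>(i, j). A $$ (i, j) \<cdot>\<^sub>m mat_unit k i j) ({..<k} \<times> {..<k}))"
      by (rule arg_cong[OF mat_unit_expansion[OF A]])
    also have "\<dots> = mat_sum p p
        (\<lambda>x. F (case x of (i, j) \<Rightarrow> A $$ (i, j) \<cdot>\<^sub>m mat_unit k i j)) ({..<k} \<times> {..<k})"
      by (rule mat_maps_mat_sum[OF F]) (use U in auto)
    also have "(\<lambda>x. F (case x of (i, j) \<Rightarrow> A $$ (i, j) \<cdot>\<^sub>m mat_unit k i j)) =
        (\<lambda>(i, j). A $$ (i, j) \<cdot>\<^sub>m F (mat_unit k i j))"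
      using F U by (auto simp: mat_maps_iff)
    finally show ?thesis .
  qed
  have GB: "G B \<in> carrier_mat n n" and FU: "F (mat_unit k i j) \<in> carrier_mat p p"
    and FAc: "F A \<in> carrier_mat p p"
    and Gs: "G (c \<cdot>\<^sub>m B) = c \<cdot>\<^sub>m G B" for i j c
    using F G A B U by (auto simp: mat_maps_iff)
  have FUd: "dim_row (F (mat_unit k i j)) = p" "dim_col (F (mat_unit k i j)) = p" for i j
    using FU[of i j] by auto
  show ?thesis
  proof (rule eq_matI)
    fix r s assume "r < dim_row (kron (F A) (G B))" "s < dim_col (kron (F A) (G B))"
    then have rs: "r < p * n" "s < p * n" using GB FAc by (auto simp: kron_def)
    then have dm: "r div n < p" "s div n < p" "r mod n < n" "s mod n < n"
      by (auto simp: less_mult_imp_div_less intro!: mod_less_divisor gr0I)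
    have "tensor_map k p m n F G (kron A B) $$ (r, s) =
        (\<Sum>x\<in>{..<k} \<times> {..<k}. (A $$ x * F (mat_unit k (fst x) (snd x)) $$ (r div n, s div n))
          * G B $$ (r mod n, s mod n))"
      unfolding tensor_map_def mat_sum_index(1)[OF rs]
    proof (intro sum.cong refl)
      fix x assume "x \<in> {..<k} \<times> {..<k}"
      then obtain i j where x: "x = (i, j)" "i < k" "j < k" by auto
      have c: "A $$ (i, j) \<cdot>\<^sub>m G B \<in> carrier_mat n n" using GB by simp
      show "(case x of (i, j) \<Rightarrow> kron (F (mat_unit k i j)) (G (mat_block m i j (kron A B)))) $$ (r, s) =
          (A $$ x * F (mat_unit k (fst x) (snd x)) $$ (r div n, s div n)) * G B $$ (r mod n, s mod n)"
        unfolding x prod.case fst_conv snd_conv blk[OF x(2,3)] Gs kron_index[OF FU c rs]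
        using GB dm by simp
    qed
    also have "\<dots> = F A $$ (r div n, s div n) * G B $$ (r mod n, s mod n)"
      unfolding sum_distrib_right[symmetric] FA mat_sum_index(1)[OF dm(1,2)]
      using FUd dm by (intro arg_cong2[where f = "(*)"] sum.cong refl) auto
    also have "\<dots> = kron (F A) (G B) $$ (r, s)"
      using FAc GB rs by (simp add: kron_index)
    finally show "tensor_map k p m n F G (kron A B) $$ (r, s) = kron (F A) (G B) $$ (r, s)" .
  qed (use GB FAc in \<open>auto simp: tensor_map_def kron_def\<close>)
qed

lemma mat_trace_mult_unit:
  assumes Y: "Y \<in> carrier_mat m m" and ij: "i < m" "j < m"
  shows "mat_trace (Y * mat_unit m i j) = Y $$ (j, i)"
proof -
  have "mat_trace (Y * mat_unit m i j) =
      (\<Sum>a<m. \<Sum>b = 0..<m. Y $$ (a, b) * (if b = i \<and> a = j then 1 else 0))"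
    using assms by (auto simp: mat_trace_def scalar_prod_def intro!: sum.cong)
  also have "\<dots> = (\<Sum>a<m. if a = j then Y $$ (a, i) else 0)"
  proof (intro sum.cong refl)
    fix a
    have "(\<Sum>b = 0..<m. Y $$ (a, b) * (if b = i \<and> a = j then 1 else 0)) =
        (\<Sum>b = 0..<m. if b = i then (if a = j then Y $$ (a, i) else 0) else 0)"
      by (intro sum.cong) auto
    then show "(\<Sum>b = 0..<m. Y $$ (a, b) * (if b = i \<and> a = j then 1 else 0)) =
        (if a = j then Y $$ (a, i) else 0)"
      using ij by simp
  qed
  finally show ?thesis using ij by simp
qed

lemma mat_trace_mult_right:
  assumes "X \<in> carrier_mat n n" "Z \<in> carrier_mat n n"
  shows "mat_trace (X * Z) = (\<Sum>a<n. \<Sum>b<n. X $$ (a, b) * Z $$ (b, a))"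
proof -
  have "(X * Z) $$ (a, a) = (\<Sum>b<n. X $$ (a, b) * Z $$ (b, a))" if "a < n" for a
    using assms that by (simp add: scalar_prod_def lessThan_atLeast0)
  then show ?thesis using assms by (simp add: mat_trace_def)
qed

lemma mat_trace_mult_mat_sum:
  assumes X: "X \<in> carrier_mat n n"
    and f: "\<And>i. i \<in> I \<Longrightarrow> f i \<in> carrier_mat n n"
  shows "mat_trace (X * mat_sum n n (\<lambda>i. c i \<cdot>\<^sub>m f i) I) = (\<Sum>i\<in>I. c i * mat_trace (X * f i))"
proof -
  have dims: "dim_row (f i) = n" "dim_col (f i) = n" if "i \<in> I" for i
    using f[OF that] by auto
  have "mat_trace (X * mat_sum n n (\<lambda>i. c i \<cdot>\<^sub>m f i) I) =
      (\<Sum>a<n. \<Sum>b<n. X $$ (a, b) * mat_sum n n (\<lambda>i. c i \<cdot>\<^sub>m f i) I $$ (b, a))"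
    by (rule mat_trace_mult_right[OF X]) (simp add: carrier_matI)
  also have "\<dots> = (\<Sum>a<n. \<Sum>b<n. \<Sum>i\<in>I. c i * (X $$ (a, b) * f i $$ (b, a)))"
  proof (intro sum.cong refl)
    fix a b assume "a \<in> {..<n}" "b \<in> {..<n}"
    then have ab: "a < n" "b < n" by auto
    show "X $$ (a, b) * mat_sum n n (\<lambda>i. c i \<cdot>\<^sub>m f i) I $$ (b, a) =
        (\<Sum>i\<in>I. c i * (X $$ (a, b) * f i $$ (b, a)))"
      unfolding mat_sum_index(1)[OF ab(2,1)] sum_distrib_left
      using dims ab by (intro sum.cong) auto
  qed
  also have "\<dots> = (\<Sum>a<n. \<Sum>i\<in>I. \<Sum>b<n. c i * (X $$ (a, b) * f i $$ (b, a)))"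
    by (intro sum.cong refl sum.swap)
  also have "\<dots> = (\<Sum>i\<in>I. \<Sum>a<n. \<Sum>b<n. c i * (X $$ (a, b) * f i $$ (b, a)))"
    by (rule sum.swap)
  also have "\<dots> = (\<Sum>i\<in>I. c i * mat_trace (X * f i))"
    by (intro sum.cong refl) (simp only: mat_trace_mult_right[OF X f] sum_distrib_left)
  finally show ?thesis .
qed

theorem dual_map:
  assumes F: "F \<in> mat_maps m n" and X: "X \<in> carrier_mat n n"
  shows "dual_map m F X \<in> carrier_mat m m"
    and "T \<in> carrier_mat m m \<Longrightarrow> mat_trace (dual_map m F X * T) = mat_trace (X * F T)"
proof -
  let ?P = "\<lambda>Y. Y \<in> carrier_mat m m \<and>
     (\<forall>T\<in>carrier_mat m m. mat_trace (Y * T) = mat_trace (X * F T))"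
  define D where "D = mat m m (\<lambda>(j, i). mat_trace (X * F (mat_unit m i j)))"
  have D: "D \<in> carrier_mat m m" by (simp add: D_def)
  have U: "mat_unit m i j \<in> carrier_mat m m" for i j by (simp add: carrier_matI)
  have "?P D"
  proof (intro conjI ballI D)
    fix T :: "complex mat" assume T: "T \<in> carrier_mat m m"
    let ?I = "{..<m} \<times> {..<m}"
    have TS: "T = mat_sum m m (\<lambda>p. T $$ p \<cdot>\<^sub>m mat_unit m (fst p) (snd p)) ?I"
      by (rule mat_unit_expansion[OF T, unfolded case_prod_unfold prod.collapse])
    have "mat_trace (D * T) = (\<Sum>p\<in>?I. T $$ p * mat_trace (D * mat_unit m (fst p) (snd p)))"
      by (subst TS, rule mat_trace_mult_mat_sum) (use D U in auto)
    also have "\<dots> = (\<Sum>p\<in>?I. T $$ p * mat_trace (X * F (mat_unit m (fst p) (snd p))))"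
    proof (intro sum.cong refl)
      fix p assume "p \<in> ?I"
      then have p: "fst p < m" "snd p < m" by auto
      then have "D $$ (snd p, fst p) = mat_trace (X * F (mat_unit m (fst p) (snd p)))"
        by (simp add: D_def)
      then show "T $$ p * mat_trace (D * mat_unit m (fst p) (snd p)) =
          T $$ p * mat_trace (X * F (mat_unit m (fst p) (snd p)))"
        by (simp only: mat_trace_mult_unit[OF D p])
    qed
    also have "\<dots> = mat_trace (X * mat_sum n n (\<lambda>p. T $$ p \<cdot>\<^sub>m F (mat_unit m (fst p) (snd p))) ?I)"
      by (rule mat_trace_mult_mat_sum[symmetric]) (use X F U in \<open>auto simp: mat_maps_iff\<close>)
    also have "mat_sum n n (\<lambda>p. T $$ p \<cdot>\<^sub>m F (mat_unit m (fst p) (snd p))) ?I =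
        F (mat_sum m m (\<lambda>p. T $$ p \<cdot>\<^sub>m mat_unit m (fst p) (snd p)) ?I)"
      using F U by (subst mat_maps_mat_sum[OF F]) (auto simp: mat_maps_iff)
    finally show "mat_trace (D * T) = mat_trace (X * F T)" by (simp only: TS[symmetric])
  qed
  moreover have "Y = D" if "?P Y" for Y
  proof (rule eq_matI)
    fix j i assume "j < dim_row D" "i < dim_col D"
    then have ij: "i < m" "j < m" using D by auto
    have "Y $$ (j, i) = mat_trace (X * F (mat_unit m i j))"
      using that ij U[of i j] mat_trace_mult_unit[of Y m i j] by simp
    then show "Y $$ (j, i) = D $$ (j, i)" using ij by (simp add: D_def)
  qed (use that D in auto)
  ultimately have "?P (THE Y. ?P Y)" by (rule theI)
  then have P: "?P (dual_map m F X)" unfolding dual_map_def .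
  show "dual_map m F X \<in> carrier_mat m m" using P by (rule conjunct1)
  show "mat_trace (dual_map m F X * T) = mat_trace (X * F T)" if "T \<in> carrier_mat m m"
    using P that by simp
qed

end

theory Submission
  imports Defs
begin

text \<open>
  Every condition is compared with the fourth one, called \<open>von_neumann_form\<close> below: \<open>\<Phi>\<close> measures in an
  orthonormal basis \<open>u\<close> and prepares a pure state \<open>v\<^sub>j\<close>.  Its Choi matrix is then the projection onto the span of
  orthonormal product vectors, which makes most implications that start from this form computations.

  \<^item> The decisive step leads from a projection as Choi matrix \<open>C\<close> back to the form
    (\<open>choi_projection_von_neumann_form\<close>).  By trace preservation \<open>I - C\<close> is a sum of conjugates of the
    partial transpose of \<open>C\<close>; since \<open>C (I - C) C = 0\<close> and the partial transpose is positive, \<open>C\<close> annihilates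
    every summand (\<open>choi_projection_exchange\<close>).  The resulting equations say that the blocks of \<open>C\<close>, as
    matrices on the input space, commute and that their joint eigenvalues form matrices of rank one.  A joint
    eigenbasis (\<open>joint_eigenbasis\<close>) gives \<open>u\<close>, and the eigenvalues give \<open>v\<close>.

  \<^item> An entanglement breaking map is a sum of maps \<open>X \<mapsto> \<langle>x\<^sub>k, X x\<^sub>k\<rangle> |y\<^sub>k><y\<^sub>k|\<close> (\<open>EB_eb_form\<close>).  If \<open>d\<^sub>1\<close> of them
    suffice, trace preservation says \<open>\<Sum> |x\<^sub>k><x\<^sub>k| = I\<close> for unit vectors \<open>y\<^sub>k\<close>, and \<open>d\<^sub>1\<close> such vectors \<open>x\<^sub>k\<close> are
    orthonormal.  No fewer than \<open>d\<^sub>1\<close> Kraus operators can represent a map whose Choi matrix has rank \<open>d\<^sub>1\<close>.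

  \<^item> The dual \<open>\<Psi>\<close> of a map of the form has the pure states of the \<open>v\<^sub>j\<close> on its diagonal.  The terms of a
    \<open>C\<^sup>*\<close>-convex decomposition are dominated by \<open>\<Psi>\<close>, hence built from the same states, and a polar
    decomposition of the coefficients shows that they are unitarily equivalent to \<open>\<Psi>\<close>
    (\<open>von_neumann_form_Cstar_extreme\<close>).  Conversely, write a \<open>C\<^sup>*\<close>-extreme \<open>\<Psi>\<close> as
    \<open>\<Sum> \<langle>a\<^sub>k, Y a\<^sub>k\<rangle> |b\<^sub>k><b\<^sub>k|\<close> with unit vectors \<open>a\<^sub>k\<close>.  Changing the weights of the terms and renormalizing gives
    unitarily equivalent maps, so the sum of all \<open>|\<langle>a\<^sub>k, a\<^sub>l\<rangle>|\<^sup>2 |\<langle>b\<^sub>k, b\<^sub>l\<rangle>|\<^sup>2\<close> stays the same.  When the weights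
    concentrate on a basis chosen from the \<open>b\<^sub>k\<close>, it tends to the largest possible value \<open>d\<^sub>1\<close>.  So it equals
    \<open>d\<^sub>1\<close>, which forces \<open>a\<^sub>k\<close> and \<open>a\<^sub>l\<close> to be parallel whenever \<open>b\<^sub>k\<close> and \<open>b\<^sub>l\<close> are not orthogonal, and then
    the Choi matrix is a projection (\<open>Cstar_extreme_choi_projection\<close>).

  \<^item> A map of the form is complementary to the Schur map of the Gram matrix of the \<open>v\<^sub>j\<close>, up to the unitary with
    columns \<open>u\<^sub>j\<close>; and since a Schur map with unit diagonal fixes the diagonal matrix units, every dilation of
    it sends \<open>e\<^sub>j\<close> to some \<open>e\<^sub>j \<otimes> v\<^sub>j\<close> (\<open>von_neumann_form_iff_schur_complement\<close>).

  \<^item> A unital map of the form is complementary to itself.  Conversely, if \<open>\<Gamma> \<circ> \<Phi>\<close> is complementary to a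
    unital \<open>\<Phi>\<close>, its Choi matrix is a projection and its partial transpose is positive, so the decisive step
    applies to it; its dilation is therefore \<open>u\<^sub>j \<mapsto> w\<^sub>j \<otimes> v\<^sub>j\<close> with orthonormal \<open>w\<^sub>j\<close>.  Positivity of the
    partial transpose for \<open>\<Phi>\<close> makes the \<open>v\<^sub>j\<close> orthogonal as well (\<open>complement_von_neumann_form\<close>).
\<close>

section \<open>Vectors, adjoints and orthonormal systems\<close>

lemma cinner_index:
  assumes "x \<in> carrier_vec d" "y \<in> carrier_vec d"
  shows "cinner x y = (\<Sum>i<d. cnj (x $ i) * y $ i)"
  using assms by (simp add: cinner_def scalar_prod_def lessThan_atLeast0 mult.commute)

lemma mat_adjoint_index [simp]:
  fixes A :: "complex mat"
  shows "i < dim_col A \<Longrightarrow> j < dim_row A \<Longrightarrow> mat_adjoint A $$ (i, j) = cnj (A $$ (j, i))"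
  and "dim_row (mat_adjoint A) = dim_col A"
  and "dim_col (mat_adjoint A) = dim_row A"
  by (auto simp: mat_adjoint_def mat_of_rows_def)

lemma mat_adjoint_carrier [simp]:
  fixes A :: "complex mat"
  shows "A \<in> carrier_mat m n \<Longrightarrow> mat_adjoint A \<in> carrier_mat n m"
  by auto

lemma mat_mult_entry:
  assumes "A \<in> carrier_mat p q" "B \<in> carrier_mat q r" "i < p" "j < r"
  shows "(A * B) $$ (i, j) = (\<Sum>k<q. A $$ (i, k) * B $$ (k, j))"
  using assms by (simp add: scalar_prod_def lessThan_atLeast0)

lemma mat_vec_entry:
  assumes "A \<in> carrier_mat p q" "x \<in> carrier_vec q" "i < p"
  shows "(A *\<^sub>v x) $ i = (\<Sum>k<q. A $$ (i, k) * x $ k)"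
  using assms by (simp add: scalar_prod_def lessThan_atLeast0)

lemma mat_adjoint_mult:
  fixes A B :: "complex mat"
  assumes "A \<in> carrier_mat p q" "B \<in> carrier_mat q r"
  shows "mat_adjoint (A * B) = mat_adjoint B * mat_adjoint A"
  using assms
  by (intro eq_matI) (auto simp: scalar_prod_def mult.commute intro!: sum.cong)

lemma mat_adjoint_adjoint [simp]: "mat_adjoint (mat_adjoint A) = (A :: complex mat)"
  by (intro eq_matI) auto

lemma cinner_adjoint:
  assumes "A \<in> carrier_mat p q" "x \<in> carrier_vec p" "y \<in> carrier_vec q"
  shows "cinner x (A *\<^sub>v y) = cinner (mat_adjoint A *\<^sub>v x) y"
proof -
  have "cinner x (A *\<^sub>v y) = (\<Sum>i<p. \<Sum>j<q. cnj (x $ i) * (A $$ (i, j) * y $ j))"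
    using assms mat_vec_entry[OF assms(1,3)]
    by (subst cinner_index[of _ p]) (auto simp: sum_distrib_left simp del: index_mult_mat_vec intro!: sum.cong)
  also have "\<dots> = (\<Sum>j<q. \<Sum>i<p. cnj (x $ i) * (A $$ (i, j) * y $ j))"
    by (rule sum.swap)
  also have "\<dots> = cinner (mat_adjoint A *\<^sub>v x) y"
  proof -
    have "(mat_adjoint A *\<^sub>v x) $ j = (\<Sum>i<p. cnj (A $$ (i, j)) * x $ i)" if "j < q" for j
      using assms that by (subst mat_vec_entry[of _ q p]) auto
    moreover have "mat_adjoint A *\<^sub>v x \<in> carrier_vec q" using assms(1) by (intro carrier_vecI) simp
    ultimately show ?thesis
      using assms by (subst cinner_index[of _ q])
        (auto simp: sum_distrib_left mult_ac simp del: index_mult_mat_vec intro!: sum.cong)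
  qed
  finally show ?thesis .
qed

lemma cinner_cnj:
  assumes "x \<in> carrier_vec d" "y \<in> carrier_vec d"
  shows "cnj (cinner x y) = cinner y x"
  using assms by (simp add: cinner_index mult.commute)

lemma cinner_self:
  assumes "x \<in> carrier_vec d"
  shows "cinner x x = of_real (\<Sum>i<d. (cmod (x $ i))\<^sup>2)"
  using assms
  by (simp add: cinner_index complex_norm_square[symmetric] mult.commute)

lemma cinner_self_eq_0:
  assumes "x \<in> carrier_vec d" "cinner x x = 0"
  shows "x = 0\<^sub>v d"
proof (rule eq_vecI)
  have "(\<Sum>i<d. (cmod (x $ i))\<^sup>2) = 0"
    using assms cinner_self[OF assms(1)] of_real_eq_0_iff by metis
  then show "x $ i = 0\<^sub>v d $ i" if "i < dim_vec (0\<^sub>v d)" for i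
    using that by (simp add: sum_nonneg_eq_0_iff)
qed (use assms in simp)

definition orthonormal :: "nat \<Rightarrow> (nat \<Rightarrow> complex vec) \<Rightarrow> bool" where
  "orthonormal d u \<longleftrightarrow> (\<forall>i<d. u i \<in> carrier_vec d) \<and>
     (\<forall>i<d. \<forall>j<d. cinner (u i) (u j) = (if i = j then 1 else 0))"

text \<open>One-sided inverses of square matrices are two-sided.\<close>
lemma square_isometry:
  fixes f :: "nat \<Rightarrow> nat \<Rightarrow> complex"
  assumes "\<And>i k. i < d \<Longrightarrow> k < d \<Longrightarrow> (\<Sum>j<d. f j i * cnj (f j k)) = (if i = k then 1 else 0)"
    and "j < d" "l < d"
  shows "(\<Sum>i<d. cnj (f j i) * f l i) = (if j = l then 1 else 0)"
proof -
  let ?A = "mat d d (\<lambda>(i, j). f j i)" and ?B = "mat d d (\<lambda>(j, i). cnj (f j i))"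
  have "?A * ?B = 1\<^sub>m d"
    using assms(1) by (intro eq_matI) (auto simp: scalar_prod_def lessThan_atLeast0)
  then have "?B * ?A = 1\<^sub>m d"
    by (rule mat_mult_left_right_inverse[rotated 2]) auto
  then have "(?B * ?A) $$ (j, l) = 1\<^sub>m d $$ (j, l)" by simp
  then show ?thesis using assms(2,3) by (simp add: scalar_prod_def lessThan_atLeast0)
qed

lemma orthonormal_complete:
  assumes "orthonormal d u" "i < d" "k < d"
  shows "(\<Sum>j<d. u j $ i * cnj (u j $ k)) = (if i = k then 1 else 0)"
proof -
  have "(\<Sum>i<d. cnj (u j $ i) * u l $ i) = (if j = l then 1 else 0)" if "j < d" "l < d" for j l
    using assms(1) that by (simp add: orthonormal_def cinner_index[symmetric])
  then have "(\<Sum>j<d. cnj (cnj (u j $ i)) * cnj (u j $ k)) = (if i = k then 1 else 0)"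
    using assms(2,3)
    by (intro square_isometry[where f = "\<lambda>i j. cnj (u j $ i)"]) auto
  then show ?thesis by simp
qed

lemma orthonormalI:
  assumes "\<And>j. j < d \<Longrightarrow> u j \<in> carrier_vec d"
    and "\<And>i k. i < d \<Longrightarrow> k < d \<Longrightarrow> (\<Sum>j<d. u j $ i * cnj (u j $ k)) = (if i = k then 1 else 0)"
  shows "orthonormal d u"
  unfolding orthonormal_def
  using assms(1) square_isometry[where f = "\<lambda>j i. u j $ i", OF assms(2)]
  by (auto simp: cinner_index[of _ d])

text \<open>The matrix with rows \<open>u\<^sub>j\<close> times its adjoint is the identity; so its determinant is nonzero, its rows are
  linearly independent, and there are as many of them as the dimension.\<close>
lemma orthonormal_basis_iff: "orthonormal_basis d u \<longleftrightarrow> orthonormal d u"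
proof
  assume u: "orthonormal d u"
  interpret vec_space "TYPE(complex)" d .
  have uc: "u j \<in> carrier_vec d" if "j < d" for j using u that by (auto simp: orthonormal_def)
  have ui: "cinner (u i) (u j) = (if i = j then 1 else 0)" if "i < d" "j < d" for i j
    using u that by (auto simp: orthonormal_def)
  have inj: "inj_on u {..<d}" using ui by (intro inj_onI) (metis lessThan_iff zero_neq_one)
  define A where "A = mat d d (\<lambda>(i, j). u i $ j)"
  have A: "A \<in> carrier_mat d d" by (simp add: A_def)
  have "A * mat_adjoint A = 1\<^sub>m d"
  proof (rule eq_matI)
    fix i j assume "i < dim_row (1\<^sub>m d :: complex mat)" "j < dim_col (1\<^sub>m d :: complex mat)"
    then have ij: "i < d" "j < d" by auto
    have "(A * mat_adjoint A) $$ (i, j) = cinner (u j) (u i)"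
      using ij uc by (subst mat_mult_entry[of _ d d]) (auto simp: A_def cinner_index[of _ d] mult.commute)
    then show "(A * mat_adjoint A) $$ (i, j) = 1\<^sub>m d $$ (i, j)" using ij ui by auto
  qed (auto simp: A_def)
  then have "det A * det (mat_adjoint A) = 1"
    using det_mult[of A d "mat_adjoint A"] A by simp
  then have "lin_indpt (set (rows A))" using A by (intro det_not_0_imp_lin_indpt_rows) auto
  moreover have "set (rows A) = u ` {..<d}"
  proof -
    have "row A i = u i" if "i < d" for i
      using that uc[OF that] by (intro eq_vecI) (auto simp: A_def)
    then show ?thesis using A by (auto simp: rows_def)
  qed
  ultimately have "lin_indpt (u ` {..<d})" by simp
  moreover have "card (u ` {..<d}) = dim" using inj by (simp add: card_image dim_is_n)
  ultimately have "basis (u ` {..<d})" using uc by (intro dim_li_is_basis) auto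
  then show "orthonormal_basis d u" using u by (simp add: orthonormal_basis_def orthonormal_def)
qed (simp add: orthonormal_basis_def orthonormal_def)

text \<open>Padded with zero rows to a square matrix, the system has determinant zero.\<close>
lemma homogeneous_system_nontrivial:
  fixes A :: "nat \<Rightarrow> nat \<Rightarrow> complex"
  assumes "k < d"
  obtains x where "x \<in> carrier_vec d" "x \<noteq> 0\<^sub>v d" "\<And>r. r < k \<Longrightarrow> (\<Sum>i<d. A r i * x $ i) = 0"
proof -
  define M where "M = mat d d (\<lambda>(r, i). if r < k then A r i else 0)"
  have M: "M \<in> carrier_mat d d" by (simp add: M_def)
  have "M = mat\<^sub>r d d (\<lambda>r. if r = k then 0\<^sub>v d else row M r)"
    using assms by (intro eq_matI) (auto simp: M_def)
  moreover have "row M \<in> {0..<d} \<rightarrow> carrier_vec d" using M by auto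
  ultimately have "det M = 0" using det_row_0[OF assms, of "row M"] by simp
  then obtain x where x: "x \<in> carrier_vec d" "x \<noteq> 0\<^sub>v d" "M *\<^sub>v x = 0\<^sub>v d"
    using det_0_iff_vec_prod_zero[OF M] by auto
  have "(\<Sum>i<d. A r i * x $ i) = 0" if "r < k" for r
  proof -
    have "(\<Sum>i<d. A r i * x $ i) = (M *\<^sub>v x) $ r"
      using that assms x by (subst mat_vec_entry[OF M]) (auto simp: M_def intro!: sum.cong)
    then show ?thesis using x that assms by simp
  qed
  with x show ?thesis using that by blast
qed

section \<open>Joint eigenbases of commuting matrices\<close>

lemma cinner_add_right:
  assumes "x \<in> carrier_vec d" "y \<in> carrier_vec d" "z \<in> carrier_vec d"
  shows "cinner x (y + z) = cinner x y + cinner x z"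
  using assms by (simp add: cinner_index[of _ d] algebra_simps sum.distrib)

lemma cinner_smult_right:
  assumes "x \<in> carrier_vec d" "y \<in> carrier_vec d"
  shows "cinner x (c \<cdot>\<^sub>v y) = c * cinner x y"
  using assms by (simp add: cinner_index[of _ d] sum_distrib_left mult_ac)

lemma cinner_smult_left:
  assumes "x \<in> carrier_vec d" "y \<in> carrier_vec d"
  shows "cinner (c \<cdot>\<^sub>v x) y = cnj c * cinner x y"
  using assms by (simp add: cinner_index[of _ d] sum_distrib_left mult_ac)

lemma normalizing_scalar:
  assumes "x \<in> carrier_vec d" "x \<noteq> 0\<^sub>v d"
  obtains s :: real where "s \<noteq> 0" "cinner (of_real (1 / s) \<cdot>\<^sub>v x) (of_real (1 / s) \<cdot>\<^sub>v x) = 1"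
proof -
  define s where "s = sqrt (\<Sum>i<d. (cmod (x $ i))\<^sup>2)"
  have xs: "cinner x x = of_real (s\<^sup>2)"
    unfolding s_def cinner_self[OF assms(1)] by (simp add: sum_nonneg)
  have s: "s \<noteq> 0" using xs cinner_self_eq_0[OF assms(1)] assms(2) by auto
  moreover have "cinner (of_real (1 / s) \<cdot>\<^sub>v x) (of_real (1 / s) \<cdot>\<^sub>v x) = 1"
    using s assms(1) by (simp add: cinner_smult_left[of _ d] cinner_smult_right[of _ d] xs power2_eq_square)
  ultimately show ?thesis by (rule that)
qed

definition linear_subspace :: "nat \<Rightarrow> complex vec set \<Rightarrow> bool" where
  "linear_subspace d V \<longleftrightarrow> V \<subseteq> carrier_vec d \<and> (\<forall>x\<in>V. \<forall>y\<in>V. x + y \<in> V) \<and> (\<forall>c. \<forall>x\<in>V. c \<cdot>\<^sub>v x \<in> V)"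

text \<open>If \<open>H = P B Q\<close> with \<open>Q = P\<^sup>-\<^sup>1\<close> and \<open>B\<close> upper triangular, then \<open>H - b\<^sub>k\<^sub>k\<close> maps the vectors whose
  \<open>Q\<close>-coordinates vanish beyond position \<open>k\<close> to those whose \<open>Q\<close>-coordinates vanish from position \<open>k\<close>
  on.  Started inside an invariant subspace, this descent must reach zero, and the vector
  before the first zero is an eigenvector in that subspace.\<close>
lemma eigenvector_in_invariant_subspace:
  assumes H: "H \<in> carrier_mat d d" and V: "linear_subspace d V"
    and inv: "\<And>x. x \<in> V \<Longrightarrow> H *\<^sub>v x \<in> V"
    and v: "v \<in> V" "v \<noteq> 0\<^sub>v d"
  obtains w e where "w \<in> V" "w \<noteq> 0\<^sub>v d" "H *\<^sub>v w = e \<cdot>\<^sub>v w"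
proof -
  from char_poly_factorized[OF H] obtain es where es: "char_poly H = (\<Prod>e\<leftarrow>es. [:- e, 1:])" by blast
  from schur_decomposition_exists[OF H es] obtain B where B: "B \<in> carrier_mat d d"
    and ut: "upper_triangular B" and sim: "similar_mat H B" by blast
  from sim obtain P Q where "similar_mat_wit H B P Q" by (auto simp: similar_mat_def)
  from similar_mat_witD2[OF H this]
  have PQ: "P * Q = 1\<^sub>m d" "Q * P = 1\<^sub>m d" "H = P * B * Q" "P \<in> carrier_mat d d" "Q \<in> carrier_mat d d"
    by auto
  have QH: "Q *\<^sub>v (H *\<^sub>v x) = B *\<^sub>v (Q *\<^sub>v x)" if x: "x \<in> carrier_vec d" for x
  proof -
    have "Q *\<^sub>v (H *\<^sub>v x) = (Q * H) *\<^sub>v x" using H PQ x by (simp add: assoc_mult_mat_vec)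
    also have "Q * H = (Q * P) * B * Q"
      using PQ(4,5) B unfolding PQ(3) by (simp add: assoc_mult_mat[of _ d d _ d _ d])
    also have "\<dots> = B * Q" using PQ(2) B by simp
    also have "(B * Q) *\<^sub>v x = B *\<^sub>v (Q *\<^sub>v x)" using B PQ x by (simp add: assoc_mult_mat_vec)
    finally show ?thesis .
  qed
  have "\<exists>w e. w \<in> V \<and> w \<noteq> 0\<^sub>v d \<and> H *\<^sub>v w = e \<cdot>\<^sub>v w"
    if "k \<le> d" "x \<in> V" "x \<noteq> 0\<^sub>v d" "\<And>i. k \<le> i \<Longrightarrow> i < d \<Longrightarrow> (Q *\<^sub>v x) $ i = 0" for k x
    using that
  proof (induction k arbitrary: x)
    case 0
    have x: "x \<in> carrier_vec d" using 0 V by (auto simp: linear_subspace_def)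
    have "Q *\<^sub>v x = 0\<^sub>v d" using 0(4) PQ by (intro eq_vecI) auto
    then have "P *\<^sub>v (Q *\<^sub>v x) = 0\<^sub>v d" using PQ by (auto intro: eq_vecI)
    moreover have "(P * Q) *\<^sub>v x = P *\<^sub>v (Q *\<^sub>v x)" by (rule assoc_mult_mat_vec[OF PQ(4,5) x])
    ultimately have "x = 0\<^sub>v d" using x unfolding PQ(1) by simp
    then show ?case using 0 by simp
  next
    case (Suc k)
    have x: "x \<in> carrier_vec d" using Suc.prems V by (auto simp: linear_subspace_def)
    let ?e = "B $$ (k, k)"
    let ?y = "H *\<^sub>v x + (- ?e) \<cdot>\<^sub>v x"
    have Hx: "H *\<^sub>v x \<in> carrier_vec d" using H x by simp
    have yV: "?y \<in> V" using Suc.prems inv V by (auto simp: linear_subspace_def)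
    show ?case
    proof (cases "?y = 0\<^sub>v d")
      case True
      have "H *\<^sub>v x = ?e \<cdot>\<^sub>v x"
      proof (rule eq_vecI)
        fix i assume "i < dim_vec (?e \<cdot>\<^sub>v x)"
        then have i: "i < d" using x by simp
        have "?y $ i = 0" using True i by simp
        then show "(H *\<^sub>v x) $ i = (?e \<cdot>\<^sub>v x) $ i" using i x Hx H by simp
      qed (use x H in simp)
      then show ?thesis using Suc.prems by blast
    next
      case False
      have Qy: "Q *\<^sub>v ?y = B *\<^sub>v (Q *\<^sub>v x) + (- ?e) \<cdot>\<^sub>v (Q *\<^sub>v x)"
        using Hx x PQ QH[OF x] by (simp add: mult_add_distrib_mat_vec[of _ d d] mult_mat_vec[of _ d d])
      have Qx: "Q *\<^sub>v x \<in> carrier_vec d" using PQ x by simp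
      have "(Q *\<^sub>v ?y) $ i = 0" if i: "k \<le> i" "i < d" for i
      proof -
        have "(B *\<^sub>v (Q *\<^sub>v x)) $ i = (\<Sum>j<d. B $$ (i, j) * (Q *\<^sub>v x) $ j)"
          by (rule mat_vec_entry[OF B Qx i(2)])
        also have "\<dots> = (\<Sum>j<d. if j = k then B $$ (i, k) * (Q *\<^sub>v x) $ k else 0)"
        proof (intro sum.cong refl)
          fix j assume "j \<in> {..<d}"
          then have j: "j < d" by simp
          show "B $$ (i, j) * (Q *\<^sub>v x) $ j = (if j = k then B $$ (i, k) * (Q *\<^sub>v x) $ k else 0)"
          proof (cases j k rule: linorder_cases)
            case less
            then have "B $$ (i, j) = 0" using i B ut by (intro upper_triangularD) auto
            then show ?thesis using less by simp
          qed (use Suc.prems(4) j in auto)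
        qed
        also have "\<dots> = B $$ (i, k) * (Q *\<^sub>v x) $ k" using i by simp
        also have "\<dots> = ?e * (Q *\<^sub>v x) $ i"
        proof (cases "i = k")
          case False
          then have "B $$ (i, k) = 0" using i B ut by (intro upper_triangularD) auto
          then show ?thesis using Suc.prems(4)[of i] i False by simp
        qed simp
        finally show ?thesis
          unfolding Qy using i Qx B PQ(5) by (simp del: index_mult_mat_vec)
      qed
      then show ?thesis using Suc.IH[OF _ yV False] Suc.prems(1) by auto
    qed
  qed
  from this[of d v] v that show ?thesis by auto
qed

text \<open>The family is finite, so it can be treated one matrix at a time: the subspace shrinks to the eigenspace
  of the first matrix, where the remaining ones still act.\<close>
lemma joint_eigenvector:
  assumes fin: "finite \<H>" and H: "\<And>H. H \<in> \<H> \<Longrightarrow> H \<in> carrier_mat d d"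
    and comm: "\<And>H K. H \<in> \<H> \<Longrightarrow> K \<in> \<H> \<Longrightarrow> H * K = K * H"
    and V: "linear_subspace d V" "v \<in> V" "v \<noteq> 0\<^sub>v d"
    and inv: "\<And>H x. H \<in> \<H> \<Longrightarrow> x \<in> V \<Longrightarrow> H *\<^sub>v x \<in> V"
  shows "\<exists>w\<in>V. w \<noteq> 0\<^sub>v d \<and> (\<forall>H\<in>\<H>. \<exists>e. H *\<^sub>v w = e \<cdot>\<^sub>v w)"
  using fin H comm V inv
proof (induction \<H> arbitrary: V v rule: finite_induct)
  case (insert H \<H>)
  from eigenvector_in_invariant_subspace[of H d V v] insert.prems
  obtain w e where w: "w \<in> V" "w \<noteq> 0\<^sub>v d" "H *\<^sub>v w = e \<cdot>\<^sub>v w" by blast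
  have Hc: "H \<in> carrier_mat d d" and Vc: "V \<subseteq> carrier_vec d"
    using insert.prems by (auto simp: linear_subspace_def)
  \<comment> \<open>The eigenspace of \<open>H\<close> inside \<open>V\<close> is invariant under whatever commutes with \<open>H\<close>.\<close>
  let ?W = "{x\<in>V. H *\<^sub>v x = e \<cdot>\<^sub>v x}"
  have "linear_subspace d ?W"
    using insert.prems(3) Hc Vc unfolding linear_subspace_def
    by (auto simp: mult_add_distrib_mat_vec[of _ d d] mult_mat_vec[of _ d d] smult_add_distrib_vec[of _ d]
        subset_iff smult_smult_assoc mult.commute)
  moreover have "K *\<^sub>v x \<in> ?W" if K: "K \<in> \<H>" and x: "x \<in> ?W" for K x
  proof -
    have Kc: "K \<in> carrier_mat d d" and xc: "x \<in> carrier_vec d" using K x Vc insert.prems by auto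
    have "H *\<^sub>v (K *\<^sub>v x) = (H * K) *\<^sub>v x" using Hc Kc xc by (simp add: assoc_mult_mat_vec)
    also have "H * K = K * H" using K insert.prems by auto
    also have "(K * H) *\<^sub>v x = e \<cdot>\<^sub>v (K *\<^sub>v x)"
      using Hc Kc xc x by (simp add: assoc_mult_mat_vec mult_mat_vec)
    finally show ?thesis using x K insert.prems by auto
  qed
  ultimately have "\<exists>w\<in>?W. w \<noteq> 0\<^sub>v d \<and> (\<forall>H\<in>\<H>. \<exists>e. H *\<^sub>v w = e \<cdot>\<^sub>v w)"
    using insert.IH[of ?W w] insert.prems w by auto
  then show ?case by blast
qed auto

text \<open>Orthonormal joint eigenvectors are collected one by one.  Since the family is closed under adjoints, it
  leaves the orthogonal complement of joint eigenvectors invariant, and a new one is found there.\<close>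
theorem joint_eigenbasis:
  assumes fin: "finite \<H>" and H: "\<And>H. H \<in> \<H> \<Longrightarrow> H \<in> carrier_mat d d"
    and comm: "\<And>H K. H \<in> \<H> \<Longrightarrow> K \<in> \<H> \<Longrightarrow> H * K = K * H"
    and adj: "\<And>H. H \<in> \<H> \<Longrightarrow> mat_adjoint H \<in> \<H>"
  obtains u where "orthonormal d u" "\<And>H j. H \<in> \<H> \<Longrightarrow> j < d \<Longrightarrow> \<exists>e. H *\<^sub>v u j = e \<cdot>\<^sub>v u j"
proof -
  let ?P = "\<lambda>k u. (\<forall>i<k. u i \<in> carrier_vec d) \<and>
     (\<forall>i<k. \<forall>j<k. cinner (u i) (u j) = (if i = j then 1 else 0)) \<and>
     (\<forall>H\<in>\<H>. \<forall>i<k. \<exists>e. H *\<^sub>v u i = e \<cdot>\<^sub>v u i)"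
  have "\<exists>u. ?P k u" if "k \<le> d" for k
    using that
  proof (induction k)
    case (Suc k)
    then obtain u where u: "?P k u" by auto
    then have uc: "u i \<in> carrier_vec d" if "i < k" for i using that by auto
    let ?V = "{x\<in>carrier_vec d. \<forall>i<k. cinner (u i) x = 0}"
    obtain x where x: "x \<in> carrier_vec d" "x \<noteq> 0\<^sub>v d"
        "\<And>r. r < k \<Longrightarrow> (\<Sum>i<d. cnj (u r $ i) * x $ i) = 0"
      using homogeneous_system_nontrivial[of k d "\<lambda>r i. cnj (u r $ i)"] Suc.prems by auto
    have xV: "x \<in> ?V" using x uc by (auto simp: cinner_index[of _ d])
    have V: "linear_subspace d ?V"
      using uc by (auto simp: linear_subspace_def cinner_add_right[of _ d] cinner_smult_right[of _ d])
    have inv: "H *\<^sub>v y \<in> ?V" if Hh: "H \<in> \<H>" and y: "y \<in> ?V" for H y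
    proof -
      have "cinner (u i) (H *\<^sub>v y) = 0" if i: "i < k" for i
      proof -
        obtain e where e: "mat_adjoint H *\<^sub>v u i = e \<cdot>\<^sub>v u i" using u adj[OF Hh] i by blast
        have "cinner (u i) (H *\<^sub>v y) = cinner (mat_adjoint H *\<^sub>v u i) y"
          using y uc[OF i] H[OF Hh] by (intro cinner_adjoint) auto
        then show ?thesis using e y uc i by (simp add: cinner_smult_left[of _ d])
      qed
      then show ?thesis using y H[OF Hh] by simp
    qed
    from joint_eigenvector[OF fin H comm V xV x(2) inv]
    obtain w where w: "w \<in> ?V" "w \<noteq> 0\<^sub>v d" and ev: "\<forall>H\<in>\<H>. \<exists>e. H *\<^sub>v w = e \<cdot>\<^sub>v w" by blast
    have wc: "w \<in> carrier_vec d" using w by auto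
    obtain s :: real where nrm: "cinner (of_real (1 / s) \<cdot>\<^sub>v w) (of_real (1 / s) \<cdot>\<^sub>v w) = 1"
      by (rule normalizing_scalar[OF wc w(2)])
    define u' where "u' = u(k := of_real (1 / s) \<cdot>\<^sub>v w)"
    have "\<exists>e. H *\<^sub>v u' i = e \<cdot>\<^sub>v u' i" if Hh: "H \<in> \<H>" and i: "i < Suc k" for H i
    proof (cases "i = k")
      case True
      obtain e where "H *\<^sub>v w = e \<cdot>\<^sub>v w" using ev Hh by auto
      then have "H *\<^sub>v u' i = e \<cdot>\<^sub>v u' i"
        using True H[OF Hh] wc by (simp add: u'_def mult_mat_vec[of _ d d] smult_smult_assoc mult.commute)
      then show ?thesis ..
    qed (use u i Hh in \<open>auto simp: u'_def\<close>)
    moreover have "cinner (u' i) (u' j) = (if i = j then 1 else 0)" if ij: "i < Suc k" "j < Suc k" for i j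
    proof -
      have a: "cinner (u l) w = 0" "cinner w (u l) = 0" if "l < k" for l
        using w that cinner_cnj[OF uc[OF that] wc] by auto
      show ?thesis
        using ij u uc wc a nrm
        by (auto simp: u'_def less_Suc_eq cinner_smult_left[of _ d] cinner_smult_right[of _ d])
    qed
    moreover have "\<forall>i<Suc k. u' i \<in> carrier_vec d" using uc wc by (auto simp: u'_def less_Suc_eq)
    ultimately show ?case by blast
  qed simp
  from this[of d] obtain u where "?P d u" by auto
  then show ?thesis using that[of u] by (auto simp: orthonormal_def)
qed

section \<open>Positive semidefinite kernels\<close>

text \<open>Working with kernels on arbitrary finite index sets avoids the position arithmetic that
  matrices on tensor products require.\<close>
definition sesq :: "'s set \<Rightarrow> ('s \<Rightarrow> 's \<Rightarrow> complex) \<Rightarrow> ('s \<Rightarrow> complex) \<Rightarrow> ('s \<Rightarrow> complex) \<Rightarrow> complex" where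
  "sesq S K x y = (\<Sum>s\<in>S. \<Sum>t\<in>S. cnj (x s) * K s t * y t)"

definition psd_kernel :: "'s set \<Rightarrow> ('s \<Rightarrow> 's \<Rightarrow> complex) \<Rightarrow> bool" where
  "psd_kernel S K \<longleftrightarrow> (\<forall>z. 0 \<le> sesq S K z z)"

lemma sesq_add_scaled:
  "sesq S K (\<lambda>s. x s + c * y s) (\<lambda>s. x s + c * y s) =
    sesq S K x x + c * sesq S K x y + cnj c * sesq S K y x + c * cnj c * sesq S K y y"
  unfolding sesq_def sum_distrib_left sum.distrib[symmetric]
  by (intro sum.cong refl) (simp add: algebra_simps)

lemma sesq_delta_left:
  assumes "finite S" "s \<in> S"
  shows "sesq S K (\<lambda>r. if r = s then 1 else 0) y = (\<Sum>t\<in>S. K s t * y t)"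
proof -
  have "sesq S K (\<lambda>r. if r = s then 1 else 0) y = (\<Sum>r\<in>S. if r = s then (\<Sum>t\<in>S. K s t * y t) else 0)"
    unfolding sesq_def by (intro sum.cong refl) auto
  then show ?thesis using assms by simp
qed

lemma sum_delta_mult:
  assumes "finite S" "s \<in> S"
  shows "(\<Sum>t\<in>S. f t * (if t = s then 1 else 0)) = (f s :: complex)"
proof -
  have "(\<Sum>t\<in>S. f t * (if t = s then 1 else 0)) = (\<Sum>t\<in>S. if t = s then f s else 0)"
    by (intro sum.cong refl) auto
  then show ?thesis using assms by simp
qed

text \<open>The choices \<open>c = 1\<close> and \<open>c = \<i>\<close> compare \<open>b\<close> with \<open>b'\<close>.  If \<open>a = 0\<close>, then for small \<open>t > 0\<close> the choice
  \<open>c = - t b\<^sup>*\<close> would make the value negative, the linear term beating the quadratic one.\<close>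
lemma quadratic_hermitian:
  fixes a b b' e :: complex
  assumes "\<And>c. 0 \<le> a + c * b + cnj c * b' + c * cnj c * e" and "0 \<le> e"
  shows "b' = cnj b" and "a = 0 \<Longrightarrow> b = 0"
proof -
  have a: "Im a = 0" and e: "Im e = 0" "0 \<le> Re e"
    using assms(1)[of 0] assms(2) by (auto simp: less_eq_complex_def)
  show b': "b' = cnj b"
    using assms(1)[of 1] assms(1)[of "\<i>"] a e by (auto simp: less_eq_complex_def complex_eq_iff)
  show "b = 0" if "a = 0"
  proof -
    define t where "t = 1 / (Re e + 1)"
    have t: "0 < t" "t * Re e < 1" using e by (auto simp: t_def)
    have "0 \<le> Re (a + (- of_real t * cnj b) * b + cnj (- of_real t * cnj b) * b' +
        (- of_real t * cnj b) * cnj (- of_real t * cnj b) * e)"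
      using assms(1)[of "- of_real t * cnj b"] by (simp add: less_eq_complex_def)
    also have "\<dots> = (t * (cmod b)\<^sup>2) * (t * Re e - 2)"
      using that e unfolding b' cmod_power2
      by (simp add: power2_eq_square algebra_simps)
    finally have "0 \<le> (t * (cmod b)\<^sup>2) * (t * Re e - 2)" .
    then have "t * (cmod b)\<^sup>2 \<le> 0" using t by (auto simp: zero_le_mult_iff)
    then show "b = 0" using t(1) by (auto simp: mult_le_0_iff)
  qed
qed

lemma psd_kernel_sesq:
  assumes "psd_kernel S K"
  shows "sesq S K y x = cnj (sesq S K x y)" and "sesq S K x x = 0 \<Longrightarrow> sesq S K x y = 0"
proof -
  have *: "0 \<le> sesq S K x x + c * sesq S K x y + cnj c * sesq S K y x + c * cnj c * sesq S K y y" for c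
    using assms unfolding psd_kernel_def sesq_add_scaled[symmetric] by blast
  have "0 \<le> sesq S K y y" using assms by (simp add: psd_kernel_def)
  from quadratic_hermitian[OF * this] show "sesq S K y x = cnj (sesq S K x y)"
    and "sesq S K x x = 0 \<Longrightarrow> sesq S K x y = 0" by auto
qed

lemma psd_kernel_diag:
  assumes "psd_kernel S K" "finite S" "s \<in> S"
  shows "0 \<le> K s s"
  using assms(1) sesq_delta_left[OF assms(2,3), of K "\<lambda>r. if r = s then 1 else 0"]
    sum_delta_mult[OF assms(2,3), of "K s"]
  unfolding psd_kernel_def by metis

lemma psd_kernel_hermitian:
  assumes "psd_kernel S K" "finite S" "s \<in> S" "t \<in> S"
  shows "K t s = cnj (K s t)"
  using psd_kernel_sesq(1)[OF assms(1), of "\<lambda>r. if r = t then 1 else 0" "\<lambda>r. if r = s then 1 else 0"]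
  by (simp add: sesq_delta_left[OF assms(2)] sum_delta_mult[OF assms(2)] assms(3,4))

lemma psd_kernel_null:
  assumes "psd_kernel S K" "finite S" "s \<in> S" "sesq S K x x = 0"
  shows "(\<Sum>t\<in>S. K s t * x t) = 0"
  using psd_kernel_sesq(1)[OF assms(1), where x = x and y = "\<lambda>r. if r = s then 1 else 0"]
    psd_kernel_sesq(2)[OF assms(1), where x = x and y = "\<lambda>r. if r = s then 1 else 0"] assms(4)
  by (simp add: sesq_delta_left[OF assms(2,3)])

lemma sesq_gram:
  assumes "\<And>s t. s \<in> S \<Longrightarrow> t \<in> S \<Longrightarrow> K s t = (\<Sum>k\<in>I. w k s * cnj (w k t))"
  shows "sesq S K z z = of_real (\<Sum>k\<in>I. (cmod (\<Sum>t\<in>S. cnj (w k t) * z t))\<^sup>2)"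
proof -
  have "sesq S K z z = (\<Sum>s\<in>S. \<Sum>t\<in>S. \<Sum>k\<in>I. (cnj (z s) * w k s) * (cnj (w k t) * z t))"
    unfolding sesq_def using assms by (auto simp: sum_distrib_left sum_distrib_right mult_ac intro!: sum.cong)
  also have "\<dots> = (\<Sum>s\<in>S. \<Sum>k\<in>I. \<Sum>t\<in>S. (cnj (z s) * w k s) * (cnj (w k t) * z t))"
    by (intro sum.cong refl sum.swap)
  also have "\<dots> = (\<Sum>k\<in>I. \<Sum>s\<in>S. \<Sum>t\<in>S. (cnj (z s) * w k s) * (cnj (w k t) * z t))"
    by (rule sum.swap)
  also have "\<dots> = (\<Sum>k\<in>I. cnj (\<Sum>t\<in>S. cnj (w k t) * z t) * (\<Sum>t\<in>S. cnj (w k t) * z t))"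
    unfolding cnj_sum sum_product by (simp add: mult_ac)
  also have "\<dots> = of_real (\<Sum>k\<in>I. (cmod (\<Sum>t\<in>S. cnj (w k t) * z t))\<^sup>2)"
    unfolding of_real_sum complex_norm_square by (simp add: mult.commute)
  finally show ?thesis .
qed

lemma psd_kernel_gramI:
  assumes "\<And>s t. s \<in> S \<Longrightarrow> t \<in> S \<Longrightarrow> K s t = (\<Sum>k\<in>I. w k s * cnj (w k t))"
  shows "psd_kernel S K"
  unfolding psd_kernel_def
proof
  fix z
  have "sesq S K z z = of_real (\<Sum>k\<in>I. (cmod (\<Sum>t\<in>S. cnj (w k t) * z t))\<^sup>2)"
    by (rule sesq_gram[OF assms])
  then show "0 \<le> sesq S K z z" by (simp add: less_eq_complex_def sum_nonneg)
qed

lemma psd_kernel_subset: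
  assumes "psd_kernel S K" "finite S" "T \<subseteq> S"
  shows "psd_kernel T K"
  unfolding psd_kernel_def
proof
  fix z :: "'a \<Rightarrow> complex"
  let ?z = "\<lambda>s. if s \<in> T then z s else 0"
  have "sesq S K ?z ?z = sesq T K z z"
  proof -
    have inner: "(\<Sum>t\<in>S. cnj (?z s) * K s t * ?z t) = (\<Sum>t\<in>T. cnj (?z s) * K s t * z t)" for s
      by (rule sum.mono_neutral_cong_right[OF assms(2,3)]) auto
    show ?thesis
      unfolding sesq_def inner by (rule sum.mono_neutral_cong_right[OF assms(2,3)]) auto
  qed
  then show "0 \<le> sesq T K z z" using assms(1) by (metis psd_kernel_def)
qed

text \<open>This is the Cholesky decomposition: one index is split off at a time and the Schur complement
  \<open>K'\<close> of its diagonal entry is again positive semidefinite.\<close>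
lemma psd_kernel_gram:
  assumes "finite S" "psd_kernel S K"
  shows "\<exists>w. \<forall>s\<in>S. \<forall>t\<in>S. K s t = (\<Sum>k\<in>S. w k s * cnj (w k t))"
  using assms
proof (induction S arbitrary: K rule: finite_induct)
  case (insert r S)
  have fin: "finite (insert r S)" using insert by simp
  have herm: "K t s = cnj (K s t)" if "s \<in> insert r S" "t \<in> insert r S" for s t
    using psd_kernel_hermitian[OF insert.prems fin that] .
  have psdS: "psd_kernel S K" using psd_kernel_subset[OF insert.prems fin] by blast
  show ?case
  proof (cases "K r r = 0")
    case True
    let ?x = "\<lambda>s. if s = r then 1 else 0"
    have "sesq (insert r S) K ?x ?x = 0"
      using sesq_delta_left[OF fin, of r K ?x] sum_delta_mult[OF fin, of r "K r"] True by simp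
    then have z1: "K s r = 0" if "s \<in> insert r S" for s
      using psd_kernel_null[OF insert.prems fin that, of ?x] sum_delta_mult[OF fin, of r "K s"] by simp
    then have z2: "K r s = 0" if "s \<in> insert r S" for s using herm[of s r] that by simp
    obtain w where w: "\<forall>s\<in>S. \<forall>t\<in>S. K s t = (\<Sum>k\<in>S. w k s * cnj (w k t))"
      using insert.IH[OF psdS] by blast
    let ?w = "\<lambda>k s. if k = r \<or> s = r then 0 else w k s"
    have "K s t = (\<Sum>k\<in>insert r S. ?w k s * cnj (?w k t))" if "s \<in> insert r S" "t \<in> insert r S" for s t
    proof -
      have "(\<Sum>k\<in>insert r S. ?w k s * cnj (?w k t)) =
          (if s = r \<or> t = r then 0 else (\<Sum>k\<in>S. w k s * cnj (w k t)))"
      proof -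
        have "(\<Sum>k\<in>S. ?w k s * cnj (?w k t)) = (\<Sum>k\<in>S. if s = r \<or> t = r then 0 else w k s * cnj (w k t))"
          using insert(2) by (intro sum.cong) auto
        then show ?thesis unfolding sum.insert[OF insert(1,2)]
          by (cases "s = r \<or> t = r") (simp_all only: simp_thms if_True if_False mult_zero_left add_0 sum.neutral_const)
      qed
      then show ?thesis using that z1 z2 w by auto
    qed
    then show ?thesis by (intro exI[of _ ?w] ballI)
  next
    case False
    have kpos: "0 \<le> K r r" using psd_kernel_diag[OF insert.prems fin] by simp
    define \<kappa> where "\<kappa> = sqrt (Re (K r r))"
    have k: "K r r = of_real \<kappa> * of_real \<kappa>" "\<kappa> \<noteq> 0"
      using kpos False by (auto simp: \<kappa>_def less_eq_complex_def complex_eq_iff)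
    define K' where "K' = (\<lambda>s t. K s t - K s r * K r t / K r r)"
    have "psd_kernel S K'"
      unfolding psd_kernel_def
    proof
      fix z
      define A where "A = (\<Sum>t\<in>S. K r t * z t)"
      \<comment> \<open>This value at \<open>r\<close> minimizes the form, and the minimum is the form of the Schur complement.\<close>
      define a where "a = - A / K r r"
      let ?z = "\<lambda>s. if s = r then a else z s"
      have cA: "cnj A = (\<Sum>s\<in>S. cnj (z s) * K s r)"
        unfolding A_def cnj_sum
      proof (intro sum.cong refl)
        fix t assume "t \<in> S"
        then show "cnj (K r t * z t) = cnj (z t) * K t r" using herm[of r t] by simp
      qed
      have row: "(\<Sum>t\<in>insert r S. cnj c * K s t * ?z t) = cnj c * K s r * a + cnj c * (\<Sum>t\<in>S. K s t * z t)"
        for c s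
      proof -
        have "(\<Sum>t\<in>S. cnj c * K s t * ?z t) = (\<Sum>t\<in>S. cnj c * (K s t * z t))"
          using insert(2) by (intro sum.cong) auto
        then show ?thesis using insert(1,2) by (simp add: sum_distrib_left)
      qed
      have "sesq (insert r S) K ?z ?z =
          (\<Sum>s\<in>insert r S. cnj (?z s) * K s r * a + cnj (?z s) * (\<Sum>t\<in>S. K s t * z t))"
        unfolding sesq_def row ..
      also have "\<dots> = (cnj a * K r r * a + cnj a * A) +
          (\<Sum>s\<in>S. cnj (?z s) * K s r * a + cnj (?z s) * (\<Sum>t\<in>S. K s t * z t))"
        unfolding sum.insert[OF insert(1,2)] A_def by simp
      also have "cnj a * K r r * a + cnj a * A = 0" using False by (simp add: a_def)
      also have "(\<Sum>s\<in>S. cnj (?z s) * K s r * a + cnj (?z s) * (\<Sum>t\<in>S. K s t * z t)) =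
          (\<Sum>s\<in>S. cnj (z s) * K s r * a + cnj (z s) * (\<Sum>t\<in>S. K s t * z t))"
        using insert(2) by (intro sum.cong) auto
      also have "\<dots> = cnj A * a + sesq S K z z"
        unfolding cA sesq_def sum.distrib sum_distrib_right[symmetric]
        by (simp add: sum_distrib_left mult.assoc)
      also have "0 + (cnj A * a + sesq S K z z) = sesq S K z z - cnj A * A / K r r"
        by (simp add: a_def)
      also have "\<dots> = sesq S K' z z"
        unfolding cA unfolding A_def sesq_def K'_def sum_product sum_divide_distrib sum_subtractf[symmetric]
        by (intro sum.cong refl) (simp add: algebra_simps)
      finally show "0 \<le> sesq S K' z z" using insert.prems by (metis psd_kernel_def)
    qed
    then obtain w where w: "\<forall>s\<in>S. \<forall>t\<in>S. K' s t = (\<Sum>k\<in>S. w k s * cnj (w k t))"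
      using insert.IH by blast
    let ?w = "\<lambda>k s. if k = r then K s r / of_real \<kappa> else if s = r then 0 else w k s"
    have "K s t = (\<Sum>k\<in>insert r S. ?w k s * cnj (?w k t))" if st: "s \<in> insert r S" "t \<in> insert r S" for s t
    proof -
      have "(\<Sum>k\<in>insert r S. ?w k s * cnj (?w k t)) = K s r * cnj (K t r) / K r r +
          (if s = r \<or> t = r then 0 else (\<Sum>k\<in>S. w k s * cnj (w k t)))"
      proof -
        have "(\<Sum>k\<in>S. ?w k s * cnj (?w k t)) = (\<Sum>k\<in>S. if s = r \<or> t = r then 0 else w k s * cnj (w k t))"
          using insert(2) by (intro sum.cong) auto
        moreover have "?w r s * cnj (?w r t) = K s r * cnj (K t r) / K r r"
          unfolding k(1) by simp
        ultimately show ?thesis unfolding sum.insert[OF insert(1,2)]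
          by (simp only: sum.neutral_const split: if_split) auto
      qed
      also have "cnj (K t r) = K r t" using herm[of t r] st by simp
      also have "K s r * K r t / K r r + (if s = r \<or> t = r then 0 else (\<Sum>k\<in>S. w k s * cnj (w k t))) = K s t"
      proof (cases "s = r \<or> t = r")
        case True
        then show ?thesis using False by auto
      next
        case ne: False
        then have "(\<Sum>k\<in>S. w k s * cnj (w k t)) = K' s t" using w st by auto
        then show ?thesis using ne by (simp add: K'_def)
      qed
      finally show ?thesis by simp
    qed
    then show ?thesis by (intro exI[of _ ?w] ballI)
  qed
qed simp

section \<open>Linear maps through their matrix coefficients\<close>

lemma block_bound: "p < k \<Longrightarrow> i < m \<Longrightarrow> p * m + i < k * (m :: nat)"
proof -
  assume a: "p < k" "i < m"
  have "p * m + i < Suc p * m" using a by simp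
  also have "\<dots> \<le> k * m" using a by (intro mult_right_mono) auto
  finally show ?thesis .
qed

lemma sum_blocks: "(\<Sum>r<k * m. f r) = (\<Sum>p<k. \<Sum>i<m. f (p * m + i :: nat))"
proof -
  have "sum f {p * m..<p * m + m} = (\<Sum>i<m. f (p * m + i))" for p
    by (rule sum.reindex_bij_witness[of _ "\<lambda>i. p * m + i" "\<lambda>r. r - p * m"]) auto
  then show ?thesis by (simp add: sum.nat_group[symmetric])
qed

lemma psd_iff_kernel: "psd d A \<longleftrightarrow> A \<in> carrier_mat d d \<and> psd_kernel {..<d} (\<lambda>i j. A $$ (i, j))"
proof (cases "A \<in> carrier_mat d d")
  case True
  have form: "cinner x (A *\<^sub>v x) = sesq {..<d} (\<lambda>i j. A $$ (i, j)) (\<lambda>i. x $ i) (\<lambda>i. x $ i)"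
    if "x \<in> carrier_vec d" for x
    using that True unfolding sesq_def
    by (auto simp: cinner_index[of _ d] mat_vec_entry[of _ d d] sum_distrib_left mult.assoc
        simp del: index_mult_mat_vec intro!: sum.cong)
  have "psd_kernel {..<d} (\<lambda>i j. A $$ (i, j)) \<longleftrightarrow> (\<forall>x\<in>carrier_vec d. 0 \<le> cinner x (A *\<^sub>v x))"
    unfolding psd_kernel_def
  proof (intro iffI allI ballI)
    fix x :: "complex vec"
    assume "\<forall>z. 0 \<le> sesq {..<d} (\<lambda>i j. A $$ (i, j)) z z" "x \<in> carrier_vec d"
    then show "0 \<le> cinner x (A *\<^sub>v x)" using form[of x] by simp
  next
    fix z assume *: "\<forall>x\<in>carrier_vec d. 0 \<le> cinner x (A *\<^sub>v x)"
    have "sesq {..<d} (\<lambda>i j. A $$ (i, j)) z z = cinner (vec d z) (A *\<^sub>v vec d z)"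
      unfolding form[OF vec_carrier] sesq_def by (intro sum.cong refl) auto
    then show "0 \<le> sesq {..<d} (\<lambda>i j. A $$ (i, j)) z z" using * by simp
  qed
  then show ?thesis using True by (simp add: psd_def)
qed (simp add: psd_def)

abbreviation blocks :: "nat \<Rightarrow> nat \<Rightarrow> (nat \<times> nat) set" where
  "blocks k m \<equiv> {..<k} \<times> {..<m}"

lemma psd_iff_block_kernel:
  "psd (k * m) R \<longleftrightarrow> R \<in> carrier_mat (k * m) (k * m) \<and>
     psd_kernel (blocks k m) (\<lambda>(p, i) (q, j). R $$ (p * m + i, q * m + j))"
proof -
  let ?K = "\<lambda>(p, i) (q, j). R $$ (p * m + i, q * m + j)"
  have form: "sesq {..<k * m} (\<lambda>i j. R $$ (i, j)) z z =
      sesq (blocks k m) ?K (\<lambda>(p, i). z (p * m + i)) (\<lambda>(p, i). z (p * m + i))" for z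
    unfolding sesq_def sum_blocks sum.cartesian_product' by simp
  have form': "sesq (blocks k m) ?K z z =
      sesq {..<k * m} (\<lambda>i j. R $$ (i, j)) (\<lambda>r. z (r div m, r mod m)) (\<lambda>r. z (r div m, r mod m))" for z
    unfolding form unfolding sesq_def by (intro sum.cong refl) auto
  have "psd_kernel {..<k * m} (\<lambda>i j. R $$ (i, j)) \<longleftrightarrow> psd_kernel (blocks k m) ?K"
    unfolding psd_kernel_def
  proof (intro iffI allI)
    fix z assume "\<forall>z. 0 \<le> sesq {..<k * m} (\<lambda>i j. R $$ (i, j)) z z"
    then show "0 \<le> sesq (blocks k m) ?K z z" unfolding form' by (rule spec)
  next
    fix z assume "\<forall>z. 0 \<le> sesq (blocks k m) ?K z z"
    then show "0 \<le> sesq {..<k * m} (\<lambda>i j. R $$ (i, j)) z z" unfolding form by (rule spec)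
  qed
  then show ?thesis unfolding psd_iff_kernel by simp
qed

text \<open>The four-index tensor of \<open>F\<close>.  Its reorderings are the Choi matrix, the partial transpose and the dual map.\<close>
definition coef :: "nat \<Rightarrow> (complex mat \<Rightarrow> complex mat) \<Rightarrow> nat \<Rightarrow> nat \<Rightarrow> nat \<Rightarrow> nat \<Rightarrow> complex" where
  "coef m F i j a b = F (mat_unit m i j) $$ (a, b)"

lemma mat_unit_carrier [simp]: "mat_unit m i j \<in> carrier_mat m m"
  by (simp add: carrier_matI)

lemma map_entry:
  assumes F: "F \<in> mat_maps m n" and X: "X \<in> carrier_mat m m" and ab: "a < n" "b < n"
  shows "F X $$ (a, b) = (\<Sum>i<m. \<Sum>j<m. X $$ (i, j) * coef m F i j a b)"
proof -
  let ?f = "\<lambda>x. case x of (i, j) \<Rightarrow> X $$ (i, j) \<cdot>\<^sub>m mat_unit m i j"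
  have "F X = F (mat_sum m m ?f ({..<m} \<times> {..<m}))"
    by (rule arg_cong[OF mat_unit_expansion[OF X]])
  also have "\<dots> = mat_sum n n (\<lambda>x. F (?f x)) ({..<m} \<times> {..<m})"
    by (rule mat_maps_mat_sum[OF F]) auto
  finally have "F X $$ (a, b) = (\<Sum>x\<in>{..<m} \<times> {..<m}. F (?f x) $$ (a, b))"
    using ab by simp
  also have "\<dots> = (\<Sum>(i, j)\<in>{..<m} \<times> {..<m}. X $$ (i, j) * coef m F i j a b)"
  proof (intro sum.cong refl)
    fix x assume "x \<in> {..<m} \<times> {..<m}"
    then obtain i j where x: "x = (i, j)" by auto
    have c: "F (mat_unit m i j) \<in> carrier_mat n n"
      and s: "F (X $$ (i, j) \<cdot>\<^sub>m mat_unit m i j) = X $$ (i, j) \<cdot>\<^sub>m F (mat_unit m i j)"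
      using F unfolding mat_maps_iff by auto
    show "F (?f x) $$ (a, b) = (case x of (i, j) \<Rightarrow> X $$ (i, j) * coef m F i j a b)"
      unfolding x prod.case s coef_def using c ab by simp
  qed
  finally show ?thesis by (simp add: sum.cartesian_product)
qed

lemma mat_mapsI:
  assumes car: "\<And>X. X \<in> carrier_mat m m \<Longrightarrow> F X \<in> carrier_mat n n"
    and ent: "\<And>X a b. X \<in> carrier_mat m m \<Longrightarrow> a < n \<Longrightarrow> b < n \<Longrightarrow>
      F X $$ (a, b) = (\<Sum>i<m. \<Sum>j<m. X $$ (i, j) * c i j a b)"
  shows "F \<in> mat_maps m n"
    and "i < m \<Longrightarrow> j < m \<Longrightarrow> a < n \<Longrightarrow> b < n \<Longrightarrow> coef m F i j a b = c i j a b"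
proof -
  have dims: "dim_row (F X) = n" "dim_col (F X) = n" if "X \<in> carrier_mat m m" for X
    using car[OF that] by auto
  show "F \<in> mat_maps m n"
    unfolding mat_maps_iff
  proof (intro conjI ballI allI car)
    fix X Y :: "complex mat" assume XY: "X \<in> carrier_mat m m" "Y \<in> carrier_mat m m"
    then have "dim_row Y = m" "dim_col Y = m" by auto
    then show "F (X + Y) = F X + F Y"
      using XY car dims
      by (intro eq_matI) (simp_all add: ent distrib_right sum.distrib)
  next
    fix c' :: complex and X :: "complex mat" assume X: "X \<in> carrier_mat m m"
    then have "dim_row X = m" "dim_col X = m" by auto
    then show "F (c' \<cdot>\<^sub>m X) = c' \<cdot>\<^sub>m F X"
      using X car dims
      by (intro eq_matI) (simp_all add: ent sum_distrib_left mult.assoc)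
  qed
  assume ij: "i < m" "j < m" and ab: "a < n" "b < n"
  have "coef m F i j a b = (\<Sum>i'<m. \<Sum>j'<m. mat_unit m i j $$ (i', j') * c i' j' a b)"
    unfolding coef_def by (rule ent[OF _ ab]) simp
  also have "\<dots> = (\<Sum>i'<m. \<Sum>j'<m. if j' = j then (if i' = i then c i j a b else 0) else 0)"
    using ij by (intro sum.cong refl) auto
  also have "\<dots> = c i j a b" using ij by simp
  finally show "coef m F i j a b = c i j a b" .
qed

lemma mat_maps_eqI:
  assumes F: "F \<in> mat_maps m n" and G: "G \<in> mat_maps m n" and X: "X \<in> carrier_mat m m"
    and eq: "\<And>i j. i < m \<Longrightarrow> j < m \<Longrightarrow> F (mat_unit m i j) = G (mat_unit m i j)"
  shows "F X = G X"
proof -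
  have "F X \<in> carrier_mat n n" "G X \<in> carrier_mat n n" using F G X by (auto simp: mat_maps_iff)
  then show ?thesis
    using map_entry[OF F X] map_entry[OF G X] eq by (intro eq_matI) (auto simp: coef_def)
qed

lemma mat_block_index [simp]:
  "i < m \<Longrightarrow> j < m \<Longrightarrow> mat_block m p q R $$ (i, j) = R $$ (p * m + i, q * m + j)"
  "mat_block m p q R \<in> carrier_mat m m"
  by (auto simp: mat_block_def)

lemma kron_block_entry:
  assumes "A \<in> carrier_mat k k" "B \<in> carrier_mat n n" "p < k" "q < k" "a < n" "b < n"
  shows "kron A B $$ (p * n + a, q * n + b) = A $$ (p, q) * B $$ (a, b)"
  using assms kron_index[OF assms(1,2) block_bound[OF assms(3,5)] block_bound[OF assms(4,6)]]
  by simp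

lemma tensor_map_entry:
  assumes F: "F \<in> mat_maps m n" and pq: "p < k" "q < k" and ab: "a < n" "b < n"
  shows "tensor_map k k m n (\<lambda>X. X) F R $$ (p * n + a, q * n + b) = F (mat_block m p q R) $$ (a, b)"
    and "tensor_map k k m n transpose_mat F R $$ (p * n + a, q * n + b) = F (mat_block m q p R) $$ (a, b)"
proof -
  have c: "F (mat_block m i j R) \<in> carrier_mat n n" for i j using F by (auto simp: mat_maps_iff)
  have *: "tensor_map k k m n (\<lambda>X. X) F R $$ (p * n + a, q * n + b) =
      (\<Sum>x\<in>{..<k} \<times> {..<k}. if x = (p, q) then F (mat_block m p q R) $$ (a, b) else 0)"
    unfolding tensor_map_def mat_sum_index(1)[OF block_bound[OF pq(1) ab(1)] block_bound[OF pq(2) ab(2)]]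
    using pq ab by (intro sum.cong refl)
      (auto simp: kron_block_entry[OF mat_unit_carrier[of k] c] split: if_splits)
  show "tensor_map k k m n (\<lambda>X. X) F R $$ (p * n + a, q * n + b) = F (mat_block m p q R) $$ (a, b)"
    unfolding * using pq by simp
  have *: "tensor_map k k m n transpose_mat F R $$ (p * n + a, q * n + b) =
      (\<Sum>x\<in>{..<k} \<times> {..<k}. if x = (q, p) then F (mat_block m q p R) $$ (a, b) else 0)"
    unfolding tensor_map_def mat_sum_index(1)[OF block_bound[OF pq(1) ab(1)] block_bound[OF pq(2) ab(2)]]
    using pq ab by (intro sum.cong refl)
      (auto simp: kron_block_entry[OF transpose_carrier_mat[THEN iffD2, OF mat_unit_carrier[of k]] c] split: if_splits)
  show "tensor_map k k m n transpose_mat F R $$ (p * n + a, q * n + b) = F (mat_block m q p R) $$ (a, b)"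
    unfolding * using pq by simp
qed

lemma tensor_map_carrier [simp]: "tensor_map k p m n F G R \<in> carrier_mat (p * n) (p * n)"
  by (simp add: tensor_map_def carrier_matI)

lemma tensor_map_expand:
  assumes F: "F \<in> mat_maps m n" and pq: "p < k" "q < k" and ab: "a < n" "b < n"
  shows "tensor_map k k m n (\<lambda>X. X) F R $$ (p * n + a, q * n + b) =
    (\<Sum>i<m. \<Sum>j<m. R $$ (p * m + i, q * m + j) * coef m F i j a b)"
  unfolding tensor_map_entry(1)[OF assms] map_entry[OF F mat_block_index(2) ab]
  by (intro sum.cong refl) simp

text \<open>\<open>R = \<Sum> |e\<^sub>i><e\<^sub>j| \<otimes> |e\<^sub>i><e\<^sub>j|\<close>, whose blocks are the matrix units.\<close>
definition max_entangled :: "nat \<Rightarrow> complex mat" where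
  "max_entangled m = mat (m * m) (m * m) (\<lambda>(r, s). if r div m = r mod m \<and> s div m = s mod m then 1 else 0)"

lemma mat_block_max_entangled:
  assumes "p < m" "q < m"
  shows "mat_block m p q (max_entangled m) = mat_unit m p q"
  using assms
  by (intro eq_matI) (auto simp: max_entangled_def block_bound mat_block_def)

lemma psd_max_entangled: "psd (m * m) (max_entangled m)"
  unfolding psd_iff_block_kernel
proof
  show "psd_kernel (blocks m m) (\<lambda>(p, i) (q, j). max_entangled m $$ (p * m + i, q * m + j))"
    by (rule psd_kernel_gramI[where I = "{()}" and w = "\<lambda>_ (p, i). if p = i then 1 else 0"])
      (auto simp: max_entangled_def block_bound)
qed (simp add: max_entangled_def)

lemma psd_block_gram:
  assumes "psd (k * m) R"
  obtains v where "\<And>p i q j. p < k \<Longrightarrow> i < m \<Longrightarrow> q < k \<Longrightarrow> j < m \<Longrightarrow>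
    R $$ (p * m + i, q * m + j) = (\<Sum>\<rho>\<in>blocks k m. v \<rho> (p, i) * cnj (v \<rho> (q, j)))"
proof -
  have "psd_kernel (blocks k m) (\<lambda>(p, i) (q, j). R $$ (p * m + i, q * m + j))"
    using assms by (simp add: psd_iff_block_kernel)
  from psd_kernel_gram[OF _ this] obtain v where
    v: "\<forall>s\<in>blocks k m. \<forall>t\<in>blocks k m. (case s of (p, i) \<Rightarrow> \<lambda>(q, j). R $$ (p * m + i, q * m + j)) t =
        (\<Sum>\<rho>\<in>blocks k m. v \<rho> s * cnj (v \<rho> t))" by auto
  show ?thesis
  proof (rule that[of v])
    fix p i q j assume "p < k" "i < m" "q < k" "j < m"
    then show "R $$ (p * m + i, q * m + j) = (\<Sum>\<rho>\<in>blocks k m. v \<rho> (p, i) * cnj (v \<rho> (q, j)))"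
      using v[rule_format, of "(p, i)" "(q, j)"] by simp
  qed
qed

definition choi_kernel :: "nat \<Rightarrow> (complex mat \<Rightarrow> complex mat) \<Rightarrow> nat \<times> nat \<Rightarrow> nat \<times> nat \<Rightarrow> complex" where
  "choi_kernel m F = (\<lambda>(i, a) (j, b). coef m F i j a b)"

definition partial_transpose :: "(nat \<times> nat \<Rightarrow> nat \<times> nat \<Rightarrow> complex) \<Rightarrow> nat \<times> nat \<Rightarrow> nat \<times> nat \<Rightarrow> complex" where
  "partial_transpose K = (\<lambda>(i, a) (j, b). K (j, a) (i, b))"

text \<open>The Choi matrix is the image of the maximally entangled matrix.  Conversely, Gram decompositions \<open>w\<close> of the
  Choi matrix and \<open>v\<close> of \<open>R\<close> combine to one of the image of \<open>R\<close>, with vectors \<open>\<Sum>\<^sub>i w\<^sub>\<kappa>(i, a) v\<^sub>\<rho>(p, i)\<close>.\<close>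
theorem CP_iff_choi_kernel:
  "CP m n F \<longleftrightarrow> F \<in> mat_maps m n \<and> psd_kernel (blocks m n) (choi_kernel m F)"
proof (intro iffI conjI)
  assume CP: "CP m n F"
  then show F: "F \<in> mat_maps m n" by (simp add: CP_def)
  have "psd (m * n) (tensor_map m m m n (\<lambda>X. X) F (max_entangled m))"
    using CP psd_max_entangled by (simp add: CP_def)
  then have "psd_kernel (blocks m n) (\<lambda>(p, a) (q, b).
      tensor_map m m m n (\<lambda>X. X) F (max_entangled m) $$ (p * n + a, q * n + b))"
    by (simp add: psd_iff_block_kernel)
  also have "sesq (blocks m n) (\<lambda>(p, a) (q, b).
      tensor_map m m m n (\<lambda>X. X) F (max_entangled m) $$ (p * n + a, q * n + b)) =
      sesq (blocks m n) (choi_kernel m F)"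
    unfolding sesq_def
    by (intro ext sum.cong refl)
      (auto simp: tensor_map_entry[OF F] mat_block_max_entangled choi_kernel_def coef_def)
  then have "psd_kernel (blocks m n) (\<lambda>(p, a) (q, b).
      tensor_map m m m n (\<lambda>X. X) F (max_entangled m) $$ (p * n + a, q * n + b)) =
      psd_kernel (blocks m n) (choi_kernel m F)"
    by (simp add: psd_kernel_def)
  finally show "psd_kernel (blocks m n) (choi_kernel m F)" .
next
  assume *: "F \<in> mat_maps m n \<and> psd_kernel (blocks m n) (choi_kernel m F)"
  then have F: "F \<in> mat_maps m n" by simp
  from psd_kernel_gram[of "blocks m n" "choi_kernel m F"] * obtain w where
    w: "\<forall>s\<in>blocks m n. \<forall>t\<in>blocks m n. choi_kernel m F s t = (\<Sum>\<kappa>\<in>blocks m n. w \<kappa> s * cnj (w \<kappa> t))"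
    by auto
  have w': "coef m F i j a b = (\<Sum>\<kappa>\<in>blocks m n. w \<kappa> (i, a) * cnj (w \<kappa> (j, b)))"
    if "i < m" "j < m" "a < n" "b < n" for i j a b
    using w[rule_format, of "(i, a)" "(j, b)"] that by (simp add: choi_kernel_def)
  have "psd (k * n) (tensor_map k k m n (\<lambda>X. X) F R)" if R: "psd (k * m) R" for k R
  proof -
    from psd_block_gram[OF R] obtain v where v: "\<And>p i q j. p < k \<Longrightarrow> i < m \<Longrightarrow> q < k \<Longrightarrow> j < m \<Longrightarrow>
      R $$ (p * m + i, q * m + j) = (\<Sum>\<rho>\<in>blocks k m. v \<rho> (p, i) * cnj (v \<rho> (q, j)))" by blast
    let ?u = "\<lambda>(\<kappa>, \<rho>) (p, a). \<Sum>i<m. w \<kappa> (i, a) * v \<rho> (p, i)"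
    have "tensor_map k k m n (\<lambda>X. X) F R $$ (p * n + a, q * n + b) =
        (\<Sum>x\<in>blocks m n \<times> blocks k m. ?u x (p, a) * cnj (?u x (q, b)))"
      if pq: "p < k" "q < k" and ab: "a < n" "b < n" for p q a b
    proof -
      have "tensor_map k k m n (\<lambda>X. X) F R $$ (p * n + a, q * n + b) =
          (\<Sum>i<m. \<Sum>j<m. \<Sum>x\<in>blocks m n \<times> blocks k m.
            (w (fst x) (i, a) * v (snd x) (p, i)) * cnj (w (fst x) (j, b) * v (snd x) (q, j)))"
        unfolding tensor_map_expand[OF F pq ab]
      proof (intro sum.cong refl)
        fix i j assume ij: "i \<in> {..<m}" "j \<in> {..<m}"
        have "R $$ (p * m + i, q * m + j) * coef m F i j a b =
            (\<Sum>\<kappa>\<in>blocks m n. w \<kappa> (i, a) * cnj (w \<kappa> (j, b))) *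
            (\<Sum>\<rho>\<in>blocks k m. v \<rho> (p, i) * cnj (v \<rho> (q, j)))"
          using ij pq ab by (simp add: v w')
        then show "R $$ (p * m + i, q * m + j) * coef m F i j a b =
            (\<Sum>x\<in>blocks m n \<times> blocks k m.
            (w (fst x) (i, a) * v (snd x) (p, i)) * cnj (w (fst x) (j, b) * v (snd x) (q, j)))"
          unfolding sum_product sum.cartesian_product by (simp add: split_beta mult_ac)
      qed
      also have "\<dots> = (\<Sum>x\<in>blocks m n \<times> blocks k m. \<Sum>i<m. \<Sum>j<m.
            (w (fst x) (i, a) * v (snd x) (p, i)) * cnj (w (fst x) (j, b) * v (snd x) (q, j)))"
        by (simp only: sum.swap[of _ "blocks m n \<times> blocks k m"])
      also have "\<dots> = (\<Sum>x\<in>blocks m n \<times> blocks k m. ?u x (p, a) * cnj (?u x (q, b)))"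
        by (intro sum.cong refl) (simp add: sum_product split_beta)
      finally show ?thesis .
    qed
    then show ?thesis
      unfolding psd_iff_block_kernel by (auto intro!: psd_kernel_gramI)
  qed
  then show "CP m n F" using F by (simp add: CP_def)
qed

lemma coCP_partial_transpose:
  assumes "coCP m n F"
  shows "psd_kernel (blocks m n) (partial_transpose (choi_kernel m F))"
proof -
  have F: "F \<in> mat_maps m n" using assms by (simp add: coCP_def)
  let ?T = "tensor_map m m m n transpose_mat F (max_entangled m)"
  have "psd (m * n) ?T" using assms psd_max_entangled by (simp add: coCP_def)
  then have "psd_kernel (blocks m n) (\<lambda>(p, a) (q, b). ?T $$ (p * n + a, q * n + b))"
    by (simp add: psd_iff_block_kernel)
  moreover have "sesq (blocks m n) (\<lambda>(p, a) (q, b). ?T $$ (p * n + a, q * n + b)) =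
      sesq (blocks m n) (partial_transpose (choi_kernel m F))"
    unfolding sesq_def
    by (intro ext sum.cong refl)
      (auto simp: tensor_map_entry[OF F] mat_block_max_entangled choi_kernel_def coef_def partial_transpose_def)
  ultimately show ?thesis by (simp add: psd_kernel_def)
qed

lemma choi_entry:
  assumes F: "F \<in> mat_maps m n" and "i < m" "j < m" "a < n" "b < n"
  shows "choi m n F $$ (i * n + a, j * n + b) = coef m F i j a b"
proof -
  have "choi m n F = tensor_map m m m n (\<lambda>X. X) F (max_entangled m)"
    unfolding choi_def tensor_map_def mat_sum_def
    by (intro cong_mat refl) (auto simp: mat_block_max_entangled intro!: sum.cong)
  then show ?thesis
    using assms by (simp add: tensor_map_entry[OF F] mat_block_max_entangled coef_def)
qed

section \<open>Measure-and-prepare forms and entanglement breaking maps\<close>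

text \<open>A vector \<open>x k\<close> is measured and \<open>y k\<close> is prepared; the vectors need not be normalized.\<close>
definition eb_form ::
  "nat \<Rightarrow> nat \<Rightarrow> (complex mat \<Rightarrow> complex mat) \<Rightarrow> nat \<Rightarrow> (nat \<Rightarrow> complex vec) \<Rightarrow> (nat \<Rightarrow> complex vec) \<Rightarrow> bool" where
  "eb_form m n F N x y \<longleftrightarrow> (\<forall>k<N. x k \<in> carrier_vec m \<and> y k \<in> carrier_vec n) \<and>
     (\<forall>X\<in>carrier_mat m m.
        F X = mat_sum n n (\<lambda>k. cinner (x k) (X *\<^sub>v x k) \<cdot>\<^sub>m ketbra (y k) (y k)) {..<N})"

lemma ketbra_carrier: "x \<in> carrier_vec m \<Longrightarrow> y \<in> carrier_vec n \<Longrightarrow> ketbra x y \<in> carrier_mat m n"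
  by (auto simp: ketbra_def)

lemma ketbra_entry:
  "x \<in> carrier_vec m \<Longrightarrow> y \<in> carrier_vec n \<Longrightarrow> i < m \<Longrightarrow> j < n \<Longrightarrow> ketbra x y $$ (i, j) = x $ i * cnj (y $ j)"
  by (auto simp: ketbra_def)

lemma quadratic_form_entry:
  assumes "X \<in> carrier_mat m m" "x \<in> carrier_vec m"
  shows "cinner x (X *\<^sub>v x) = (\<Sum>i<m. \<Sum>j<m. X $$ (i, j) * (cnj (x $ i) * x $ j))"
proof -
  have "cinner x (X *\<^sub>v x) = (\<Sum>i<m. cnj (x $ i) * (\<Sum>j<m. X $$ (i, j) * x $ j))"
    using assms mat_vec_entry[OF assms]
    by (subst cinner_index[of _ m]) (auto simp del: index_mult_mat_vec)
  then show ?thesis by (simp add: sum_distrib_left mult_ac)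
qed

lemma eb_sum_entry:
  assumes "\<And>k. k < N \<Longrightarrow> x k \<in> carrier_vec m" "\<And>k. k < N \<Longrightarrow> y k \<in> carrier_vec n"
    and X: "X \<in> carrier_mat m m" and ab: "a < n" "b < n"
  shows "mat_sum n n (\<lambda>k. cinner (x k) (X *\<^sub>v x k) \<cdot>\<^sub>m ketbra (y k) (y k)) {..<N} $$ (a, b) =
    (\<Sum>i<m. \<Sum>j<m. X $$ (i, j) * (\<Sum>k<N. cnj (x k $ i) * x k $ j * y k $ a * cnj (y k $ b)))"
proof -
  have "mat_sum n n (\<lambda>k. cinner (x k) (X *\<^sub>v x k) \<cdot>\<^sub>m ketbra (y k) (y k)) {..<N} $$ (a, b) =
      (\<Sum>k<N. \<Sum>i<m. \<Sum>j<m. X $$ (i, j) * (cnj (x k $ i) * x k $ j * y k $ a * cnj (y k $ b)))"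
    unfolding mat_sum_index(1)[OF ab]
  proof (intro sum.cong refl)
    fix k assume "k \<in> {..<N}"
    then have k: "x k \<in> carrier_vec m" "y k \<in> carrier_vec n" using assms by auto
    show "(cinner (x k) (X *\<^sub>v x k) \<cdot>\<^sub>m ketbra (y k) (y k)) $$ (a, b) =
        (\<Sum>i<m. \<Sum>j<m. X $$ (i, j) * (cnj (x k $ i) * x k $ j * y k $ a * cnj (y k $ b)))"
      using ketbra_carrier[OF k(2,2)] ketbra_entry[OF k(2,2) ab] ab
      by (simp add: quadratic_form_entry[OF X k(1)] sum_distrib_left sum_distrib_right mult_ac)
  qed
  also have "\<dots> = (\<Sum>i<m. \<Sum>j<m. \<Sum>k<N. X $$ (i, j) * (cnj (x k $ i) * x k $ j * y k $ a * cnj (y k $ b)))"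
    unfolding sum.swap[of _ "{..<m}" "{..<N}"] by (simp only: sum.swap[of _ "{..<N}" "{..<m}"])
  finally show ?thesis by (simp only: sum_distrib_left)
qed

theorem eb_form_iff_coef:
  "eb_form m n F N x y \<longleftrightarrow> (\<forall>k<N. x k \<in> carrier_vec m \<and> y k \<in> carrier_vec n) \<and> F \<in> mat_maps m n \<and>
     (\<forall>i<m. \<forall>j<m. \<forall>a<n. \<forall>b<n.
        coef m F i j a b = (\<Sum>k<N. cnj (x k $ i) * x k $ j * y k $ a * cnj (y k $ b)))"
    (is "_ \<longleftrightarrow> ?C \<and> ?L \<and> ?E")
proof (intro iffI)
  let ?S = "\<lambda>X. mat_sum n n (\<lambda>k. cinner (x k) (X *\<^sub>v x k) \<cdot>\<^sub>m ketbra (y k) (y k)) {..<N}"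
  {
    assume *: "eb_form m n F N x y"
    then have c: "\<And>k. k < N \<Longrightarrow> x k \<in> carrier_vec m" "\<And>k. k < N \<Longrightarrow> y k \<in> carrier_vec n"
      and eq: "\<And>X. X \<in> carrier_mat m m \<Longrightarrow> F X = ?S X"
      by (auto simp: eb_form_def)
    have "F X \<in> carrier_mat n n" if "X \<in> carrier_mat m m" for X
      using eq[OF that] by (simp add: carrier_matI)
    moreover have "F X $$ (a, b) =
        (\<Sum>i<m. \<Sum>j<m. X $$ (i, j) * (\<Sum>k<N. cnj (x k $ i) * x k $ j * y k $ a * cnj (y k $ b)))"
      if X: "X \<in> carrier_mat m m" and ab: "a < n" "b < n" for X a b
      unfolding eq[OF X] by (rule eb_sum_entry[OF c X ab])
    ultimately show "?C \<and> ?L \<and> ?E"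
      using c mat_mapsI[of m F n "\<lambda>i j a b. \<Sum>k<N. cnj (x k $ i) * x k $ j * y k $ a * cnj (y k $ b)"]
      by blast
  next
    assume *: "?C \<and> ?L \<and> ?E"
    then have c: "\<And>k. k < N \<Longrightarrow> x k \<in> carrier_vec m" "\<And>k. k < N \<Longrightarrow> y k \<in> carrier_vec n"
      and F: "F \<in> mat_maps m n" by auto
    have "F X = ?S X" if X: "X \<in> carrier_mat m m" for X
    proof (rule eq_matI)
      fix a b assume "a < dim_row (?S X)" "b < dim_col (?S X)"
      then have ab: "a < n" "b < n" by auto
      show "F X $$ (a, b) = ?S X $$ (a, b)"
      proof -
        have "?S X $$ (a, b) =
            (\<Sum>i<m. \<Sum>j<m. X $$ (i, j) * (\<Sum>k<N. cnj (x k $ i) * x k $ j * y k $ a * cnj (y k $ b)))"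
          by (rule eb_sum_entry[OF c X ab])
        then show ?thesis unfolding map_entry[OF F X ab] using * ab by simp
      qed
    next
      have "F X \<in> carrier_mat n n" using F X by (auto simp: mat_maps_iff)
      then show "dim_row (F X) = dim_row (?S X)" "dim_col (F X) = dim_col (?S X)" by auto
    qed
    then show "eb_form m n F N x y" using * by (auto simp: eb_form_def)
  }
qed

lemma eb_formD:
  assumes "eb_form m n F N x y"
  shows "F \<in> mat_maps m n" and "k < N \<Longrightarrow> x k \<in> carrier_vec m" and "k < N \<Longrightarrow> y k \<in> carrier_vec n"
    and "i < m \<Longrightarrow> j < m \<Longrightarrow> a < n \<Longrightarrow> b < n \<Longrightarrow>
      coef m F i j a b = (\<Sum>k<N. cnj (x k $ i) * x k $ j * y k $ a * cnj (y k $ b))"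
  using assms unfolding eb_form_iff_coef by auto

lemma eb_form_CP:
  assumes "eb_form m n F N x y"
  shows "CP m n F"
  unfolding CP_iff_choi_kernel
proof
  show "psd_kernel (blocks m n) (choi_kernel m F)"
    by (rule psd_kernel_gramI[where I = "{..<N}" and w = "\<lambda>k (i, a). cnj (x k $ i) * y k $ a"])
      (auto simp: choi_kernel_def eb_formD(4)[OF assms] mult_ac)
qed (rule eb_formD(1)[OF assms])

lemma psd_ketbra: "x \<in> carrier_vec d \<Longrightarrow> psd d (ketbra x x)"
  unfolding psd_iff_kernel
  by (auto intro!: psd_kernel_gramI[where I = "{()}" and w = "\<lambda>_ i. x $ i"] simp: ketbra_def)

lemma psd_gram:
  assumes "psd d A"
  obtains w where "\<And>s t. s < d \<Longrightarrow> t < d \<Longrightarrow> A $$ (s, t) = (\<Sum>k<d. w k s * cnj (w k t))"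
  using psd_kernel_gram[of "{..<d}" "\<lambda>i j. A $$ (i, j)"] assms unfolding psd_iff_kernel by auto

text \<open>On \<open>R\<close> the form produces \<open>\<Sum> P\<^sub>l \<otimes> |y\<^sub>l><y\<^sub>l|\<close>, where \<open>P\<^sub>l\<close> is the compression of \<open>R\<close> by \<open>x\<^sub>l\<close> in the second factor.\<close>
lemma eb_form_EB:
  assumes eb: "eb_form m n F N x y"
  shows "EB m n F"
  unfolding EB_def
proof (intro conjI allI impI eb_form_CP[OF eb])
  fix k R assume R: "psd (k * m) R"
  have F: "F \<in> mat_maps m n" by (rule eb_formD(1)[OF eb])
  define P where "P l = mat k k (\<lambda>(p, q). \<Sum>i<m. \<Sum>j<m. R $$ (p * m + i, q * m + j) * (cnj (x l $ i) * x l $ j))" for l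
  have Pc: "P l \<in> carrier_mat k k" for l by (simp add: P_def)
  have "psd k (P l)" for l
  proof -
    from psd_block_gram[OF R] obtain v where v: "\<And>p i q j. p < k \<Longrightarrow> i < m \<Longrightarrow> q < k \<Longrightarrow> j < m \<Longrightarrow>
      R $$ (p * m + i, q * m + j) = (\<Sum>\<rho>\<in>blocks k m. v \<rho> (p, i) * cnj (v \<rho> (q, j)))" by blast
    let ?u = "\<lambda>\<rho> p. \<Sum>i<m. v \<rho> (p, i) * cnj (x l $ i)"
    have "P l $$ (p, q) = (\<Sum>\<rho>\<in>blocks k m. ?u \<rho> p * cnj (?u \<rho> q))" if pq: "p < k" "q < k" for p q
    proof -
      have "P l $$ (p, q) = (\<Sum>i<m. \<Sum>j<m. \<Sum>\<rho>\<in>blocks k m.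
          (v \<rho> (p, i) * cnj (x l $ i)) * cnj (v \<rho> (q, j) * cnj (x l $ j)))"
      proof -
        have "R $$ (p * m + i, q * m + j) * (cnj (x l $ i) * x l $ j) = (\<Sum>\<rho>\<in>blocks k m.
          (v \<rho> (p, i) * cnj (x l $ i)) * cnj (v \<rho> (q, j) * cnj (x l $ j)))" if "i < m" "j < m" for i j
          unfolding v[OF pq(1) that(1) pq(2) that(2)] sum_distrib_right by (simp add: mult_ac)
        then show ?thesis using pq by (simp add: P_def)
      qed
      also have "\<dots> = (\<Sum>\<rho>\<in>blocks k m. \<Sum>i<m. \<Sum>j<m.
          (v \<rho> (p, i) * cnj (x l $ i)) * cnj (v \<rho> (q, j) * cnj (x l $ j)))"
        by (simp only: sum.swap[of _ "blocks k m"])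
      also have "\<dots> = (\<Sum>\<rho>\<in>blocks k m. ?u \<rho> p * cnj (?u \<rho> q))"
        unfolding cnj_sum sum_product ..
      finally show ?thesis .
    qed
    then show ?thesis
      unfolding psd_iff_kernel using Pc
      by (intro conjI psd_kernel_gramI[where I = "blocks k m" and w = ?u]) auto
  qed
  moreover have "psd n (ketbra (y l) (y l))" if "l < N" for l
    by (rule psd_ketbra[OF eb_formD(3)[OF eb that]])
  moreover have "tensor_map k k m n (\<lambda>X. X) F R =
      mat_sum (k * n) (k * n) (\<lambda>l. kron (P l) (ketbra (y l) (y l))) {..<N}" (is "?T = ?S")
  proof (rule eq_matI)
    fix r s assume "r < dim_row ?S" "s < dim_col ?S"
    then have rs: "r < k * n" "s < k * n" by auto
    then have n: "0 < n" by (auto intro: gr0I)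
    define p a q b where "p = r div n" and "a = r mod n" and "q = s div n" and "b = s mod n"
    have pq: "p < k" "q < k" and ab: "a < n" "b < n" and r: "r = p * n + a" and s: "s = q * n + b"
      using rs n by (auto simp: p_def q_def a_def b_def less_mult_imp_div_less)
    have "?T $$ (r, s) = (\<Sum>i<m. \<Sum>j<m. \<Sum>l<N. R $$ (p * m + i, q * m + j) *
        (cnj (x l $ i) * x l $ j) * (y l $ a * cnj (y l $ b)))"
      unfolding r s tensor_map_expand[OF F pq ab]
      by (intro sum.cong refl) (simp add: eb_formD(4)[OF eb] ab sum_distrib_left mult.assoc)
    also have "\<dots> = (\<Sum>l<N. \<Sum>i<m. \<Sum>j<m. R $$ (p * m + i, q * m + j) *
        (cnj (x l $ i) * x l $ j) * (y l $ a * cnj (y l $ b)))"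
      by (simp only: sum.swap[of _ "{..<N}" "{..<m}"])
    also have "\<dots> = (\<Sum>l<N. P l $$ (p, q) * ketbra (y l) (y l) $$ (a, b))"
      using pq ab by (intro sum.cong refl)
        (simp add: P_def ketbra_entry[OF eb_formD(3)[OF eb] eb_formD(3)[OF eb]] sum_distrib_right)
    also have "\<dots> = ?S $$ (r, s)"
      unfolding mat_sum_index(1)[OF rs] unfolding r s
      by (intro sum.cong refl)
        (simp add: kron_block_entry[OF Pc ketbra_carrier[OF eb_formD(3)[OF eb] eb_formD(3)[OF eb]] pq ab])
    finally show "?T $$ (r, s) = ?S $$ (r, s)" .
  qed (simp_all add: tensor_map_def)
  ultimately have sep: "(\<forall>i<N. psd k (P i) \<and> psd n (ketbra (y i) (y i))) \<and> ?T = ?S" by simp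
  show "\<exists>(l::nat) P Q. (\<forall>i<l. psd k (P i) \<and> psd n (Q i)) \<and>
      ?T = mat_sum (k * n) (k * n) (\<lambda>i. kron (P i) (Q i)) {..<l}"
    by (rule exI[of _ N], rule exI[of _ P], rule exI[of _ "\<lambda>l. ketbra (y l) (y l)"], rule sep)
qed

text \<open>Applied to the maximally entangled matrix, the entanglement breaking property separates the
  Choi matrix; splitting every factor into rank-one matrices gives the form.\<close>
lemma EB_eb_form:
  assumes EB: "EB m n F"
  obtains N x y where "eb_form m n F N x y"
proof -
  have F: "F \<in> mat_maps m n" using EB by (simp add: EB_def CP_def)
  obtain L :: nat and P Q where PQ: "\<And>l. l < L \<Longrightarrow> psd m (P l)" "\<And>l. l < L \<Longrightarrow> psd n (Q l)"
    and T: "tensor_map m m m n (\<lambda>X. X) F (max_entangled m) =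
      mat_sum (m * n) (m * n) (\<lambda>l. kron (P l) (Q l)) {..<L}"
    using EB[unfolded EB_def, THEN conjunct2, rule_format, OF psd_max_entangled[of m]] by auto
  have "\<forall>l\<in>{..<L}. \<exists>w. \<forall>s<m. \<forall>t<m. P l $$ (s, t) = (\<Sum>k<m. w k s * cnj (w k t))"
  proof
    fix l assume "l \<in> {..<L}"
    then have "psd m (P l)" using PQ by simp
    from psd_gram[OF this] show "\<exists>w. \<forall>s<m. \<forall>t<m. P l $$ (s, t) = (\<Sum>k<m. w k s * cnj (w k t))" by metis
  qed
  then obtain f where f: "\<And>l s t. l < L \<Longrightarrow> s < m \<Longrightarrow> t < m \<Longrightarrow> P l $$ (s, t) = (\<Sum>k<m. f l k s * cnj (f l k t))"
    unfolding bchoice_iff by auto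
  have "\<forall>l\<in>{..<L}. \<exists>w. \<forall>s<n. \<forall>t<n. Q l $$ (s, t) = (\<Sum>k<n. w k s * cnj (w k t))"
  proof
    fix l assume "l \<in> {..<L}"
    then have "psd n (Q l)" using PQ by simp
    from psd_gram[OF this] show "\<exists>w. \<forall>s<n. \<forall>t<n. Q l $$ (s, t) = (\<Sum>k<n. w k s * cnj (w k t))" by metis
  qed
  then obtain g where g: "\<And>l s t. l < L \<Longrightarrow> s < n \<Longrightarrow> t < n \<Longrightarrow> Q l $$ (s, t) = (\<Sum>k<n. g l k s * cnj (g l k t))"
    unfolding bchoice_iff by auto
  let ?I = "{..<L} \<times> {..<m} \<times> {..<n}"
  obtain h where h: "bij_betw h {..<card ?I} ?I"
    using ex_bij_betw_nat_finite[of ?I] by (auto simp: lessThan_atLeast0)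
  define x where "x k = (case h k of (l, s, t) \<Rightarrow> vec m (\<lambda>i. cnj (f l s i)))" for k
  define y where "y k = (case h k of (l, s, t) \<Rightarrow> vec n (g l t))" for k
  have "coef m F i j a b = (\<Sum>k<card ?I. cnj (x k $ i) * x k $ j * y k $ a * cnj (y k $ b))"
    if ij: "i < m" "j < m" and ab: "a < n" "b < n" for i j a b
  proof -
    have "coef m F i j a b = tensor_map m m m n (\<lambda>X. X) F (max_entangled m) $$ (i * n + a, j * n + b)"
      using ij ab by (simp add: tensor_map_entry[OF F] mat_block_max_entangled coef_def)
    also have "\<dots> = (\<Sum>l<L. P l $$ (i, j) * Q l $$ (a, b))"
      unfolding T mat_sum_index(1)[OF block_bound[OF ij(1) ab(1)] block_bound[OF ij(2) ab(2)]]
      using PQ kron_block_entry[OF _ _ ij ab] by (intro sum.cong refl) (auto simp: psd_def)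
    also have "\<dots> = (\<Sum>l<L. \<Sum>s<m. \<Sum>t<n. f l s i * cnj (f l s j) * (g l t a * cnj (g l t b)))"
      using ij ab by (intro sum.cong refl) (simp add: f g sum_product)
    also have "\<dots> = (\<Sum>z\<in>?I. case z of (l, s, t) \<Rightarrow> f l s i * cnj (f l s j) * (g l t a * cnj (g l t b)))"
      unfolding sum.cartesian_product by (simp add: split_beta)
    also have "\<dots> = (\<Sum>k<card ?I. case h k of (l, s, t) \<Rightarrow> f l s i * cnj (f l s j) * (g l t a * cnj (g l t b)))"
      by (rule sum.reindex_bij_betw[OF h, symmetric])
    also have "\<dots> = (\<Sum>k<card ?I. cnj (x k $ i) * x k $ j * y k $ a * cnj (y k $ b))"
      using ij ab by (intro sum.cong refl) (simp add: x_def y_def split: prod.split)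
    finally show ?thesis .
  qed
  moreover have "x k \<in> carrier_vec m" "y k \<in> carrier_vec n" for k
    by (auto simp: x_def y_def split: prod.split)
  ultimately have "eb_form m n F (card ?I) x y" unfolding eb_form_iff_coef using F by blast
  then show ?thesis by (rule that)
qed

section \<open>Channels whose Choi matrix is a projection\<close>

text \<open>The channels that measure in an orthonormal basis and then prepare a pure state.\<close>
definition von_neumann_form :: "nat \<Rightarrow> nat \<Rightarrow> (complex mat \<Rightarrow> complex mat) \<Rightarrow> bool" where
  "von_neumann_form m n F \<longleftrightarrow>
     (\<exists>u v. orthonormal m u \<and> (\<forall>j<m. cinner (v j) (v j) = 1) \<and> eb_form m n F m u v)"

lemma trace_preserving_coef:
  assumes F: "F \<in> mat_maps m n" and tp: "trace_preserving m F" and ij: "i < m" "j < m"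
  shows "(\<Sum>a<n. coef m F i j a a) = (if i = j then 1 else 0)"
proof -
  have c: "F (mat_unit m i j) \<in> carrier_mat n n" using F by (auto simp: mat_maps_iff)
  have "(\<Sum>a<n. coef m F i j a a) = mat_trace (F (mat_unit m i j))"
    using c by (simp add: mat_trace_def coef_def)
  also have "\<dots> = mat_trace (mat_unit m i j)"
    using tp by (simp add: trace_preserving_def)
  also have "\<dots> = (\<Sum>a<m. if a = i then (if i = j then 1 else 0) else 0)"
    unfolding mat_trace_def using ij by (intro sum.cong) auto
  finally show ?thesis using ij by simp
qed

lemma block_eq_matI:
  fixes A B :: "complex mat"
  assumes A: "A \<in> carrier_mat (k * n) (k * n)" and B: "B \<in> carrier_mat (k * n) (k * n)"
    and eq: "\<And>p q a b. p < k \<Longrightarrow> q < k \<Longrightarrow> a < n \<Longrightarrow> b < n \<Longrightarrow>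
      A $$ (p * n + a, q * n + b) = B $$ (p * n + a, q * n + b)"
  shows "A = B"
proof (rule eq_matI)
  fix r s assume "r < dim_row B" "s < dim_col B"
  then have rs: "r < k * n" "s < k * n" using B by auto
  then have n: "0 < n" by (auto intro: gr0I)
  show "A $$ (r, s) = B $$ (r, s)"
    using eq[of "r div n" "s div n" "r mod n" "s mod n"] rs n by (simp add: less_mult_imp_div_less)
qed (use A B in auto)

lemma choi_projection_iff:
  assumes F: "F \<in> mat_maps m n" and psd: "psd_kernel (blocks m n) (choi_kernel m F)"
  shows "is_projection (choi m n F) \<longleftrightarrow>
    (\<forall>i<m. \<forall>k<m. \<forall>a<n. \<forall>b<n. (\<Sum>j<m. \<Sum>e<n. coef m F i j a e * coef m F j k e b) = coef m F i k a b)"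
proof -
  let ?C = "choi m n F"
  have C: "?C \<in> carrier_mat (m * n) (m * n)" by (simp add: choi_def carrier_matI)
  have herm: "coef m F j i b a = cnj (coef m F i j a b)" if "i < m" "j < m" "a < n" "b < n" for i j a b
    using psd_kernel_hermitian[OF psd, of "(i, a)" "(j, b)"] that by (simp add: choi_kernel_def)
  have "mat_adjoint ?C = ?C"
    using C by (intro block_eq_matI[of _ m n]) (auto simp: block_bound choi_entry[OF F] herm[symmetric])
  moreover have prod: "(?C * ?C) $$ (i * n + a, k * n + b) =
      (\<Sum>j<m. \<Sum>e<n. coef m F i j a e * coef m F j k e b)"
    if "i < m" "k < m" "a < n" "b < n" for i k a b
    using that by (subst mat_mult_entry[OF C C]) (auto simp: block_bound sum_blocks choi_entry[OF F])
  moreover have "?C * ?C = ?C \<longleftrightarrow> (\<forall>i<m. \<forall>k<m. \<forall>a<n. \<forall>b<n.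
      (?C * ?C) $$ (i * n + a, k * n + b) = ?C $$ (i * n + a, k * n + b))"
    using C block_eq_matI[of "?C * ?C" m n ?C] by auto
  ultimately show ?thesis
    unfolding is_projection_def using C choi_entry[OF F] by auto
qed

lemma sum_swap4:
  "(\<Sum>j\<in>A. \<Sum>e\<in>B. \<Sum>s\<in>C. \<Sum>t\<in>D. f j e s t) = (\<Sum>s\<in>C. \<Sum>t\<in>D. \<Sum>j\<in>A. \<Sum>e\<in>B. f j e s t)"
proof -
  let ?g = "\<lambda>x y. f (fst x) (snd x) (fst y) (snd y)"
  have "(\<Sum>x\<in>A \<times> B. \<Sum>y\<in>C \<times> D. ?g x y) = (\<Sum>y\<in>C \<times> D. \<Sum>x\<in>A \<times> B. ?g x y)"
    by (rule sum.swap)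
  then show ?thesis by (simp add: sum.cartesian_product')
qed

lemma sum_rotate3:
  "(\<Sum>i\<in>A. \<Sum>k\<in>B. \<Sum>j\<in>C. f i k j) = (\<Sum>j\<in>C. \<Sum>i\<in>A. \<Sum>k\<in>B. f i k j)"
proof -
  have "(\<Sum>i\<in>A. \<Sum>k\<in>B. \<Sum>j\<in>C. f i k j) = (\<Sum>i\<in>A. \<Sum>j\<in>C. \<Sum>k\<in>B. f i k j)"
    by (intro sum.cong refl) (rule sum.swap)
  also have "\<dots> = (\<Sum>j\<in>C. \<Sum>i\<in>A. \<Sum>k\<in>B. f i k j)" by (rule sum.swap)
  finally show ?thesis .
qed

text \<open>The Choi matrix is \<open>\<Sum> |w\<^sub>j><w\<^sub>j|\<close> with the orthonormal vectors \<open>w\<^sub>j = u\<^sub>j\<^sup>* \<otimes> v\<^sub>j\<close>, where \<open>u\<^sub>j\<^sup>*\<close> is the entrywise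
  conjugate of \<open>u\<^sub>j\<close>.\<close>
lemma von_neumann_form_choi_projection:
  assumes "von_neumann_form m n F"
  shows "is_projection (choi m n F)"
proof -
  obtain u v where u: "orthonormal m u" and v: "\<And>j. j < m \<Longrightarrow> cinner (v j) (v j) = 1"
    and eb: "eb_form m n F m u v"
    using assms by (auto simp: von_neumann_form_def)
  note F = eb_formD(1)[OF eb] and c = eb_formD(4)[OF eb]
  have psd: "psd_kernel (blocks m n) (choi_kernel m F)"
    using eb_form_CP[OF eb] by (simp add: CP_iff_choi_kernel)
  have uu: "(\<Sum>j<m. u s $ j * cnj (u t $ j)) = (if s = t then 1 else 0)" if "s < m" "t < m" for s t
    using u that by (auto simp: orthonormal_def cinner_index[of _ m] mult.commute)
  have vv: "(\<Sum>e<n. cnj (v s $ e) * v s $ e) = 1" if "s < m" for s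
    using v[OF that] eb_formD(3)[OF eb that] by (simp add: cinner_index[of _ n])
  have "(\<Sum>j<m. \<Sum>e<n. coef m F i j a e * coef m F j k e b) = coef m F i k a b"
    if ik: "i < m" "k < m" and ab: "a < n" "b < n" for i k a b
  proof -
    let ?L = "\<lambda>s. cnj (u s $ i) * v s $ a" and ?R = "\<lambda>t. u t $ k * cnj (v t $ b)"
    have "(\<Sum>j<m. \<Sum>e<n. coef m F i j a e * coef m F j k e b) =
        (\<Sum>j<m. \<Sum>e<n. \<Sum>s<m. \<Sum>t<m. ?L s * ?R t *
          ((u s $ j * cnj (u t $ j)) * (cnj (v s $ e) * v t $ e)))"
      using ik ab by (intro sum.cong refl) (simp add: c sum_product mult_ac)
    also have "\<dots> = (\<Sum>s<m. \<Sum>t<m. \<Sum>j<m. \<Sum>e<n. ?L s * ?R t *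
          ((u s $ j * cnj (u t $ j)) * (cnj (v s $ e) * v t $ e)))"
      by (rule sum_swap4)
    also have "\<dots> = (\<Sum>s<m. \<Sum>t<m. ?L s * ?R t *
          ((\<Sum>j<m. u s $ j * cnj (u t $ j)) * (\<Sum>e<n. cnj (v s $ e) * v t $ e)))"
      unfolding sum_product unfolding sum_distrib_left ..
    also have "\<dots> = (\<Sum>s<m. \<Sum>t<m. if t = s then ?L s * ?R s else 0)"
      by (intro sum.cong refl) (auto simp: uu vv)
    also have "\<dots> = coef m F i k a b" using ik ab by (simp add: c mult_ac)
    finally show ?thesis .
  qed
  then show ?thesis using choi_projection_iff[OF F psd] by blast
qed

lemma spectral_entry:
  assumes H: "H \<in> carrier_mat d d" and u: "orthonormal d u"
    and ev: "\<And>j. j < d \<Longrightarrow> H *\<^sub>v u j = e j \<cdot>\<^sub>v u j" and ik: "i < d" "k < d"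
  shows "H $$ (i, k) = (\<Sum>j<d. e j * u j $ i * cnj (u j $ k))"
proof -
  have uc: "u j \<in> carrier_vec d" if "j < d" for j using u that by (simp add: orthonormal_def)
  have ud: "dim_vec (u j) = d" if "j < d" for j using uc[OF that] by simp
  have "(\<Sum>j<d. e j * u j $ i * cnj (u j $ k)) = (\<Sum>j<d. (H *\<^sub>v u j) $ i * cnj (u j $ k))"
    using ev ik by (intro sum.cong refl) (simp add: ud del: index_mult_mat_vec)
  also have "\<dots> = (\<Sum>j<d. \<Sum>l<d. H $$ (i, l) * (u j $ l * cnj (u j $ k)))"
    using mat_vec_entry[OF H uc ik(1)] by (intro sum.cong refl) (simp add: sum_distrib_right mult.assoc)
  also have "\<dots> = (\<Sum>l<d. H $$ (i, l) * (\<Sum>j<d. u j $ l * cnj (u j $ k)))"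
    by (subst sum.swap) (simp add: sum_distrib_left)
  also have "\<dots> = (\<Sum>l<d. if l = k then H $$ (i, k) else 0)"
    using orthonormal_complete[OF u _ ik(2)] by (intro sum.cong refl) auto
  finally show ?thesis using ik by simp
qed

text \<open>Vanishing \<open>2 \<times> 2\<close> minors mean rank at most one.  As the trace is one, some \<open>\<nu>\<^sub>r\<^sub>r\<close> is nonzero, and
  \<open>\<nu>\<^sub>r\<^sub>r = \<Sum>\<^sub>b \<nu>\<^sub>r\<^sub>r \<nu>\<^sub>b\<^sub>b = \<Sum>\<^sub>b |\<nu>\<^sub>r\<^sub>b|\<^sup>2\<close> is positive, so its square root normalizes the column \<open>r\<close>.\<close>
lemma hermitian_vanishing_minors:
  fixes \<nu> :: "nat \<Rightarrow> nat \<Rightarrow> complex"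
  assumes minors: "\<And>a p b q. a < n \<Longrightarrow> p < n \<Longrightarrow> b < n \<Longrightarrow> q < n \<Longrightarrow> \<nu> a p * \<nu> b q = \<nu> b p * \<nu> a q"
    and herm: "\<And>a b. a < n \<Longrightarrow> b < n \<Longrightarrow> \<nu> b a = cnj (\<nu> a b)"
    and trace: "(\<Sum>a<n. \<nu> a a) = 1"
  shows "\<exists>v. \<forall>a<n. \<forall>b<n. \<nu> a b = v a * cnj (v b)"
proof -
  have "\<exists>r. \<nu> r r \<noteq> 0 \<and> r < n"
    using trace by (metis (mono_tags, lifting) lessThan_iff sum.neutral zero_neq_one)
  then obtain r where r: "r < n" "\<nu> r r \<noteq> 0" by blast
  have "\<nu> r r = (\<Sum>b<n. \<nu> r r * \<nu> b b)" using trace by (simp add: sum_distrib_left[symmetric])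
  also have "\<dots> = (\<Sum>b<n. of_real ((cmod (\<nu> r b))\<^sup>2))"
  proof (intro sum.cong refl)
    fix b assume "b \<in> {..<n}"
    then have "\<nu> r r * \<nu> b b = \<nu> r b * cnj (\<nu> r b)" using minors[of r r b b] herm[of r b] r by simp
    then show "\<nu> r r * \<nu> b b = of_real ((cmod (\<nu> r b))\<^sup>2)" by (simp only: complex_norm_square)
  qed
  finally have pos: "\<nu> r r = of_real (\<Sum>b<n. (cmod (\<nu> r b))\<^sup>2)" by simp
  define s where "s = sqrt (\<Sum>b<n. (cmod (\<nu> r b))\<^sup>2)"
  have s: "of_real s * of_real s = \<nu> r r"
    unfolding pos s_def of_real_mult[symmetric] by (simp add: sum_nonneg)
  have "\<nu> a b = (\<nu> a r / of_real s) * cnj (\<nu> b r / of_real s)" if ab: "a < n" "b < n" for a b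
  proof -
    have "(\<nu> a r / of_real s) * cnj (\<nu> b r / of_real s) = \<nu> a r * \<nu> r b / \<nu> r r"
      using herm[OF ab(2) r(1)] s by simp
    also have "\<dots> = \<nu> a b" using minors[of a r r b] ab r by simp
    finally show ?thesis ..
  qed
  then show ?thesis by (intro exI[of _ "\<lambda>a. \<nu> a r / of_real s"]) blast
qed

text \<open>Let \<open>C\<close> be the Choi matrix, \<open>C\<^sup>\<Gamma>\<close> its partial transpose in the second factor (the transpose of the one
  assumed to be positive) and \<open>W\<^sub>a\<^sub>b = |e\<^sub>a><e\<^sub>b| - |e\<^sub>b><e\<^sub>a|\<close>, acting on the second factor.  Trace
  preservation gives the reduction identity \<open>I - C = (1/2) \<Sum> W\<^sub>a\<^sub>b\<^sup>* C\<^sup>\<Gamma> W\<^sub>a\<^sub>b\<close>.  For a projection \<open>C\<close>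
  one has \<open>C (I - C) C = 0\<close>, so each of the positive semidefinite summands \<open>C W\<^sub>a\<^sub>b\<^sup>* C\<^sup>\<Gamma> W\<^sub>a\<^sub>b C\<close> is zero and
  \<open>C\<^sup>\<Gamma> W\<^sub>a\<^sub>b C = 0\<close>.  The entries of this equation are the exchange relations.\<close>
lemma choi_projection_exchange:
  assumes psd: "psd_kernel (blocks m n) (choi_kernel m F)"
    and ppt: "psd_kernel (blocks m n) (partial_transpose (choi_kernel m F))"
    and tp: "\<And>i j. i < m \<Longrightarrow> j < m \<Longrightarrow> (\<Sum>a<n. coef m F i j a a) = (if i = j then 1 else 0)"
    and proj: "\<And>i k a b. i < m \<Longrightarrow> k < m \<Longrightarrow> a < n \<Longrightarrow> b < n \<Longrightarrow>
      (\<Sum>j<m. \<Sum>e<n. coef m F i j a e * coef m F j k e b) = coef m F i k a b"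
    and il: "i < m" "l < m" and apbq: "a < n" "p < n" "b < n" "q < n"
  shows "(\<Sum>j<m. coef m F i j a p * coef m F j l b q) = (\<Sum>j<m. coef m F i j b p * coef m F j l a q)"
proof -
  define c where "c = coef m F"
  let ?S = "blocks m n" and ?K = "partial_transpose (choi_kernel m F)"
  have K: "?K (i, a) (j, b) = c j i a b" for i j a b
    by (simp add: partial_transpose_def choi_kernel_def c_def)
  have herm: "cnj (c i j a b) = c j i b a" if "i < m" "j < m" "a < n" "b < n" for i j a b
    using psd_kernel_hermitian[OF psd, of "(i, a)" "(j, b)"] that by (simp add: choi_kernel_def c_def)
  define pt where "pt e f = (\<lambda>(j :: nat, g :: nat). if g = e then f j else 0)" for e :: nat and f :: "nat \<Rightarrow> complex"
  define H where "H f g a b = (\<Sum>i<m. \<Sum>j<m. cnj (f i) * c j i a b * g j)" for f g a b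
  have row: "(\<Sum>t\<in>?S. ?K (i, a) t * pt b g t) = (\<Sum>j<m. c j i a b * g j)" if "b < n" for i a b g
  proof -
    have "(\<Sum>t\<in>?S. ?K (i, a) t * pt b g t) = (\<Sum>j<m. \<Sum>f<n. if f = b then c j i a b * g j else 0)"
      unfolding sum.cartesian_product' by (intro sum.cong refl) (auto simp: K pt_def)
    then show ?thesis using that by simp
  qed
  have form: "sesq ?S ?K (pt a f) (pt b g) = H f g a b" if "a < n" "b < n" for a b f g
  proof -
    define R where "R s = (\<Sum>t\<in>?S. ?K s t * pt b g t)" for s
    have "sesq ?S ?K (pt a f) (pt b g) = (\<Sum>s\<in>?S. cnj (pt a f s) * R s)"
      unfolding sesq_def R_def by (simp add: sum_distrib_left mult.assoc)
    also have "\<dots> = (\<Sum>i<m. \<Sum>e<n. if e = a then cnj (f i) * R (i, a) else 0)"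
      unfolding sum.cartesian_product' by (intro sum.cong refl) (auto simp: pt_def)
    also have "\<dots> = (\<Sum>i<m. \<Sum>e<n. if e = a then cnj (f i) * (\<Sum>j<m. c j i a b * g j) else 0)"
      unfolding R_def row[OF that(2)] ..
    also have "\<dots> = H f g a b" using that by (simp add: H_def sum_distrib_left mult.assoc)
    finally show ?thesis .
  qed
  \<comment> \<open>\<open>\<psi>\<close> is the column of \<open>C\<close> at \<open>(l, q)\<close>, and \<open>z a b\<close> is the conjugate of \<open>W\<^sub>a\<^sub>b \<psi>\<close>.\<close>
  define \<psi> where "\<psi> b j = c j l b q" for b j
  define \<psi>' where "\<psi>' b j = cnj (\<psi> b j)" for b j
  define z where "z a b = (\<lambda>t. pt a (\<psi>' b) t + (- 1) * pt b (\<psi>' a) t)" for a b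
  define S where "S a b = sesq ?S ?K (z a b) (z a b)" for a b
  have S: "S a b = H (\<psi>' b) (\<psi>' b) a a - H (\<psi>' b) (\<psi>' a) a b - H (\<psi>' a) (\<psi>' b) b a + H (\<psi>' a) (\<psi>' a) b b"
    if "a < n" "b < n" for a b
    unfolding S_def z_def sesq_add_scaled using that by (simp add: form)
  have diag: "(\<Sum>a<n. H f g a a) = (\<Sum>i<m. cnj (f i) * g i)" for f g
  proof -
    have "(\<Sum>a<n. H f g a a) = (\<Sum>i<m. \<Sum>j<m. cnj (f i) * (\<Sum>a<n. c j i a a) * g j)"
      unfolding H_def sum_distrib_left sum_distrib_right
      by (simp only: sum.swap[of _ "{..<m}" "{..<n}"])
    also have "\<dots> = (\<Sum>i<m. \<Sum>j<m. if j = i then cnj (f i) * g i else 0)"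
      using tp by (intro sum.cong refl) (auto simp: c_def)
    finally show ?thesis by simp
  qed
  have off: "(\<Sum>b<n. H (\<psi>' b) g a b) = (\<Sum>j<m. \<psi> a j * g j)" if "a < n" for a g
  proof -
    have "(\<Sum>b<n. H (\<psi>' b) g a b) = (\<Sum>j<m. \<Sum>i<m. \<Sum>b<n. c j i a b * \<psi> b i * g j)"
      unfolding H_def \<psi>'_def
      by (simp add: sum.swap[of _ "{..<m}" "{..<n}"] mult_ac) (rule sum.swap)
    also have "\<dots> = (\<Sum>j<m. (\<Sum>i<m. \<Sum>b<n. c j i a b * \<psi> b i) * g j)"
      by (simp add: sum_distrib_right)
    also have "\<dots> = (\<Sum>j<m. \<psi> a j * g j)"
      using proj il apbq that by (intro sum.cong refl) (simp add: \<psi>_def c_def)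
    finally show ?thesis .
  qed
  let ?N = "\<Sum>b<n. \<Sum>i<m. \<psi> b i * cnj (\<psi> b i)"
  have "(\<Sum>a<n. \<Sum>b<n. S a b) = (\<Sum>a<n. \<Sum>b<n. H (\<psi>' b) (\<psi>' b) a a) - (\<Sum>a<n. \<Sum>b<n. H (\<psi>' b) (\<psi>' a) a b)
      - (\<Sum>a<n. \<Sum>b<n. H (\<psi>' a) (\<psi>' b) b a) + (\<Sum>a<n. \<Sum>b<n. H (\<psi>' a) (\<psi>' a) b b)"
    by (simp add: S sum.distrib sum_subtractf)
  also have "(\<Sum>a<n. \<Sum>b<n. H (\<psi>' b) (\<psi>' b) a a) = (\<Sum>b<n. \<Sum>a<n. H (\<psi>' b) (\<psi>' b) a a)"
    by (rule sum.swap)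
  also have "(\<Sum>a<n. \<Sum>b<n. H (\<psi>' a) (\<psi>' b) b a) = (\<Sum>b<n. \<Sum>a<n. H (\<psi>' a) (\<psi>' b) b a)"
    by (rule sum.swap)
  also have "(\<Sum>b<n. \<Sum>a<n. H (\<psi>' b) (\<psi>' b) a a) - (\<Sum>a<n. \<Sum>b<n. H (\<psi>' b) (\<psi>' a) a b)
      - (\<Sum>b<n. \<Sum>a<n. H (\<psi>' a) (\<psi>' b) b a) + (\<Sum>a<n. \<Sum>b<n. H (\<psi>' a) (\<psi>' a) b b) = ?N - ?N - ?N + ?N" unfolding diag by (simp add: off) (simp add: \<psi>'_def)
  finally have sum0: "(\<Sum>a<n. \<Sum>b<n. S a b) = 0" by simp
  have Spos: "0 \<le> S a b" for a b using ppt by (simp add: S_def psd_kernel_def)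
  have "(\<Sum>a<n. \<Sum>b<n. Re (S a b)) = 0" using arg_cong[OF sum0, of Re] by simp
  then have "(\<Sum>b<n. Re (S a b)) = 0"
    using Spos apbq by (subst (asm) sum_nonneg_eq_0_iff) (auto simp: less_eq_complex_def intro!: sum_nonneg)
  then have "Re (S a b) = 0"
    using Spos apbq by (subst (asm) sum_nonneg_eq_0_iff) (auto simp: less_eq_complex_def)
  then have "S a b = 0" using Spos[of a b] by (simp add: less_eq_complex_def complex_eq_iff)
  then have null: "(\<Sum>t\<in>?S. ?K (i, p) t * z a b t) = 0"
    using psd_kernel_null[OF ppt, of "(i, p)" "z a b"] il apbq by (simp add: S_def)
  have "(\<Sum>t\<in>?S. ?K (i, p) t * z a b t) =
      (\<Sum>t\<in>?S. ?K (i, p) t * pt a (\<psi>' b) t) - (\<Sum>t\<in>?S. ?K (i, p) t * pt b (\<psi>' a) t)"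
    by (simp add: z_def right_diff_distrib sum_subtractf)
  then have "(\<Sum>j<m. c j i p a * \<psi>' b j) = (\<Sum>j<m. c j i p b * \<psi>' a j)"
    unfolding null row[OF apbq(1)] row[OF apbq(3)] by simp
  then have "cnj (\<Sum>j<m. c j i p a * \<psi>' b j) = cnj (\<Sum>j<m. c j i p b * \<psi>' a j)" by simp
  then have "(\<Sum>j<m. c i j a p * \<psi> b j) = (\<Sum>j<m. c i j b p * \<psi> a j)"
    using herm il apbq by (simp add: \<psi>'_def)
  then show ?thesis by (simp add: \<psi>_def c_def)
qed

text \<open>Write \<open>O\<^sub>a\<^sub>b\<close> for the matrix with entries \<open>coef m F i j a b\<close>.  The exchange relations
  \<open>O\<^sub>a\<^sub>p O\<^sub>b\<^sub>q = O\<^sub>b\<^sub>p O\<^sub>a\<^sub>q\<close> swap the first indices, their adjoints swap the second ones; so the \<open>O\<^sub>a\<^sub>b\<close> commute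
  and have a joint eigenbasis \<open>x\<^sub>j\<close>.  The relations say that the matrix of eigenvalues at \<open>x\<^sub>j\<close> has vanishing
  \<open>2 \<times> 2\<close> minors, and trace preservation that its trace is one; so it is \<open>|v\<^sub>j><v\<^sub>j|\<close> for a unit vector \<open>v\<^sub>j\<close>.\<close>
theorem choi_projection_von_neumann_form:
  assumes CP: "CP m n F"
    and ppt: "psd_kernel (blocks m n) (partial_transpose (choi_kernel m F))"
    and tp: "\<And>i j. i < m \<Longrightarrow> j < m \<Longrightarrow> (\<Sum>a<n. coef m F i j a a) = (if i = j then 1 else 0)"
    and proj: "is_projection (choi m n F)"
  shows "von_neumann_form m n F"
proof -
  have F: "F \<in> mat_maps m n" and psd: "psd_kernel (blocks m n) (choi_kernel m F)"
    using CP by (simp_all add: CP_iff_choi_kernel)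
  define c where "c = coef m F"
  have herm: "c j i b a = cnj (c i j a b)" if "i < m" "j < m" "a < n" "b < n" for i j a b
    using psd_kernel_hermitian[OF psd, of "(i, a)" "(j, b)"] that by (simp add: choi_kernel_def c_def)
  define O' where "O' a b = mat m m (\<lambda>(i, j). c i j a b)" for a b
  have O: "O' a b \<in> carrier_mat m m" for a b by (simp add: O'_def)
  have exch: "O' a p * O' b q = O' b p * O' a q" if "a < n" "p < n" "b < n" "q < n" for a p b q
  proof (rule eq_matI)
    fix i l assume "i < dim_row (O' b p * O' a q)" "l < dim_col (O' b p * O' a q)"
    then have il: "i < m" "l < m" by (auto simp: O'_def)
    show "(O' a p * O' b q) $$ (i, l) = (O' b p * O' a q) $$ (i, l)"
      unfolding mat_mult_entry[OF O O il]
      using choi_projection_exchange[OF psd ppt tp _ il that]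
        proj[unfolded choi_projection_iff[OF F psd]] il
      by (simp add: O'_def c_def)
  qed (simp_all add: O'_def)
  have adj: "mat_adjoint (O' a b) = O' b a" if "a < n" "b < n" for a b
    using herm[OF _ _ that] by (intro eq_matI) (auto simp: O'_def)
  have exch': "O' a p * O' b q = O' a q * O' b p" if "a < n" "p < n" "b < n" "q < n" for a p b q
  proof -
    have "mat_adjoint (O' q b * O' p a) = mat_adjoint (O' p b * O' q a)"
      using exch[of q b p a] that by simp
    then show ?thesis using that by (simp add: mat_adjoint_mult[OF O O] adj)
  qed
  let ?H = "(\<lambda>(a, b). O' a b) ` blocks n n"
  have comm: "H * K = K * H" if HK: "H \<in> ?H" "K \<in> ?H" for H K
  proof -
    obtain a p b q where H: "H = O' a p" "a < n" "p < n" and K: "K = O' b q" "b < n" "q < n"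
      using HK by auto
    have "O' a p * O' b q = O' b p * O' a q" using exch H K by simp
    also have "\<dots> = O' b q * O' a p" using exch' H K by simp
    finally show ?thesis using H K by simp
  qed
  obtain x where x: "orthonormal m x"
    and ev: "\<And>H j. H \<in> ?H \<Longrightarrow> j < m \<Longrightarrow> \<exists>e. H *\<^sub>v x j = e \<cdot>\<^sub>v x j"
  proof (rule joint_eigenbasis[of ?H m])
    show "mat_adjoint H \<in> ?H" if "H \<in> ?H" for H using that adj by auto
  qed (use O comm in auto)
  define \<nu> where "\<nu> a b j = (SOME e. O' a b *\<^sub>v x j = e \<cdot>\<^sub>v x j)" for a b j
  have \<nu>: "O' a b *\<^sub>v x j = \<nu> a b j \<cdot>\<^sub>v x j" if "a < n" "b < n" "j < m" for a b j
    unfolding \<nu>_def by (rule someI_ex, rule ev) (use that in auto)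
  have xc: "x j \<in> carrier_vec m" and xx: "cinner (x j) (x j) = 1" if "j < m" for j
    using x that by (auto simp: orthonormal_def)
  have \<nu>_cinner: "\<nu> a b j = cinner (x j) (O' a b *\<^sub>v x j)" if "a < n" "b < n" "j < m" for a b j
    using \<nu>[OF that] xc[OF that(3)] xx[OF that(3)] by (simp add: cinner_smult_right)
  have prod: "\<nu> a p j * \<nu> b q j = cinner (x j) ((O' a p * O' b q) *\<^sub>v x j)"
    if "a < n" "p < n" "b < n" "q < n" "j < m" for a p b q j
  proof -
    have "(O' a p * O' b q) *\<^sub>v x j = O' a p *\<^sub>v (O' b q *\<^sub>v x j)"
      by (rule assoc_mult_mat_vec[OF O O xc[OF that(5)]])
    also have "\<dots> = (\<nu> b q j * \<nu> a p j) \<cdot>\<^sub>v x j"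
      using \<nu> that xc[OF that(5)] O by (simp add: mult_mat_vec[of _ m m] smult_smult_assoc)
    finally show ?thesis
      using xc[OF that(5)] xx[OF that(5)] by (simp add: cinner_smult_right mult.commute)
  qed
  have trace: "(\<Sum>a<n. \<nu> a a j) = 1" if j: "j < m" for j
  proof -
    have "(\<Sum>a<n. \<nu> a a j) = (\<Sum>a<n. \<Sum>i<m. \<Sum>k<m. c i k a a * (cnj (x j $ i) * x j $ k))"
      using j quadratic_form_entry[OF O xc[OF j]]
      by (intro sum.cong refl) (simp add: \<nu>_cinner, simp add: O'_def)
    also have "\<dots> = (\<Sum>i<m. \<Sum>k<m. (\<Sum>a<n. c i k a a) * (cnj (x j $ i) * x j $ k))"
      unfolding sum_distrib_right by (simp only: sum.swap[of _ "{..<m}" "{..<n}"])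
    also have "\<dots> = (\<Sum>i<m. \<Sum>k<m. if k = i then cnj (x j $ i) * x j $ i else 0)"
      using tp by (intro sum.cong refl) (auto simp: c_def)
    also have "\<dots> = 1" using xx[OF j] xc[OF j] by (simp add: cinner_index)
    finally show ?thesis .
  qed
  have "\<forall>j\<in>{..<m}. \<exists>v. \<forall>a<n. \<forall>b<n. \<nu> a b j = v a * cnj (v b)"
  proof
    fix j assume "j \<in> {..<m}"
    then have j: "j < m" by simp
    show "\<exists>v. \<forall>a<n. \<forall>b<n. \<nu> a b j = v a * cnj (v b)"
    proof (rule hermitian_vanishing_minors)
      show "\<nu> a p j * \<nu> b q j = \<nu> b p j * \<nu> a q j" if "a < n" "p < n" "b < n" "q < n" for a p b q
        using that j by (simp add: prod exch)
      show "\<nu> b a j = cnj (\<nu> a b j)" if "a < n" "b < n" for a b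
      proof -
        have "cnj (\<nu> a b j) = cinner (O' a b *\<^sub>v x j) (x j)"
          using that j by (simp add: \<nu>_cinner cinner_cnj[OF xc[OF j] mult_mat_vec_carrier[OF O xc[OF j]]])
        also have "\<dots> = \<nu> b a j"
          using that j xc[OF j] cinner_adjoint[OF O xc[OF j] xc[OF j], of b a]
          by (simp add: \<nu>_cinner adj)
        finally show ?thesis ..
      qed
      show "(\<Sum>a<n. \<nu> a a j) = 1" by (rule trace[OF j])
    qed
  qed
  then obtain w where w: "\<And>j a b. j < m \<Longrightarrow> a < n \<Longrightarrow> b < n \<Longrightarrow> \<nu> a b j = w j a * cnj (w j b)"
    unfolding bchoice_iff by auto
  define u where "u j = vec m (\<lambda>i. cnj (x j $ i))" for j
  define v where "v j = vec n (w j)" for j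
  have u: "orthonormal m u"
  proof (rule orthonormalI)
    fix i k assume ik: "i < m" "k < m"
    have "(\<Sum>j<m. u j $ i * cnj (u j $ k)) = cnj (\<Sum>j<m. x j $ i * cnj (x j $ k))"
      using ik by (simp add: u_def)
    then show "(\<Sum>j<m. u j $ i * cnj (u j $ k)) = (if i = k then 1 else 0)"
      using orthonormal_complete[OF x ik] by simp
  qed (simp add: u_def)
  have eb: "eb_form m n F m u v"
    unfolding eb_form_iff_coef
  proof (intro conjI allI impI F)
    fix i k a b assume ik: "i < m" "k < m" and ab: "a < n" "b < n"
    have "coef m F i k a b = O' a b $$ (i, k)" using ik by (simp add: O'_def c_def)
    also have "\<dots> = (\<Sum>j<m. \<nu> a b j * x j $ i * cnj (x j $ k))"
      by (rule spectral_entry[OF O x \<nu>[OF ab] ik])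
    also have "\<dots> = (\<Sum>j<m. cnj (u j $ i) * u j $ k * v j $ a * cnj (v j $ b))"
      using ik ab by (intro sum.cong refl) (simp add: u_def v_def w)
    finally show "coef m F i k a b = (\<Sum>j<m. cnj (u j $ i) * u j $ k * v j $ a * cnj (v j $ b))" .
  qed (simp_all add: u_def v_def)
  have "cinner (v j) (v j) = 1" if j: "j < m" for j
  proof -
    have "cinner (v j) (v j) = (\<Sum>a<n. cnj (v j $ a) * v j $ a)"
      by (rule cinner_index) (simp_all add: v_def)
    also have "\<dots> = (\<Sum>a<n. \<nu> a a j)"
      using j by (intro sum.cong refl) (simp add: v_def w)
    finally show ?thesis using trace[OF j] by simp
  qed
  then show ?thesis unfolding von_neumann_form_def using u eb by blast
qed

section \<open>Kraus decompositions and ranks\<close>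

lemma lin_indpt_cols:
  fixes V :: "complex mat"
  assumes V: "V \<in> carrier_mat m n" and cs: "set cs \<subseteq> set (cols V)" "distinct cs"
    and ind: "\<And>x. x \<in> carrier_vec (length cs) \<Longrightarrow> mat_of_cols m cs *\<^sub>v x = 0\<^sub>v m \<Longrightarrow> x = 0\<^sub>v (length cs)"
  shows "length cs \<le> vec_space.rank m V"
proof -
  interpret vec_space "TYPE(complex)" m .
  have car: "set cs \<subseteq> carrier_vec m" using cs V cols_dim[of V] by auto
  then have cols: "cols (mat_of_cols m cs) = cs" by simp
  have "lin_indpt (set cs)"
  proof
    assume "lin_dep (set cs)"
    then have "lin_dep (set (cols (mat_of_cols m cs)))" by (simp add: cols)
    then obtain v where "v \<in> carrier_vec (length cs)" "v \<noteq> 0\<^sub>v (length cs)" "mat_of_cols m cs *\<^sub>v v = 0\<^sub>v m"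
      using lin_depE[of "mat_of_cols m cs" "length cs"] cs(2) by (metis cols mat_of_cols_carrier(1))
    then show False using ind by blast
  qed
  then have "card (set cs) \<le> rank V" using rank_ge_card_indpt[OF V] cs by blast
  then show ?thesis using cs by (simp add: distinct_card)
qed

text \<open>If one column is nonzero and some other column is not a multiple of it, the two are independent and the
  rank is at least two.\<close>
lemma rank_eq_1_iff:
  fixes V :: "complex mat"
  assumes V: "V \<in> carrier_mat m n"
  shows "vec_space.rank m V = 1 \<longleftrightarrow>
    (\<exists>x\<in>carrier_vec m. \<exists>y\<in>carrier_vec n. x \<noteq> 0\<^sub>v m \<and> y \<noteq> 0\<^sub>v n \<and> V = ketbra x y)"
proof
  assume r1: "vec_space.rank m V = 1"
  have "V \<noteq> 0\<^sub>m m n"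
    using r1 vec_space.rank_0I[of m n, where ?'a = complex] by auto
  then obtain r i where ri: "r < m" "i < n" "V $$ (r, i) \<noteq> 0"
    using V eq_matI[of V "0\<^sub>m m n"] by auto
  have "\<exists>t. \<forall>s<m. V $$ (s, j) = t * V $$ (s, i)" if j: "j < n" for j
  proof (rule ccontr)
    assume no: "\<nexists>t. \<forall>s<m. V $$ (s, j) = t * V $$ (s, i)"
    let ?cs = "[col V i, col V j]"
    have ne: "col V i \<noteq> col V j"
    proof
      assume "col V i = col V j"
      then have "V $$ (s, j) = 1 * V $$ (s, i)" if "s < m" for s
        using that V j ri by (metis carrier_matD index_col mult_1)
      then show False using no by blast
    qed
    have "length ?cs \<le> vec_space.rank m V"
    proof (rule lin_indpt_cols[OF V])
      show "set ?cs \<subseteq> set (cols V)" using V ri j by (auto simp: cols_def)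
      fix x assume x: "x \<in> carrier_vec (length ?cs)" and z: "mat_of_cols m ?cs *\<^sub>v x = 0\<^sub>v m"
      have e: "x $ 0 * V $$ (s, i) + x $ 1 * V $$ (s, j) = 0" if s: "s < m" for s
      proof -
        have "(mat_of_cols m ?cs *\<^sub>v x) $ s = (\<Sum>k<2. mat_of_cols m ?cs $$ (s, k) * x $ k)"
          using x s by (intro mat_vec_entry) (auto simp: numeral_2_eq_2)
        also have "\<dots> = x $ 0 * V $$ (s, i) + x $ 1 * V $$ (s, j)"
          using s V ri j by (simp add: numeral_2_eq_2 mat_of_cols_index mult.commute)
        finally show ?thesis using z s by simp
      qed
      have x1: "x $ 1 = 0"
      proof (rule ccontr)
        assume ne: "x $ 1 \<noteq> 0"
        have "V $$ (s, j) = - (x $ 0 / x $ 1) * V $$ (s, i)" if "s < m" for s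
          using e[OF that] ne by (simp add: field_simps eq_neg_iff_add_eq_0)
        then show False using no by blast
      qed
      then have "x $ 0 = 0" using e[OF ri(1)] ri(3) by simp
      then show "x = 0\<^sub>v (length ?cs)" using x x1 by (intro eq_vecI) (auto simp: less_Suc_eq)
    qed (use ne in simp)
    then show False using r1 by simp
  qed
  then obtain t where t: "\<And>j s. j < n \<Longrightarrow> s < m \<Longrightarrow> V $$ (s, j) = t j * V $$ (s, i)" by metis
  let ?x = "col V i" and ?y = "vec n (\<lambda>j. cnj (t j))"
  have "V = ketbra ?x ?y"
  proof (rule eq_matI)
    fix s j assume "s < dim_row (ketbra ?x ?y)" "j < dim_col (ketbra ?x ?y)"
    then have sj: "s < m" "j < n" using V by (auto simp: ketbra_def)
    show "V $$ (s, j) = ketbra ?x ?y $$ (s, j)"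
      using sj V ri t[OF sj(2,1)] by (simp add: ketbra_def mult.commute)
  qed (use V in \<open>auto simp: ketbra_def\<close>)
  moreover have "?x \<noteq> 0\<^sub>v m"
  proof
    assume "?x = 0\<^sub>v m"
    then have "?x $ r = 0" using ri by simp
    then show False using ri V by simp
  qed
  moreover have "?y \<noteq> 0\<^sub>v n"
  proof
    assume "?y = 0\<^sub>v n"
    then have "?y $ i = 0" using ri by simp
    then show False using t[OF ri(2,1)] ri by simp
  qed
  moreover have "?x \<in> carrier_vec m" "?y \<in> carrier_vec n" using V by auto
  ultimately show "\<exists>x\<in>carrier_vec m. \<exists>y\<in>carrier_vec n. x \<noteq> 0\<^sub>v m \<and> y \<noteq> 0\<^sub>v n \<and> V = ketbra x y" by blast
next
  assume "\<exists>x\<in>carrier_vec m. \<exists>y\<in>carrier_vec n. x \<noteq> 0\<^sub>v m \<and> y \<noteq> 0\<^sub>v n \<and> V = ketbra x y"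
  then obtain x y where x: "x \<in> carrier_vec m" "x \<noteq> 0\<^sub>v m" and y: "y \<in> carrier_vec n" "y \<noteq> 0\<^sub>v n"
    and Vxy: "V = ketbra x y" by blast
  have ent: "V $$ (r, i) = x $ r * cnj (y $ i)" if "r < m" "i < n" for r i
    using that x y unfolding Vxy by (simp add: ketbra_entry)
  have "vec_space.rank m V \<le> 1"
    by (rule vec_space.rank_le_1_product_entries[OF V, of "\<lambda>r. x $ r" "\<lambda>i. cnj (y $ i)"])
      (use V ent in auto)
  moreover obtain r where r: "r < m" "x $ r \<noteq> 0" using x by (metis carrier_vecD eq_vecI index_zero_vec)
  moreover obtain i where i: "i < n" "y $ i \<noteq> 0" using y by (metis carrier_vecD eq_vecI index_zero_vec)
  have "length [col V i] \<le> vec_space.rank m V"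
  proof (rule lin_indpt_cols[OF V])
    show "set [col V i] \<subseteq> set (cols V)" using V i by (auto simp: cols_def)
    fix z assume z: "z \<in> carrier_vec (length [col V i])" "mat_of_cols m [col V i] *\<^sub>v z = 0\<^sub>v m"
    have "(mat_of_cols m [col V i] *\<^sub>v z) $ r = (\<Sum>k<1. mat_of_cols m [col V i] $$ (r, k) * z $ k)"
      using z r by (intro mat_vec_entry) auto
    then have "V $$ (r, i) * z $ 0 = 0" using z r V i by (simp add: mat_of_cols_index)
    then show "z = 0\<^sub>v (length [col V i])" using ent[OF r(1) i(1)] r i z by (intro eq_vecI) auto
  qed simp
  ultimately show "vec_space.rank m V = 1" by simp
qed

lemma sandwich_entry:
  fixes B :: "complex mat"
  assumes B: "B \<in> carrier_mat r m" and X: "X \<in> carrier_mat m m" and st: "s < r" "t < r"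
  shows "(B * X * mat_adjoint B) $$ (s, t) = (\<Sum>i<m. \<Sum>j<m. X $$ (i, j) * (B $$ (s, i) * cnj (B $$ (t, j))))"
proof -
  have "(B * X * mat_adjoint B) $$ (s, t) = (\<Sum>j<m. (\<Sum>i<m. B $$ (s, i) * X $$ (i, j)) * cnj (B $$ (t, j)))"
    using B X st by (subst mat_mult_entry[of _ r m _ r])
      (auto intro!: sum.cong simp: mat_mult_entry[OF B X] simp del: index_mult_mat(1))
  also have "\<dots> = (\<Sum>j<m. \<Sum>i<m. X $$ (i, j) * (B $$ (s, i) * cnj (B $$ (t, j))))"
    by (simp add: sum_distrib_left sum_distrib_right mult_ac)
  also have "\<dots> = (\<Sum>i<m. \<Sum>j<m. X $$ (i, j) * (B $$ (s, i) * cnj (B $$ (t, j))))"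
    by (rule sum.swap)
  finally show ?thesis .
qed

lemma Ad_entry:
  assumes V: "V \<in> carrier_mat m n" and X: "X \<in> carrier_mat m m" and ab: "a < n" "b < n"
  shows "Ad V X $$ (a, b) = (\<Sum>i<m. \<Sum>j<m. X $$ (i, j) * (cnj (V $$ (i, a)) * V $$ (j, b)))"
proof -
  have "Ad V X $$ (a, b) = (\<Sum>i<m. \<Sum>j<m. X $$ (i, j) *
      (mat_adjoint V $$ (a, i) * cnj (mat_adjoint V $$ (b, j))))"
    unfolding Ad_def using sandwich_entry[of "mat_adjoint V" n m X a b] assms by simp
  then show ?thesis using assms by simp
qed

lemma Ad_carrier: "V \<in> carrier_mat m n \<Longrightarrow> X \<in> carrier_mat m m \<Longrightarrow> Ad V X \<in> carrier_mat n n"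
  by (simp add: Ad_def mult_carrier_mat[of _ n m])

lemma kraus_family_coef:
  assumes K: "kraus_family m n F l V"
  shows "F \<in> mat_maps m n"
    and "i < m \<Longrightarrow> j < m \<Longrightarrow> a < n \<Longrightarrow> b < n \<Longrightarrow>
      coef m F i j a b = (\<Sum>k<l. cnj (V k $$ (i, a)) * V k $$ (j, b))"
proof -
  have V: "V k \<in> carrier_mat m n" if "k < l" for k using K that by (simp add: kraus_family_def)
  have F: "F X = mat_sum n n (\<lambda>k. Ad (V k) X) {..<l}" if "X \<in> carrier_mat m m" for X
    using K that by (simp add: kraus_family_def)
  have ent: "F X $$ (a, b) = (\<Sum>i<m. \<Sum>j<m. X $$ (i, j) * (\<Sum>k<l. cnj (V k $$ (i, a)) * V k $$ (j, b)))"
    if X: "X \<in> carrier_mat m m" and ab: "a < n" "b < n" for X a b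
  proof -
    have "F X $$ (a, b) = (\<Sum>k<l. \<Sum>i<m. \<Sum>j<m. X $$ (i, j) * (cnj (V k $$ (i, a)) * V k $$ (j, b)))"
      unfolding F[OF X] mat_sum_index(1)[OF ab] using Ad_entry[OF V X ab] by (intro sum.cong refl) simp
    then show ?thesis unfolding sum_distrib_left by (simp only: sum.swap[of _ "{..<m}" "{..<l}"])
  qed
  have car: "F X \<in> carrier_mat n n" if "X \<in> carrier_mat m m" for X
    unfolding F[OF that] by (simp add: carrier_matI)
  from mat_mapsI[OF car ent] show "F \<in> mat_maps m n"
    and "i < m \<Longrightarrow> j < m \<Longrightarrow> a < n \<Longrightarrow> b < n \<Longrightarrow>
      coef m F i j a b = (\<Sum>k<l. cnj (V k $$ (i, a)) * V k $$ (j, b))" by blast+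
qed

lemma Ad_ketbra:
  assumes x: "x \<in> carrier_vec m" and y: "y \<in> carrier_vec n" and X: "X \<in> carrier_mat m m"
  shows "Ad (ketbra x y) X = cinner x (X *\<^sub>v x) \<cdot>\<^sub>m ketbra y y"
proof (rule eq_matI)
  fix a b assume "a < dim_row (cinner x (X *\<^sub>v x) \<cdot>\<^sub>m ketbra y y)" "b < dim_col (cinner x (X *\<^sub>v x) \<cdot>\<^sub>m ketbra y y)"
  then have ab: "a < n" "b < n" using ketbra_carrier[OF y y] by auto
  show "Ad (ketbra x y) X $$ (a, b) = (cinner x (X *\<^sub>v x) \<cdot>\<^sub>m ketbra y y) $$ (a, b)"
    using ab ketbra_carrier[OF y y] unfolding Ad_entry[OF ketbra_carrier[OF x y] X ab]
    by (simp add: ketbra_entry[OF x y] ketbra_entry[OF y y] quadratic_form_entry[OF X x]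
        sum_distrib_left sum_distrib_right mult_ac)
qed (use Ad_carrier[OF ketbra_carrier[OF x y] X] ketbra_carrier[OF y y] in auto)

lemma eb_form_kraus:
  assumes "\<And>k. k < N \<Longrightarrow> x k \<in> carrier_vec m" "\<And>k. k < N \<Longrightarrow> y k \<in> carrier_vec n"
  shows "eb_form m n F N x y \<longleftrightarrow> kraus_family m n F N (\<lambda>k. ketbra (x k) (y k))"
proof -
  have "mat_sum n n (\<lambda>k. Ad (ketbra (x k) (y k)) X) {..<N} =
      mat_sum n n (\<lambda>k. cinner (x k) (X *\<^sub>v x k) \<cdot>\<^sub>m ketbra (y k) (y k)) {..<N}"
    if "X \<in> carrier_mat m m" for X
    unfolding mat_sum_def using assms that
    by (intro cong_mat refl) (auto simp: Ad_ketbra[of _ m _ n] intro!: sum.cong)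
  then show ?thesis
    using assms ketbra_carrier by (auto simp: eb_form_def kraus_family_def)
qed

lemma eb_form_nonzero:
  assumes eb: "eb_form m n F N x y"
  obtains N' x' y' where "eb_form m n F N' x' y'" "\<And>k. k < N' \<Longrightarrow> x' k \<noteq> 0\<^sub>v m \<and> y' k \<noteq> 0\<^sub>v n"
proof -
  let ?I = "{k\<in>{..<N}. x k \<noteq> 0\<^sub>v m \<and> y k \<noteq> 0\<^sub>v n}"
  obtain h where h: "bij_betw h {..<card ?I} ?I"
    using ex_bij_betw_nat_finite[of ?I] by (auto simp: lessThan_atLeast0)
  then have hI: "h k < N" "x (h k) \<noteq> 0\<^sub>v m" "y (h k) \<noteq> 0\<^sub>v n" if "k < card ?I" for k
    using bij_betwE[OF h] that by auto
  have "eb_form m n F (card ?I) (x \<circ> h) (y \<circ> h)"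
    unfolding eb_form_iff_coef
  proof (intro conjI allI impI eb_formD(1)[OF eb])
    fix i j a b assume ij: "i < m" "j < m" and ab: "a < n" "b < n"
    have "coef m F i j a b = (\<Sum>k\<in>?I. cnj (x k $ i) * x k $ j * y k $ a * cnj (y k $ b))"
      unfolding eb_formD(4)[OF eb ij ab] using ij ab
      by (intro sum.mono_neutral_right) auto
    also have "\<dots> = (\<Sum>k<card ?I. cnj (x (h k) $ i) * x (h k) $ j * y (h k) $ a * cnj (y (h k) $ b))"
      by (rule sum.reindex_bij_betw[OF h, symmetric])
    finally show "coef m F i j a b = (\<Sum>k<card ?I. cnj ((x \<circ> h) k $ i) * (x \<circ> h) k $ j * (y \<circ> h) k $ a * cnj ((y \<circ> h) k $ b))"
      by simp
  qed (use eb_formD(2,3)[OF eb] hI in auto)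
  then show ?thesis using that[of "card ?I" "x \<circ> h" "y \<circ> h"] hI by simp
qed

lemma eb_form_rescale:
  assumes eb: "eb_form m n F N x y" and s: "\<And>k. k < N \<Longrightarrow> s k \<noteq> (0 :: real)"
  shows "eb_form m n F N (\<lambda>k. of_real (s k) \<cdot>\<^sub>v x k) (\<lambda>k. of_real (1 / s k) \<cdot>\<^sub>v y k)"
  unfolding eb_form_iff_coef
proof (intro conjI allI impI eb_formD(1)[OF eb])
  fix i j a b assume ij: "i < m" "j < m" and ab: "a < n" "b < n"
  show "coef m F i j a b = (\<Sum>k<N. cnj ((of_real (s k) \<cdot>\<^sub>v x k) $ i) * (of_real (s k) \<cdot>\<^sub>v x k) $ j *
      (of_real (1 / s k) \<cdot>\<^sub>v y k) $ a * cnj ((of_real (1 / s k) \<cdot>\<^sub>v y k) $ b))"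
    unfolding eb_formD(4)[OF eb ij ab]
  proof (intro sum.cong refl)
    fix k assume "k \<in> {..<N}"
    then have k: "k < N" by simp
    have d: "dim_vec (x k) = m" "dim_vec (y k) = n" using eb_formD(2,3)[OF eb k] by auto
    show "cnj (x k $ i) * x k $ j * y k $ a * cnj (y k $ b) =
      cnj ((of_real (s k) \<cdot>\<^sub>v x k) $ i) * (of_real (s k) \<cdot>\<^sub>v x k) $ j *
      (of_real (1 / s k) \<cdot>\<^sub>v y k) $ a * cnj ((of_real (1 / s k) \<cdot>\<^sub>v y k) $ b)"
      using ij ab d s[OF k] by simp
  qed
qed (use eb_formD(2,3)[OF eb] in auto)

lemma eb_form_unit_right:
  assumes eb: "eb_form m n F N x y" and nz: "\<And>k. k < N \<Longrightarrow> y k \<noteq> 0\<^sub>v n"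
  obtains x' y' where "eb_form m n F N x' y'" "\<And>k. k < N \<Longrightarrow> cinner (y' k) (y' k) = 1"
proof -
  have "\<forall>k\<in>{..<N}. \<exists>s::real. s \<noteq> 0 \<and> cinner (of_real (1 / s) \<cdot>\<^sub>v y k) (of_real (1 / s) \<cdot>\<^sub>v y k) = 1"
  proof
    fix k assume "k \<in> {..<N}"
    then have "y k \<in> carrier_vec n" "y k \<noteq> 0\<^sub>v n" using eb_formD(3)[OF eb] nz by auto
    then show "\<exists>s::real. s \<noteq> 0 \<and> cinner (of_real (1 / s) \<cdot>\<^sub>v y k) (of_real (1 / s) \<cdot>\<^sub>v y k) = 1"
      by (meson normalizing_scalar)
  qed
  then obtain s :: "nat \<Rightarrow> real" where s: "\<And>k. k < N \<Longrightarrow> s k \<noteq> 0"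
    "\<And>k. k < N \<Longrightarrow> cinner (of_real (1 / s k) \<cdot>\<^sub>v y k) (of_real (1 / s k) \<cdot>\<^sub>v y k) = 1"
    unfolding bchoice_iff by auto
  show ?thesis by (rule that[OF eb_form_rescale[OF eb s(1)] s(2)])
qed

text \<open>Trace preservation says \<open>\<Sum> |x\<^sub>k><x\<^sub>k| = I\<close>; with only \<open>m\<close> summands this makes the \<open>x\<^sub>k\<close> orthonormal.\<close>
lemma eb_form_trace_preserving_orthonormal:
  assumes eb: "eb_form m n F m x y" and unit: "\<And>k. k < m \<Longrightarrow> cinner (y k) (y k) = 1"
    and tp: "\<And>i j. i < m \<Longrightarrow> j < m \<Longrightarrow> (\<Sum>a<n. coef m F i j a a) = (if i = j then 1 else 0)"
  shows "orthonormal m x"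
proof (rule orthonormalI)
  fix i j assume ij: "i < m" "j < m"
  have "(\<Sum>a<n. coef m F j i a a) = (\<Sum>k<m. \<Sum>a<n. x k $ i * cnj (x k $ j) * (cnj (y k $ a) * y k $ a))"
    using ij by (subst sum.swap, intro sum.cong refl) (simp add: eb_formD(4)[OF eb] mult_ac)
  also have "\<dots> = (\<Sum>k<m. x k $ i * cnj (x k $ j))"
  proof (intro sum.cong refl)
    fix k assume "k \<in> {..<m}"
    then have "(\<Sum>a<n. cnj (y k $ a) * y k $ a) = 1"
      using unit eb_formD(3)[OF eb] by (simp add: cinner_index[of _ n, symmetric])
    then show "(\<Sum>a<n. x k $ i * cnj (x k $ j) * (cnj (y k $ a) * y k $ a)) = x k $ i * cnj (x k $ j)"
      unfolding sum_distrib_left[symmetric] by simp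
  qed
  finally show "(\<Sum>k<m. x k $ i * cnj (x k $ j)) = (if i = j then 1 else 0)"
    using tp[OF ij(2,1)] by auto
qed (rule eb_formD(2)[OF eb])

text \<open>The Choi matrix of \<open>F\<close> is the projection onto the span of \<open>m\<close> orthonormal vectors \<open>\<eta>\<^sub>j\<close>.  With fewer than
  \<open>m\<close> Kraus operators some nonzero combination \<open>z\<close> of these vectors would be annihilated by the Choi matrix.\<close>
lemma von_neumann_form_kraus_length:
  assumes "von_neumann_form m n F" and K: "kraus_family m n F l V"
  shows "m \<le> l"
proof (rule ccontr)
  assume "\<not> m \<le> l"
  then have l: "l < m" by simp
  obtain u v where u: "orthonormal m u" and v: "\<And>j. j < m \<Longrightarrow> cinner (v j) (v j) = 1"
    and eb: "eb_form m n F m u v"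
    using assms by (auto simp: von_neumann_form_def)
  define \<eta> where "\<eta> j = (\<lambda>(i, a). cnj (u j $ i) * v j $ a)" for j
  have \<eta>: "(\<Sum>t\<in>blocks m n. cnj (\<eta> j t) * \<eta> k t) = (if k = j then 1 else 0)" if jk: "j < m" "k < m" for j k
  proof -
    have "(\<Sum>t\<in>blocks m n. cnj (\<eta> j t) * \<eta> k t) =
        (\<Sum>i<m. cnj (u k $ i) * u j $ i) * (\<Sum>a<n. cnj (v j $ a) * v k $ a)"
      unfolding sum.cartesian_product' sum_product by (simp add: \<eta>_def mult_ac)
    also have "(\<Sum>i<m. cnj (u k $ i) * u j $ i) = (if k = j then 1 else 0)"
      using u jk by (auto simp: orthonormal_def cinner_index[of _ m, symmetric])
    finally show ?thesis using v[OF jk(1)] eb_formD(3)[OF eb jk(1)] by (auto simp: cinner_index[of _ n])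
  qed
  obtain g where g: "g \<in> carrier_vec m" "g \<noteq> 0\<^sub>v m"
    and gz: "\<And>r. r < l \<Longrightarrow> (\<Sum>j<m. (\<Sum>(i, a)\<in>blocks m n. V r $$ (i, a) * \<eta> j (i, a)) * g $ j) = 0"
    using homogeneous_system_nontrivial[OF l, of "\<lambda>r j. \<Sum>(i, a)\<in>blocks m n. V r $$ (i, a) * \<eta> j (i, a)"] by blast
  define z where "z t = (\<Sum>j<m. g $ j * \<eta> j t)" for t
  have apply_z: "(\<Sum>t\<in>blocks m n. f t * z t) = (\<Sum>j<m. (\<Sum>t\<in>blocks m n. f t * \<eta> j t) * g $ j)" for f
    unfolding z_def sum_distrib_left sum_distrib_right by (subst sum.swap) (simp add: mult_ac)
  let ?Q = "sesq (blocks m n) (choi_kernel m F) z z"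
  have "?Q = of_real (\<Sum>k<m. (cmod (\<Sum>t\<in>blocks m n. cnj (\<eta> k t) * z t))\<^sup>2)"
    by (rule sesq_gram) (auto simp: choi_kernel_def eb_formD(4)[OF eb] \<eta>_def mult_ac)
  also have "\<dots> = of_real (\<Sum>k<m. (cmod (g $ k))\<^sup>2)"
  proof -
    have "(\<Sum>t\<in>blocks m n. cnj (\<eta> k t) * z t) = g $ k" if "k < m" for k
    proof -
      have "(\<Sum>j<m. (\<Sum>t\<in>blocks m n. cnj (\<eta> k t) * \<eta> j t) * g $ j) = (\<Sum>j<m. if j = k then g $ k else 0)"
        using \<eta>[OF that] by (intro sum.cong refl) auto
      then show ?thesis using that by (simp add: apply_z)
    qed
    then show ?thesis by simp
  qed
  finally have Q1: "?Q = cinner g g" by (simp add: cinner_self[OF g(1)])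
  have "?Q = of_real (\<Sum>r<l. (cmod (\<Sum>t\<in>blocks m n. cnj ((\<lambda>(i, a). cnj (V r $$ (i, a))) t) * z t))\<^sup>2)"
    by (rule sesq_gram) (auto simp: choi_kernel_def kraus_family_coef(2)[OF K])
  also have "\<dots> = 0"
  proof -
    have "(\<Sum>t\<in>blocks m n. cnj ((\<lambda>(i, a). cnj (V r $$ (i, a))) t) * z t) = 0" if "r < l" for r
      using gz[OF that] unfolding apply_z by (simp add: split_beta)
    then show ?thesis by simp
  qed
  finally show False using Q1 g cinner_self_eq_0 by auto
qed

theorem von_neumann_form_ranks:
  assumes vN: "von_neumann_form m n F"
  shows "EB m n F" and "ER m n F = m" and "CR m n F = m"
proof -
  obtain u v where u: "orthonormal m u" and v: "\<And>j. j < m \<Longrightarrow> cinner (v j) (v j) = 1"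
    and eb: "eb_form m n F m u v"
    using assms by (auto simp: von_neumann_form_def)
  show "EB m n F" by (rule eb_form_EB[OF eb])
  let ?V = "\<lambda>k. ketbra (u k) (v k)"
  have K: "kraus_family m n F m ?V" using eb eb_form_kraus[where x = u and y = v, OF eb_formD(2,3)[OF eb]] by blast
  have r: "vec_space.rank m (?V k) = 1" if k: "k < m" for k
  proof -
    have "cinner (u k) (u k) = 1" using u k by (simp add: orthonormal_def)
    then have "u k \<noteq> 0\<^sub>v m" "v k \<noteq> 0\<^sub>v n"
      using v[OF k] by (auto simp: cinner_index[of _ m] cinner_index[of _ n])
    then show ?thesis
      using rank_eq_1_iff[OF ketbra_carrier] eb_formD(2,3)[OF eb k] by blast
  qed
  show "CR m n F = m"
    unfolding CR_def by (rule Least_equality) (use K von_neumann_form_kraus_length[OF vN] in blast)+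
  show "ER m n F = m"
    unfolding ER_def by (rule Least_equality) (use K r von_neumann_form_kraus_length[OF vN] in blast)+
qed

text \<open>A minimal family of \<open>m\<close> rank-one Kraus operators is a measure-and-prepare form of length \<open>m\<close>, and after
  normalizing the prepared vectors the measured ones are orthonormal.\<close>
theorem ER_von_neumann_form:
  assumes EB: "EB m n F" and ER: "ER m n F = m"
    and tp: "\<And>i j. i < m \<Longrightarrow> j < m \<Longrightarrow> (\<Sum>a<n. coef m F i j a a) = (if i = j then 1 else 0)"
  shows "von_neumann_form m n F"
proof -
  let ?P = "\<lambda>l. \<exists>V. kraus_family m n F l V \<and> (\<forall>i<l. vec_space.rank m (V i) = 1)"
  obtain N0 x0 y0 where eb0: "eb_form m n F N0 x0 y0" by (rule EB_eb_form[OF EB])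
  obtain N x y where eb: "eb_form m n F N x y"
    and nz: "\<And>k. k < N \<Longrightarrow> x k \<noteq> 0\<^sub>v m \<and> y k \<noteq> 0\<^sub>v n"
    by (rule eb_form_nonzero[OF eb0]) blast
  have "vec_space.rank m (ketbra (x k) (y k)) = 1" if "k < N" for k
    using rank_eq_1_iff[OF ketbra_carrier] eb_formD(2,3)[OF eb that] nz[OF that] by blast
  then have "?P N" using eb eb_form_kraus[where x = x and y = y, OF eb_formD(2,3)[OF eb]] by blast
  then have "?P (ER m n F)" unfolding ER_def by (rule LeastI)
  then obtain V where K: "kraus_family m n F m V" and r: "\<And>k. k < m \<Longrightarrow> vec_space.rank m (V k) = 1"
    unfolding ER by blast
  have V: "V k \<in> carrier_mat m n" if "k < m" for k using K that by (simp add: kraus_family_def)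
  have "\<forall>k\<in>{..<m}. \<exists>p. fst p \<in> carrier_vec m \<and> snd p \<in> carrier_vec n \<and> fst p \<noteq> 0\<^sub>v m \<and> snd p \<noteq> 0\<^sub>v n \<and>
      V k = ketbra (fst p) (snd p)"
    using r rank_eq_1_iff[OF V] by fastforce
  then obtain p where p: "\<And>k. k < m \<Longrightarrow> fst (p k) \<in> carrier_vec m \<and> snd (p k) \<in> carrier_vec n \<and>
      snd (p k) \<noteq> 0\<^sub>v n \<and> V k = ketbra (fst (p k)) (snd (p k))"
    unfolding bchoice_iff by auto
  have "kraus_family m n F m (\<lambda>k. ketbra (fst (p k)) (snd (p k)))"
    using K p by (simp add: kraus_family_def mat_sum_def)
  then have "eb_form m n F m (\<lambda>k. fst (p k)) (\<lambda>k. snd (p k))"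
    using p by (subst eb_form_kraus) auto
  from eb_form_unit_right[OF this] p obtain x' y' where eb': "eb_form m n F m x' y'"
    and y': "\<And>k. k < m \<Longrightarrow> cinner (y' k) (y' k) = 1" by blast
  show ?thesis
    unfolding von_neumann_form_def
    using eb_form_trace_preserving_orthonormal[OF eb' y' tp] eb' y' by blast
qed

section \<open>Complementary maps\<close>

text \<open>\<open>\<beta> a c i\<close> is the entry of the dilation \<open>B\<close> at row \<open>(a, c)\<close> and column \<open>i\<close>.\<close>
definition dilation_coefs ::
  "nat \<Rightarrow> nat \<Rightarrow> nat \<Rightarrow> (complex mat \<Rightarrow> complex mat) \<Rightarrow> (complex mat \<Rightarrow> complex mat) \<Rightarrow>
   (nat \<Rightarrow> nat \<Rightarrow> nat \<Rightarrow> complex) \<Rightarrow> bool" where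
  "dilation_coefs m p q F G \<beta> \<longleftrightarrow> (\<forall>i<m. \<forall>j<m.
     (\<forall>a<p. \<forall>b<p. coef m F i j a b = (\<Sum>c<q. \<beta> a c i * cnj (\<beta> b c j))) \<and>
     (\<forall>c<q. \<forall>e<q. coef m G i j c e = (\<Sum>a<p. \<beta> a c i * cnj (\<beta> a e j))))"

lemma dilation_coefsD:
  assumes "dilation_coefs m p q F G \<beta>"
  shows "i < m \<Longrightarrow> j < m \<Longrightarrow> a < p \<Longrightarrow> b < p \<Longrightarrow> coef m F i j a b = (\<Sum>c<q. \<beta> a c i * cnj (\<beta> b c j))"
    and "i < m \<Longrightarrow> j < m \<Longrightarrow> c < q \<Longrightarrow> e < q \<Longrightarrow> coef m G i j c e = (\<Sum>a<p. \<beta> a c i * cnj (\<beta> a e j))"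
  using assms by (auto simp: dilation_coefs_def)

theorem complementary_iff_coef:
  "complementary m p q F G \<longleftrightarrow> F \<in> mat_maps m p \<and> G \<in> mat_maps m q \<and> (\<exists>\<beta>. dilation_coefs m p q F G \<beta>)"
proof
  assume c: "complementary m p q F G"
  then have F: "F \<in> mat_maps m p" and G: "G \<in> mat_maps m q" by (auto simp: complementary_def CP_def)
  obtain B where B: "B \<in> carrier_mat (p * q) m" and FG: "\<And>X. X \<in> carrier_mat m m \<Longrightarrow>
      F X = ptrace_right p q (B * X * mat_adjoint B) \<and> G X = ptrace_left p q (B * X * mat_adjoint B)"
    using c by (auto simp: complementary_def)
  define \<beta> where "\<beta> a c i = B $$ (a * q + c, i)" for a c i
  have ent: "(B * mat_unit m i j * mat_adjoint B) $$ (a * q + c, b * q + e) = \<beta> a c i * cnj (\<beta> b e j)"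
    if "i < m" "j < m" "a < p" "b < p" "c < q" "e < q" for i j a b c e
  proof -
    have "(B * mat_unit m i j * mat_adjoint B) $$ (a * q + c, b * q + e) =
        (\<Sum>i'<m. \<Sum>j'<m. mat_unit m i j $$ (i', j') * (B $$ (a * q + c, i') * cnj (B $$ (b * q + e, j'))))"
      using that by (intro sandwich_entry[OF B]) (auto simp: block_bound)
    also have "\<dots> = (\<Sum>i'<m. \<Sum>j'<m. if j' = j then (if i' = i then \<beta> a c i * cnj (\<beta> b e j) else 0) else 0)"
      using that by (intro sum.cong refl) (auto simp: \<beta>_def)
    finally show ?thesis using that by simp
  qed
  have "dilation_coefs m p q F G \<beta>"
    unfolding dilation_coefs_def
    using FG[OF mat_unit_carrier] ent by (simp add: coef_def ptrace_right_def ptrace_left_def)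
  then show "F \<in> mat_maps m p \<and> G \<in> mat_maps m q \<and> (\<exists>\<beta>. dilation_coefs m p q F G \<beta>)"
    using F G by blast
next
  assume *: "F \<in> mat_maps m p \<and> G \<in> mat_maps m q \<and> (\<exists>\<beta>. dilation_coefs m p q F G \<beta>)"
  then have F: "F \<in> mat_maps m p" and G: "G \<in> mat_maps m q" by auto
  from * obtain \<beta> where d: "dilation_coefs m p q F G \<beta>" by blast
  note cF = dilation_coefsD(1)[OF d] and cG = dilation_coefsD(2)[OF d]
  have "CP m p F"
    unfolding CP_iff_choi_kernel
    by (intro conjI F psd_kernel_gramI[where I = "{..<q}" and w = "\<lambda>c (i, a). \<beta> a c i"])
      (auto simp: choi_kernel_def cF)
  moreover have "CP m q G"
    unfolding CP_iff_choi_kernel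
    by (intro conjI G psd_kernel_gramI[where I = "{..<p}" and w = "\<lambda>a (i, c). \<beta> a c i"])
      (auto simp: choi_kernel_def cG)
  moreover define B where "B = mat (p * q) m (\<lambda>(r, i). \<beta> (r div q) (r mod q) i)"
  have B: "B \<in> carrier_mat (p * q) m" by (simp add: B_def)
  have ent: "(B * X * mat_adjoint B) $$ (a * q + c, b * q + e) =
      (\<Sum>i<m. \<Sum>j<m. X $$ (i, j) * (\<beta> a c i * cnj (\<beta> b e j)))"
    if X: "X \<in> carrier_mat m m" and "a < p" "b < p" "c < q" "e < q" for X a b c e
    using that by (subst sandwich_entry[OF B X]) (auto simp: B_def block_bound intro!: sum.cong)
  have "F X = ptrace_right p q (B * X * mat_adjoint B)" if X: "X \<in> carrier_mat m m" for X
  proof (rule eq_matI)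
    have FX: "F X \<in> carrier_mat p p" using F X by (auto simp: mat_maps_iff)
    show "dim_row (F X) = dim_row (ptrace_right p q (B * X * mat_adjoint B))"
      "dim_col (F X) = dim_col (ptrace_right p q (B * X * mat_adjoint B))"
      using FX by (auto simp: ptrace_right_def)
    fix a b assume "a < dim_row (ptrace_right p q (B * X * mat_adjoint B))"
      "b < dim_col (ptrace_right p q (B * X * mat_adjoint B))"
    then have ab: "a < p" "b < p" by (auto simp: ptrace_right_def)
    have "F X $$ (a, b) = (\<Sum>i<m. \<Sum>j<m. \<Sum>c<q. X $$ (i, j) * (\<beta> a c i * cnj (\<beta> b c j)))"
      unfolding map_entry[OF F X ab] using ab by (simp add: cF sum_distrib_left)
    also have "\<dots> = (\<Sum>c<q. \<Sum>i<m. \<Sum>j<m. X $$ (i, j) * (\<beta> a c i * cnj (\<beta> b c j)))"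
      by (simp only: sum.swap[of _ "{..<q}" "{..<m}"])
    finally show "F X $$ (a, b) = ptrace_right p q (B * X * mat_adjoint B) $$ (a, b)"
      using ab ent[OF X] by (simp add: ptrace_right_def)
  qed
  moreover have "G X = ptrace_left p q (B * X * mat_adjoint B)" if X: "X \<in> carrier_mat m m" for X
  proof (rule eq_matI)
    have GX: "G X \<in> carrier_mat q q" using G X by (auto simp: mat_maps_iff)
    show "dim_row (G X) = dim_row (ptrace_left p q (B * X * mat_adjoint B))"
      "dim_col (G X) = dim_col (ptrace_left p q (B * X * mat_adjoint B))"
      using GX by (auto simp: ptrace_left_def)
    fix c e assume "c < dim_row (ptrace_left p q (B * X * mat_adjoint B))"
      "e < dim_col (ptrace_left p q (B * X * mat_adjoint B))"
    then have ce: "c < q" "e < q" by (auto simp: ptrace_left_def)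
    have "G X $$ (c, e) = (\<Sum>i<m. \<Sum>j<m. \<Sum>a<p. X $$ (i, j) * (\<beta> a c i * cnj (\<beta> a e j)))"
      unfolding map_entry[OF G X ce] using ce by (simp add: cG sum_distrib_left)
    also have "\<dots> = (\<Sum>a<p. \<Sum>i<m. \<Sum>j<m. X $$ (i, j) * (\<beta> a c i * cnj (\<beta> a e j)))"
      by (simp only: sum.swap[of _ "{..<p}" "{..<m}"])
    finally show "G X $$ (c, e) = ptrace_left p q (B * X * mat_adjoint B) $$ (c, e)"
      using ce ent[OF X] by (simp add: ptrace_left_def)
  qed
  ultimately show "complementary m p q F G" unfolding complementary_def using B by blast
qed

lemma sum_mult_cnj_eq_0:
  assumes "finite S" "(\<Sum>c\<in>S. f c * cnj (f c)) = 0" "c \<in> S"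
  shows "f c = (0 :: complex)"
proof -
  have "of_real (\<Sum>c\<in>S. (cmod (f c))\<^sup>2) = (\<Sum>c\<in>S. f c * cnj (f c))"
    unfolding of_real_sum complex_norm_square ..
  then have "(\<Sum>c\<in>S. (cmod (f c))\<^sup>2) = 0" using assms(2) by (metis of_real_eq_0_iff)
  then show ?thesis using assms(1,3) by (simp add: sum_nonneg_eq_0_iff)
qed

lemma schur_map_coef:
  assumes A: "A \<in> carrier_mat m m"
  shows "schur_map A \<in> mat_maps m m"
    and "i < m \<Longrightarrow> j < m \<Longrightarrow> a < m \<Longrightarrow> b < m \<Longrightarrow>
      coef m (schur_map A) i j a b = (if i = a \<and> j = b then A $$ (i, j) else 0)"
proof -
  have car: "schur_map A X \<in> carrier_mat m m" for X using A by (auto simp: schur_map_def)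
  have ent: "schur_map A X $$ (a, b) = (\<Sum>i<m. \<Sum>j<m. X $$ (i, j) * (if i = a \<and> j = b then A $$ (i, j) else 0))"
    if ab: "a < m" "b < m" for X a b
  proof -
    have "(\<Sum>i<m. \<Sum>j<m. X $$ (i, j) * (if i = a \<and> j = b then A $$ (i, j) else 0)) =
        (\<Sum>i<m. \<Sum>j<m. if j = b then (if i = a then X $$ (a, b) * A $$ (a, b) else 0) else 0)"
      by (intro sum.cong refl) auto
    then show ?thesis using ab A by (simp add: schur_map_def mult.commute)
  qed
  from mat_mapsI[of m "schur_map A" m "\<lambda>i j a b. if i = a \<and> j = b then A $$ (i, j) else 0", OF car ent]
  show "schur_map A \<in> mat_maps m m" and "i < m \<Longrightarrow> j < m \<Longrightarrow> a < m \<Longrightarrow> b < m \<Longrightarrow>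
      coef m (schur_map A) i j a b = (if i = a \<and> j = b then A $$ (i, j) else 0)" by blast+
qed

lemma cinner_Ad:
  assumes U: "U \<in> carrier_mat m m" and X: "X \<in> carrier_mat m m" and z: "z \<in> carrier_vec m"
  shows "cinner z (Ad U X *\<^sub>v z) = cinner (U *\<^sub>v z) (X *\<^sub>v (U *\<^sub>v z))"
proof -
  have Uz: "U *\<^sub>v z \<in> carrier_vec m" and Ua: "mat_adjoint U \<in> carrier_mat m m" using U z by auto
  have "Ad U X *\<^sub>v z = (mat_adjoint U * X) *\<^sub>v (U *\<^sub>v z)"
    unfolding Ad_def by (rule assoc_mult_mat_vec[OF mult_carrier_mat[OF Ua X] U z])
  also have "\<dots> = mat_adjoint U *\<^sub>v (X *\<^sub>v (U *\<^sub>v z))"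
    by (rule assoc_mult_mat_vec[OF Ua X Uz])
  finally show ?thesis
    using cinner_adjoint[OF Ua z mult_mat_vec_carrier[OF X Uz]] by simp
qed

lemma eb_form_comp_Ad:
  assumes S: "eb_form m n S N x y" and U: "U \<in> carrier_mat m m"
    and F: "\<And>X. X \<in> carrier_mat m m \<Longrightarrow> F X = S (Ad U X)"
  shows "eb_form m n F N (\<lambda>k. U *\<^sub>v x k) y"
  unfolding eb_form_def
proof (intro conjI ballI)
  show "\<forall>k<N. U *\<^sub>v x k \<in> carrier_vec m \<and> y k \<in> carrier_vec n"
    using eb_formD(2,3)[OF S] U by auto
  fix X :: "complex mat" assume X: "X \<in> carrier_mat m m"
  have "F X = mat_sum n n (\<lambda>k. cinner (x k) (Ad U X *\<^sub>v x k) \<cdot>\<^sub>m ketbra (y k) (y k)) {..<N}"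
    unfolding F[OF X] using S Ad_carrier[OF U X] by (simp add: eb_form_def)
  also have "\<dots> = mat_sum n n (\<lambda>k. cinner (U *\<^sub>v x k) (X *\<^sub>v (U *\<^sub>v x k)) \<cdot>\<^sub>m ketbra (y k) (y k)) {..<N}"
    unfolding mat_sum_def using eb_formD(2)[OF S]
    by (intro cong_mat refl) (auto simp: cinner_Ad[OF U X] intro!: sum.cong)
  finally show "F X = \<dots>" .
qed

lemma mult_unit_vec:
  fixes U :: "complex mat"
  assumes "U \<in> carrier_mat m m" "j < m"
  shows "U *\<^sub>v unit_vec m j = col U j"
proof (rule eq_vecI)
  fix i assume "i < dim_vec (col U j)"
  then have i: "i < m" using assms by simp
  have "(U *\<^sub>v unit_vec m j) $ i = (\<Sum>k<m. U $$ (i, k) * (if k = j then 1 else 0))"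
    unfolding mat_vec_entry[OF assms(1) unit_vec_carrier i] using assms(2) by (intro sum.cong refl) auto
  then show "(U *\<^sub>v unit_vec m j) $ i = col U j $ i"
    using assms i sum_delta_mult[of "{..<m}" j "\<lambda>k. U $$ (i, k)"] by simp
qed (use assms in simp)

lemma sum_unit_vec:
  assumes "i < m" "j < m"
  shows "(\<Sum>k<m. cnj (unit_vec m k $ i) * unit_vec m k $ j * f k) = (if i = j then f i else (0 :: complex))"
proof -
  have "(\<Sum>k<m. cnj (unit_vec m k $ i) * unit_vec m k $ j * f k) =
      (\<Sum>k<m. if k = i then (if i = j then f i else 0) else 0)"
    using assms by (intro sum.cong refl) auto
  then show ?thesis using assms by simp
qed

lemma orthonormal_cols_iff_unitary:
  assumes U: "U \<in> carrier_mat m m"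
  shows "unitary m U \<longleftrightarrow> orthonormal m (col U)"
proof
  assume "unitary m U"
  then have UU: "mat_adjoint U * U = 1\<^sub>m m" by (simp add: unitary_def)
  have "cinner (col U i) (col U j) = (if i = j then 1 else 0)" if ij: "i < m" "j < m" for i j
  proof -
    have "cinner (col U i) (col U j) = (mat_adjoint U * U) $$ (i, j)"
      using U ij by (subst mat_mult_entry[of _ m m]) (auto simp: cinner_index[of _ m])
    then show ?thesis using ij UU by simp
  qed
  then show "orthonormal m (col U)" using U by (auto simp: orthonormal_def)
next
  assume o: "orthonormal m (col U)"
  have "(mat_adjoint U * U) $$ (i, j) = (if i = j then 1 else 0)" if ij: "i < m" "j < m" for i j
  proof -
    have "(mat_adjoint U * U) $$ (i, j) = cinner (col U i) (col U j)"
      using U ij by (subst mat_mult_entry[of _ m m]) (auto simp: cinner_index[of _ m])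
    then show ?thesis using o ij by (simp add: orthonormal_def)
  qed
  then have "mat_adjoint U * U = 1\<^sub>m m" using U by (intro eq_matI) auto
  moreover have "(U * mat_adjoint U) $$ (i, j) = (if i = j then 1 else 0)" if ij: "i < m" "j < m" for i j
  proof -
    have "(U * mat_adjoint U) $$ (i, j) = (\<Sum>k<m. col U k $ i * cnj (col U k $ j))"
      using U ij by (subst mat_mult_entry[of _ m m]) auto
    then show ?thesis using orthonormal_complete[OF o ij] by simp
  qed
  then have "U * mat_adjoint U = 1\<^sub>m m" using U by (intro eq_matI) auto
  ultimately show "unitary m U" using U by (simp add: unitary_def)
qed

text \<open>Take \<open>A\<close> to be the Gram matrix of the prepared vectors and the \<open>u\<^sub>j\<close> to be the columns of \<open>U\<close>: then
  \<open>e\<^sub>j \<mapsto> e\<^sub>j \<otimes> v\<^sub>j\<close> dilates the Schur map, and its complement measures in the standard basis and prepares \<open>v\<^sub>j\<close>.\<close>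
theorem von_neumann_form_iff_schur_complement:
  "von_neumann_form m n F \<longleftrightarrow> (\<exists>A U S. psd m A \<and> (\<forall>i<m. A $$ (i, i) = 1) \<and> unitary m U \<and>
     complementary m m n (schur_map A) S \<and> (\<forall>X\<in>carrier_mat m m. F X = S (Ad U X)))"
proof
  assume "von_neumann_form m n F"
  then obtain u v where u: "orthonormal m u" and v: "\<And>j. j < m \<Longrightarrow> cinner (v j) (v j) = 1"
    and eb: "eb_form m n F m u v"
    by (auto simp: von_neumann_form_def)
  note vc = eb_formD(3)[OF eb]
  define A where "A = mat m m (\<lambda>(i, j). \<Sum>c<n. v i $ c * cnj (v j $ c))"
  have Ac: "A \<in> carrier_mat m m" by (simp add: A_def)
  define U where "U = mat m m (\<lambda>(i, j). u j $ i)"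
  have Uc: "U \<in> carrier_mat m m" by (simp add: U_def)
  have colU: "col U j = u j" if "j < m" for j
    using u that by (intro eq_vecI) (auto simp: U_def orthonormal_def)
  define S where "S X = mat_sum n n (\<lambda>j. cinner (unit_vec m j) (X *\<^sub>v unit_vec m j) \<cdot>\<^sub>m ketbra (v j) (v j)) {..<m}" for X
  have S: "eb_form m n S m (unit_vec m) v"
    using vc by (simp add: eb_form_def S_def)
  have "psd m A"
    unfolding psd_iff_kernel using Ac
    by (intro conjI psd_kernel_gramI[where I = "{..<n}" and w = "\<lambda>c i. v i $ c"]) (auto simp: A_def)
  moreover have "\<forall>i<m. A $$ (i, i) = 1"
    using v vc by (auto simp: A_def cinner_index[of _ n] mult.commute)
  moreover have "orthonormal m (col U)"
    using u colU by (simp add: orthonormal_def)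
  then have "unitary m U" using orthonormal_cols_iff_unitary[OF Uc] by simp
  moreover have "complementary m m n (schur_map A) S"
    unfolding complementary_iff_coef
  proof (intro conjI schur_map_coef(1)[OF Ac] eb_formD(1)[OF S] exI[of _ "\<lambda>a c i. if a = i then v i $ c else 0"],
      unfold dilation_coefs_def, intro allI impI conjI)
    let ?\<beta> = "\<lambda>a c i. if a = i then v i $ c else 0"
    fix i j assume ij: "i < m" "j < m"
    {
      fix a b assume ab: "a < m" "b < m"
      show "coef m (schur_map A) i j a b = (\<Sum>c<n. ?\<beta> a c i * cnj (?\<beta> b c j))"
        using ij ab by (simp add: schur_map_coef(2)[OF Ac]) (auto simp: A_def)
    next
      fix c e assume ce: "c < n" "e < n"
      have "coef m S i j c e = (if i = j then v i $ c * cnj (v i $ e) else 0)"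
        unfolding eb_formD(4)[OF S ij ce] mult.assoc[of _ "v _ $ c"]
        by (rule sum_unit_vec[OF ij])
      also have "\<dots> = (\<Sum>a<m. if a = i then (if i = j then v i $ c * cnj (v i $ e) else 0) else 0)"
        using ij by simp
      also have "\<dots> = (\<Sum>a<m. ?\<beta> a c i * cnj (?\<beta> a e j))"
        by (intro sum.cong refl) auto
      finally show "coef m S i j c e = (\<Sum>a<m. ?\<beta> a c i * cnj (?\<beta> a e j))" .
    }
  qed
  moreover have "F X = S (Ad U X)" if X: "X \<in> carrier_mat m m" for X
  proof -
    have "F X = mat_sum n n (\<lambda>k. cinner (u k) (X *\<^sub>v u k) \<cdot>\<^sub>m ketbra (v k) (v k)) {..<m}"
      using eb X by (simp add: eb_form_def)
    also have "\<dots> = S (Ad U X)"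
      unfolding S_def mat_sum_def
      by (intro cong_mat refl)
        (auto simp: cinner_Ad[OF Uc X unit_vec_carrier] mult_unit_vec[OF Uc] colU intro!: sum.cong)
    finally show ?thesis .
  qed
  ultimately show "\<exists>A U S. psd m A \<and> (\<forall>i<m. A $$ (i, i) = 1) \<and> unitary m U \<and>
     complementary m m n (schur_map A) S \<and> (\<forall>X\<in>carrier_mat m m. F X = S (Ad U X))" by blast
next
  assume "\<exists>A U S. psd m A \<and> (\<forall>i<m. A $$ (i, i) = 1) \<and> unitary m U \<and>
     complementary m m n (schur_map A) S \<and> (\<forall>X\<in>carrier_mat m m. F X = S (Ad U X))"
  then obtain A U S where A: "psd m A" "\<And>i. i < m \<Longrightarrow> A $$ (i, i) = 1" and U: "unitary m U"
    and comp: "complementary m m n (schur_map A) S"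
    and F: "\<And>X. X \<in> carrier_mat m m \<Longrightarrow> F X = S (Ad U X)" by blast
  have Ac: "A \<in> carrier_mat m m" using A by (simp add: psd_def)
  have Uc: "U \<in> carrier_mat m m" using U by (simp add: unitary_def)
  from comp obtain \<beta> where SS: "S \<in> mat_maps m n" and d: "dilation_coefs m m n (schur_map A) S \<beta>"
    unfolding complementary_iff_coef by blast
  note \<beta>A = dilation_coefsD(1)[OF d] and \<beta>S = dilation_coefsD(2)[OF d]
  \<comment> \<open>The Schur map fixes \<open>|e\<^sub>i><e\<^sub>i|\<close>, so the dilation maps \<open>e\<^sub>i\<close> to a product vector \<open>e\<^sub>i \<otimes> v\<^sub>i\<close>.\<close>
  have off: "\<beta> a c i = 0" if "a \<noteq> i" "a < m" "i < m" "c < n" for a c i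
  proof (rule sum_mult_cnj_eq_0[of "{..<n}" "\<lambda>c. \<beta> a c i"])
    show "(\<Sum>c<n. \<beta> a c i * cnj (\<beta> a c i)) = 0"
      using \<beta>A[of i i a a] schur_map_coef(2)[OF Ac, of i i a a] that by simp
  qed (use that in auto)
  define v where "v i = vec n (\<lambda>c. \<beta> i c i)" for i
  have S: "eb_form m n S m (unit_vec m) v"
    unfolding eb_form_iff_coef
  proof (intro conjI allI impI SS)
    fix i j c e assume ij: "i < m" "j < m" and ce: "c < n" "e < n"
    have "coef m S i j c e = (\<Sum>a<m. if a = i then (if i = j then v i $ c * cnj (v i $ e) else 0) else 0)"
      unfolding \<beta>S[OF ij ce] using ij ce by (intro sum.cong refl) (auto simp: off v_def)
    also have "\<dots> = (if i = j then v i $ c * cnj (v i $ e) else 0)" using ij by simp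
    also have "\<dots> = (\<Sum>k<m. cnj (unit_vec m k $ i) * unit_vec m k $ j * (v k $ c * cnj (v k $ e)))"
      by (rule sum_unit_vec[OF ij, symmetric])
    finally show "coef m S i j c e = (\<Sum>k<m. cnj (unit_vec m k $ i) * unit_vec m k $ j * v k $ c * cnj (v k $ e))"
      by (simp only: mult.assoc)
  qed (auto simp: v_def)
  have "eb_form m n F m (\<lambda>k. U *\<^sub>v unit_vec m k) v"
    by (rule eb_form_comp_Ad[OF S Uc F])
  moreover have "orthonormal m (\<lambda>k. U *\<^sub>v unit_vec m k)"
    using U orthonormal_cols_iff_unitary[OF Uc] by (simp add: orthonormal_def mult_unit_vec[OF Uc])
  moreover have "cinner (v j) (v j) = 1" if j: "j < m" for j
  proof -
    have "cinner (v j) (v j) = (\<Sum>c<n. \<beta> j c j * cnj (\<beta> j c j))"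
      by (subst cinner_index[of _ n]) (auto simp: v_def mult.commute)
    also have "\<dots> = 1" using \<beta>A[of j j j j] schur_map_coef(2)[OF Ac, of j j j j] A(2) j by simp
    finally show ?thesis .
  qed
  ultimately show "von_neumann_form m n F" unfolding von_neumann_form_def by blast
qed

section \<open>Degradable unital channels\<close>

lemma unital_iff_coef:
  assumes F: "F \<in> mat_maps m n"
  shows "unital m n F \<longleftrightarrow> (\<forall>a<n. \<forall>b<n. (\<Sum>i<m. coef m F i i a b) = (if a = b then 1 else 0))"
proof -
  have c: "F (1\<^sub>m m) \<in> carrier_mat n n" using F by (simp add: mat_maps_iff)
  have ent: "F (1\<^sub>m m) $$ (a, b) = (\<Sum>i<m. coef m F i i a b)" if ab: "a < n" "b < n" for a b
  proof -
    have "F (1\<^sub>m m) $$ (a, b) = (\<Sum>i<m. \<Sum>j<m. 1\<^sub>m m $$ (i, j) * coef m F i j a b)"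
      by (rule map_entry[OF F _ ab]) simp
    also have "\<dots> = (\<Sum>i<m. \<Sum>j<m. if j = i then coef m F i i a b else 0)"
      by (intro sum.cong refl) auto
    finally show ?thesis by simp
  qed
  show ?thesis
  proof
    assume "unital m n F"
    then show "\<forall>a<n. \<forall>b<n. (\<Sum>i<m. coef m F i i a b) = (if a = b then 1 else 0)"
      by (simp add: unital_def ent[symmetric])
  next
    assume "\<forall>a<n. \<forall>b<n. (\<Sum>i<m. coef m F i i a b) = (if a = b then 1 else 0)"
    then show "unital m n F" unfolding unital_def using c ent by (intro eq_matI) auto
  qed
qed

text \<open>A unital channel of the von Neumann form prepares an orthonormal basis and is therefore complementary to itself, so
  that the identity degrades it.\<close>
lemma von_neumann_form_degradable:
  assumes "von_neumann_form d d F" and unital: "unital d d F"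
  shows "degradable d d F"
proof -
  obtain u v where u: "orthonormal d u" and eb: "eb_form d d F d u v"
    using assms by (auto simp: von_neumann_form_def)
  note F = eb_formD(1)[OF eb] and c = eb_formD(4)[OF eb]
  have uu: "(\<Sum>i<d. u l $ i * cnj (u j $ i)) = (if j = l then 1 else 0)" if "j < d" "l < d" for j l
    using u that by (auto simp: orthonormal_def cinner_index[of _ d] mult.commute)
  have v: "orthonormal d v"
  proof (rule orthonormalI)
    fix a b assume ab: "a < d" "b < d"
    have "(if a = b then 1 else 0) = (\<Sum>i<d. coef d F i i a b)"
      using iffD1[OF unital_iff_coef[OF F] unital] ab by simp
    also have "\<dots> = (\<Sum>i<d. \<Sum>k<d. v k $ a * cnj (v k $ b) * (u k $ i * cnj (u k $ i)))"
      using ab by (simp add: c mult_ac)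
    also have "\<dots> = (\<Sum>k<d. v k $ a * cnj (v k $ b))"
      by (subst sum.swap) (simp add: sum_distrib_left[symmetric] uu)
    finally show "(\<Sum>k<d. v k $ a * cnj (v k $ b)) = (if a = b then 1 else 0)" ..
  qed (rule eb_formD(3)[OF eb])
  have vv: "(\<Sum>e<d. v j $ e * cnj (v l $ e)) = (if l = j then 1 else 0)" if "j < d" "l < d" for j l
    using v that by (auto simp: orthonormal_def cinner_index[of _ d] mult.commute)
  \<comment> \<open>The dilation \<open>u\<^sub>j \<mapsto> v\<^sub>j \<otimes> v\<^sub>j\<close> shows that \<open>F\<close> is complementary to itself.\<close>
  define \<beta> where "\<beta> a e i = (\<Sum>j<d. v j $ a * v j $ e * cnj (u j $ i))" for a e i
  have sym: "\<beta> a e i = \<beta> e a i" for a e i by (simp add: \<beta>_def mult_ac)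
  have \<beta>: "(\<Sum>e<d. \<beta> a e i * cnj (\<beta> b e k)) = coef d F i k a b"
    if ik: "i < d" "k < d" and ab: "a < d" "b < d" for i k a b
  proof -
    let ?t = "\<lambda>j l. v j $ a * cnj (u j $ i) * (cnj (v l $ b) * u l $ k)"
    have "(\<Sum>e<d. \<beta> a e i * cnj (\<beta> b e k)) = (\<Sum>e<d. \<Sum>j<d. \<Sum>l<d. ?t j l * (v j $ e * cnj (v l $ e)))"
      by (simp add: \<beta>_def sum_product mult_ac)
    also have "\<dots> = (\<Sum>j<d. \<Sum>l<d. \<Sum>e<d. ?t j l * (v j $ e * cnj (v l $ e)))"
    proof -
      have "(\<Sum>l<d. \<Sum>e<d. ?t j l * (v j $ e * cnj (v l $ e))) = (\<Sum>e<d. \<Sum>l<d. ?t j l * (v j $ e * cnj (v l $ e)))"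
        for j by (rule sum.swap)
      then show ?thesis by (simp only:) (rule sum.swap)
    qed
    also have "\<dots> = (\<Sum>j<d. \<Sum>l<d. if l = j then ?t j j else 0)"
      unfolding sum_distrib_left[symmetric] by (intro sum.cong refl) (auto simp: vv)
    also have "\<dots> = coef d F i k a b" using ik ab by (simp add: c mult_ac)
    finally show ?thesis .
  qed
  have "complementary d d d F ((\<lambda>X. X) \<circ> F)"
    unfolding complementary_iff_coef comp_def
  proof (intro conjI F exI[of _ \<beta>], unfold dilation_coefs_def, intro allI impI conjI)
    fix i k a b assume "i < d" "k < d" "a < d" "b < d"
    note eq = \<beta>[OF this, symmetric]
    show "coef d F i k a b = (\<Sum>e<d. \<beta> a e i * cnj (\<beta> b e k))" by (rule eq)
    then show "coef d F i k a b = (\<Sum>e<d. \<beta> e a i * cnj (\<beta> e b k))" by (simp only: sym)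
  qed
  moreover have "CP d d (\<lambda>X. X)"
    unfolding CP_iff_choi_kernel
    by (intro conjI psd_kernel_gramI[where I = "{()}" and w = "\<lambda>_ (i, a). if i = a then 1 else 0"])
      (auto simp: mat_maps_iff choi_kernel_def coef_def)
  ultimately show ?thesis unfolding degradable_def by blast
qed

lemma coCP_comp:
  assumes F: "coCP m p F" and G: "CP p q G" and GF: "G \<circ> F \<in> mat_maps m q"
  shows "coCP m q (G \<circ> F)"
  unfolding coCP_def
proof (intro conjI allI impI GF)
  fix k R assume R: "psd (k * m) R"
  have Fm: "F \<in> mat_maps m p" and Gm: "G \<in> mat_maps p q" using F G by (auto simp: coCP_def CP_def)
  let ?T = "tensor_map k k m p transpose_mat F R"
  have "psd (k * p) ?T" using F R by (simp add: coCP_def)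
  then have "psd (k * q) (tensor_map k k p q (\<lambda>X. X) G ?T)" using G by (simp add: CP_def)
  moreover have "tensor_map k k m q transpose_mat (G \<circ> F) R = tensor_map k k p q (\<lambda>X. X) G ?T"
  proof (rule block_eq_matI[OF tensor_map_carrier tensor_map_carrier])
    fix s t a b assume st: "s < k" "t < k" and ab: "a < q" "b < q"
    have "F (mat_block m t s R) \<in> carrier_mat p p" using Fm by (auto simp: mat_maps_iff)
    then have "mat_block p s t ?T = F (mat_block m t s R)"
      using st by (intro eq_matI) (auto simp: tensor_map_entry(2)[OF Fm] mat_block_def)
    then show "tensor_map k k m q transpose_mat (G \<circ> F) R $$ (s * q + a, t * q + b) =
        tensor_map k k p q (\<lambda>X. X) G ?T $$ (s * q + a, t * q + b)"
      by (simp add: tensor_map_entry(2)[OF GF st ab] tensor_map_entry(1)[OF Gm st ab])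
  qed
  ultimately show "psd (k * q) (tensor_map k k m q transpose_mat (G \<circ> F) R)" by simp
qed

text \<open>Read the dilation as a matrix \<open>M\<close> with rows \<open>(i, c)\<close> and columns \<open>a\<close>.  The Choi matrix of \<open>G\<close> is \<open>M M\<^sup>*\<close>,
  and unitality of \<open>F\<close> is the equation \<open>M\<^sup>* M = I\<close>.\<close>
lemma complement_choi_projection:
  assumes comp: "complementary m p q F G" and unital: "unital m p F"
  shows "is_projection (choi m q G)"
proof -
  from comp obtain \<beta> where F: "F \<in> mat_maps m p" and G: "G \<in> mat_maps m q"
    and d: "dilation_coefs m p q F G \<beta>" unfolding complementary_iff_coef by blast
  note cF = dilation_coefsD(1)[OF d] and cG = dilation_coefsD(2)[OF d]
  have psd: "psd_kernel (blocks m q) (choi_kernel m G)"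
    using comp by (simp add: complementary_def CP_iff_choi_kernel)
  have iso: "(\<Sum>j<m. \<Sum>e<q. cnj (\<beta> a e j) * \<beta> b e j) = (if b = a then 1 else 0)" if "a < p" "b < p" for a b
    using iffD1[OF unital_iff_coef[OF F] unital] that by (simp add: cF mult.commute)
  have "(\<Sum>j<m. \<Sum>e<q. coef m G i j c e * coef m G j k e f) = coef m G i k c f"
    if ik: "i < m" "k < m" and cf: "c < q" "f < q" for i k c f
  proof -
    have "(\<Sum>j<m. \<Sum>e<q. coef m G i j c e * coef m G j k e f) = (\<Sum>j<m. \<Sum>e<q. \<Sum>a<p. \<Sum>b<p.
        \<beta> a c i * cnj (\<beta> b f k) * (cnj (\<beta> a e j) * \<beta> b e j))"
      using ik cf by (intro sum.cong refl) (simp add: cG, simp only: sum_product, simp add: mult_ac)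
    also have "\<dots> = (\<Sum>a<p. \<Sum>b<p. \<Sum>j<m. \<Sum>e<q. \<beta> a c i * cnj (\<beta> b f k) * (cnj (\<beta> a e j) * \<beta> b e j))"
      by (rule sum_swap4)
    also have "\<dots> = (\<Sum>a<p. \<Sum>b<p. if b = a then \<beta> a c i * cnj (\<beta> a f k) else 0)"
      unfolding sum_distrib_left[symmetric] by (intro sum.cong refl) (auto simp: iso)
    also have "\<dots> = coef m G i k c f" using ik cf by (simp add: cG)
    finally show ?thesis .
  qed
  then show ?thesis using choi_projection_iff[OF G psd] by blast
qed

text \<open>If the complement \<open>G\<close> measures in the basis \<open>u\<close> and prepares \<open>v\<^sub>s\<close>, then the dilation maps \<open>u\<^sub>s\<close>
  to a product vector \<open>w\<^sub>s \<otimes> v\<^sub>s\<close> with orthonormal \<open>w\<^sub>s\<close>, and \<open>F\<close> maps \<open>|u\<^sub>s><u\<^sub>t|\<close> to \<open><v\<^sub>t, v\<^sub>s> |w\<^sub>s><w\<^sub>t|\<close>.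
  The partial transpose of the Choi matrix can be positive only if \<open><v\<^sub>t, v\<^sub>s> = 0\<close> for \<open>s \<noteq> t\<close>.\<close>
lemma complement_von_neumann_form:
  assumes comp: "complementary m n q F G" and vN: "von_neumann_form m q G"
    and ppt: "psd_kernel (blocks m n) (partial_transpose (choi_kernel m F))"
  shows "von_neumann_form m n F"
proof -
  from comp obtain \<beta> where F: "F \<in> mat_maps m n" and d: "dilation_coefs m n q F G \<beta>"
    unfolding complementary_iff_coef by blast
  note cF = dilation_coefsD(1)[OF d] and cG = dilation_coefsD(2)[OF d]
  obtain u v where u: "orthonormal m u" and v: "\<And>j. j < m \<Longrightarrow> cinner (v j) (v j) = 1"
    and eb: "eb_form m q G m u v"
    using vN by (auto simp: von_neumann_form_def)
  have uu: "(\<Sum>i<m. u s $ i * cnj (u t $ i)) = (if t = s then 1 else 0)" if "s < m" "t < m" for s t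
    using u that by (auto simp: orthonormal_def cinner_index[of _ m] mult.commute)
  have vv: "(\<Sum>c<q. v s $ c * cnj (v s $ c)) = 1" if "s < m" for s
    using v[OF that] eb_formD(3)[OF eb that] by (simp add: cinner_index[of _ q] mult.commute)
  define \<gamma> where "\<gamma> s a c = (\<Sum>i<m. \<beta> a c i * u s $ i)" for s a c
  have \<gamma>\<gamma>: "(\<Sum>a<n. \<gamma> s a c * cnj (\<gamma> t a e)) = (if s = t then v s $ c * cnj (v s $ e) else 0)"
    if st: "s < m" "t < m" and ce: "c < q" "e < q" for s t c e
  proof -
    have "(\<Sum>a<n. \<gamma> s a c * cnj (\<gamma> t a e)) =
        (\<Sum>a<n. \<Sum>i<m. \<Sum>k<m. u s $ i * cnj (u t $ k) * (\<beta> a c i * cnj (\<beta> a e k)))"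
      by (simp add: \<gamma>_def sum_product mult_ac)
    also have "\<dots> = (\<Sum>i<m. \<Sum>k<m. \<Sum>a<n. u s $ i * cnj (u t $ k) * (\<beta> a c i * cnj (\<beta> a e k)))"
      by (simp only: sum.swap[of _ "{..<m}" "{..<n}"])
    also have "\<dots> = (\<Sum>i<m. \<Sum>k<m. u s $ i * cnj (u t $ k) * coef m G i k c e)"
      using ce by (simp add: cG sum_distrib_left)
    also have "\<dots> = (\<Sum>i<m. \<Sum>k<m. \<Sum>j<m. v j $ c * cnj (v j $ e) *
        ((u s $ i * cnj (u j $ i)) * (u j $ k * cnj (u t $ k))))"
      using ce by (simp add: eb_formD(4)[OF eb] sum_distrib_left mult_ac)
    also have "\<dots> = (\<Sum>j<m. \<Sum>i<m. \<Sum>k<m. v j $ c * cnj (v j $ e) *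
        ((u s $ i * cnj (u j $ i)) * (u j $ k * cnj (u t $ k))))"
      by (rule sum_rotate3)
    also have "\<dots> = (\<Sum>j<m. v j $ c * cnj (v j $ e) *
        ((\<Sum>i<m. u s $ i * cnj (u j $ i)) * (\<Sum>k<m. u j $ k * cnj (u t $ k))))"
      unfolding sum_product unfolding sum_distrib_left ..
    also have "\<dots> = (\<Sum>j<m. if j = s then (if s = t then v s $ c * cnj (v s $ e) else 0) else 0)"
      using st by (intro sum.cong refl) (auto simp: uu)
    finally show ?thesis using st by simp
  qed
  define w where "w s a = (\<Sum>c<q. \<gamma> s a c * cnj (v s $ c))" for s a
  have ww: "(\<Sum>a<n. w s a * cnj (w t a)) = (if s = t then 1 else 0)" if st: "s < m" "t < m" for s t
  proof -
    have "(\<Sum>a<n. w s a * cnj (w t a)) =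
        (\<Sum>a<n. \<Sum>c<q. \<Sum>e<q. cnj (v s $ c) * v t $ e * (\<gamma> s a c * cnj (\<gamma> t a e)))"
      unfolding w_def cnj_sum sum_product by (simp add: mult_ac)
    also have "\<dots> = (\<Sum>c<q. \<Sum>e<q. \<Sum>a<n. cnj (v s $ c) * v t $ e * (\<gamma> s a c * cnj (\<gamma> t a e)))"
      by (simp only: sum.swap[of _ "{..<q}" "{..<n}"])
    also have "\<dots> = (\<Sum>c<q. \<Sum>e<q. if s = t then (v s $ c * cnj (v s $ c)) * (v s $ e * cnj (v s $ e)) else 0)"
      unfolding sum_distrib_left[symmetric] using st by (intro sum.cong refl) (auto simp: \<gamma>\<gamma>)
    also have "\<dots> = (if s = t then 1 else 0)"
      using vv[OF st(1)] vv[OF st(2)] by (simp add: sum_product[symmetric])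
    finally show ?thesis .
  qed
  have \<gamma>: "\<gamma> s a c = w s a * v s $ c" if s: "s < m" and a: "a < n" and c: "c < q" for s a c
  proof -
    let ?D = "\<lambda>(a, c). \<gamma> s a c - w s a * v s $ c"
    have row: "(\<Sum>c<q. ?D (a, c) * cnj (?D (a, c))) = (\<Sum>c<q. \<gamma> s a c * cnj (\<gamma> s a c)) - w s a * cnj (w s a)" for a
    proof -
      have "(\<Sum>c<q. ?D (a, c) * cnj (?D (a, c))) = (\<Sum>c<q. \<gamma> s a c * cnj (\<gamma> s a c))
          - (\<Sum>c<q. (\<gamma> s a c * cnj (v s $ c)) * cnj (w s a)) - (\<Sum>c<q. w s a * cnj (\<gamma> s a c * cnj (v s $ c)))
          + (\<Sum>c<q. (w s a * cnj (w s a)) * (v s $ c * cnj (v s $ c)))"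
        by (simp add: algebra_simps sum.distrib sum_subtractf)
      also have "\<dots> = (\<Sum>c<q. \<gamma> s a c * cnj (\<gamma> s a c)) - w s a * cnj (w s a)"
        unfolding sum_distrib_left[symmetric] sum_distrib_right[symmetric] cnj_sum[symmetric] w_def[symmetric]
        using vv[OF s] by simp
      finally show ?thesis .
    qed
    have "(\<Sum>x\<in>{..<n} \<times> {..<q}. ?D x * cnj (?D x)) = (\<Sum>a<n. \<Sum>c<q. ?D (a, c) * cnj (?D (a, c)))"
      by (rule sum.cartesian_product')
    also have "\<dots> = (\<Sum>c<q. \<Sum>a<n. \<gamma> s a c * cnj (\<gamma> s a c)) - (\<Sum>a<n. w s a * cnj (w s a))"
      unfolding row sum_subtractf by (subst sum.swap) (rule refl)
    also have "\<dots> = 0" using s by (simp add: \<gamma>\<gamma> ww vv)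
    finally have "(\<Sum>x\<in>{..<n} \<times> {..<q}. ?D x * cnj (?D x)) = 0" .
    from sum_mult_cnj_eq_0[OF _ this, of "(a, c)"] a c show ?thesis by simp
  qed
  define g where "g s t = (\<Sum>c<q. v s $ c * cnj (v t $ c))" for s t
  have \<beta>: "\<beta> a c i = (\<Sum>s<m. w s a * v s $ c * cnj (u s $ i))" if i: "i < m" and a: "a < n" and c: "c < q" for a c i
  proof -
    have "(\<Sum>s<m. w s a * v s $ c * cnj (u s $ i)) = (\<Sum>s<m. \<Sum>k<m. \<beta> a c k * (u s $ k * cnj (u s $ i)))"
      using a c by (intro sum.cong refl) (simp add: \<gamma>[symmetric] \<gamma>_def sum_distrib_right mult.assoc)
    also have "\<dots> = (\<Sum>k<m. \<beta> a c k * (\<Sum>s<m. u s $ k * cnj (u s $ i)))"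
      by (subst sum.swap) (simp add: sum_distrib_left)
    also have "\<dots> = (\<Sum>k<m. if k = i then \<beta> a c i else 0)"
      using orthonormal_complete[OF u _ i] by (intro sum.cong refl) auto
    finally show ?thesis using i by simp
  qed
  have cF': "coef m F i k a b = (\<Sum>s<m. \<Sum>t<m. g s t * (w s a * cnj (u s $ i) * (cnj (w t b) * u t $ k)))"
    if ik: "i < m" "k < m" and ab: "a < n" "b < n" for i k a b
  proof -
    have "coef m F i k a b = (\<Sum>c<q. \<Sum>s<m. \<Sum>t<m.
        (v s $ c * cnj (v t $ c)) * (w s a * cnj (u s $ i) * (cnj (w t b) * u t $ k)))"
      unfolding cF[OF ik ab] using ik ab by (intro sum.cong refl) (simp add: \<beta> sum_product mult_ac)
    also have "\<dots> = (\<Sum>s<m. \<Sum>t<m. \<Sum>c<q.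
        (v s $ c * cnj (v t $ c)) * (w s a * cnj (u s $ i) * (cnj (w t b) * u t $ k)))"
      by (simp only: sum.swap[of _ "{..<m}" "{..<q}"])
    finally show ?thesis by (simp add: g_def sum_distrib_right)
  qed
  define \<xi> where "\<xi> t s = (\<lambda>(i, a). u t $ i * w s a)" for t s
  let ?S = "blocks m n" and ?K = "partial_transpose (choi_kernel m F)"
  have \<xi>\<xi>: "(\<Sum>x\<in>?S. cnj (\<xi> p r x) * \<xi> t s x) = (if t = p \<and> s = r then 1 else 0)"
    if "p < m" "r < m" "t < m" "s < m" for p r t s
  proof -
    have "(\<Sum>x\<in>?S. cnj (\<xi> p r x) * \<xi> t s x) = (\<Sum>i<m. u t $ i * cnj (u p $ i)) * (\<Sum>a<n. w s a * cnj (w r a))"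
      unfolding sum.cartesian_product' sum_product by (simp add: \<xi>_def mult_ac)
    then show ?thesis using that by (auto simp: uu ww)
  qed
  have form: "sesq ?S ?K x y =
      (\<Sum>s<m. \<Sum>t<m. g s t * ((\<Sum>\<sigma>\<in>?S. cnj (x \<sigma>) * \<xi> t s \<sigma>) * (\<Sum>\<tau>\<in>?S. cnj (\<xi> s t \<tau>) * y \<tau>)))" for x y
  proof -
    have "sesq ?S ?K x y = (\<Sum>\<sigma>\<in>?S. \<Sum>\<tau>\<in>?S. \<Sum>s<m. \<Sum>t<m.
        g s t * ((cnj (x \<sigma>) * \<xi> t s \<sigma>) * (cnj (\<xi> s t \<tau>) * y \<tau>)))"
      unfolding sesq_def
    proof (intro sum.cong refl)
      fix \<sigma> \<tau> assume "\<sigma> \<in> ?S" "\<tau> \<in> ?S"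
      then obtain i a k b where st: "\<sigma> = (i, a)" "\<tau> = (k, b)" and ik: "i < m" "k < m" and ab: "a < n" "b < n"
        by auto
      have "?K \<sigma> \<tau> = (\<Sum>s<m. \<Sum>t<m. g s t * (\<xi> t s \<sigma> * cnj (\<xi> s t \<tau>)))"
        using ik ab by (simp add: st partial_transpose_def choi_kernel_def cF' \<xi>_def mult_ac)
      then show "cnj (x \<sigma>) * ?K \<sigma> \<tau> * y \<tau> =
          (\<Sum>s<m. \<Sum>t<m. g s t * ((cnj (x \<sigma>) * \<xi> t s \<sigma>) * (cnj (\<xi> s t \<tau>) * y \<tau>)))"
        by (simp add: sum_distrib_left sum_distrib_right mult_ac)
    qed
    also have "\<dots> = (\<Sum>s<m. \<Sum>t<m. \<Sum>\<sigma>\<in>?S. \<Sum>\<tau>\<in>?S.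
        g s t * ((cnj (x \<sigma>) * \<xi> t s \<sigma>) * (cnj (\<xi> s t \<tau>) * y \<tau>)))"
      by (rule sum_swap4)
    finally show ?thesis unfolding sum_product unfolding sum_distrib_left .
  qed
  have form\<xi>: "sesq ?S ?K (\<xi> p r) (\<xi> p' r') = (if r = p' \<and> p = r' then g r p else 0)"
    if pr: "p < m" "r < m" "p' < m" "r' < m" for p r p' r'
  proof -
    have "sesq ?S ?K (\<xi> p r) (\<xi> p' r') =
        (\<Sum>s<m. \<Sum>t<m. if t = p then (if s = r then (if r = p' \<and> p = r' then g r p else 0) else 0) else 0)"
      unfolding form using pr by (intro sum.cong refl) (auto simp: \<xi>\<xi>)
    then show ?thesis using pr by simp
  qed
  have goff: "g s t = 0" if st: "s < m" "t < m" "s \<noteq> t" for s t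
    using psd_kernel_sesq(2)[OF ppt, of "\<xi> t s" "\<xi> s t"] st by (simp add: form\<xi>)
  define y where "y s = vec n (w s)" for s
  have eb': "eb_form m n F m u y"
    unfolding eb_form_iff_coef
  proof (intro conjI allI impI F)
    fix i k a b assume ik: "i < m" "k < m" and ab: "a < n" "b < n"
    have "coef m F i k a b = (\<Sum>s<m. \<Sum>t<m. if t = s then cnj (u s $ i) * u s $ k * y s $ a * cnj (y s $ b) else 0)"
      unfolding cF'[OF ik ab] using ab vv
      by (intro sum.cong refl) (auto simp: goff g_def[of s s for s] y_def)
    then show "coef m F i k a b = (\<Sum>s<m. cnj (u s $ i) * u s $ k * y s $ a * cnj (y s $ b))" by simp
  qed (use eb_formD(2)[OF eb] in \<open>auto simp: y_def\<close>)
  have "cinner (y s) (y s) = 1" if s: "s < m" for s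
    using ww[OF s s] by (subst cinner_index[of _ n]) (auto simp: y_def mult.commute)
  then show ?thesis unfolding von_neumann_form_def using u eb' by blast
qed

text \<open>Let \<open>G \<circ> F\<close> be complementary to \<open>F\<close>.  It inherits trace preservation and, since \<open>G\<close> is completely positive,
  also complete copositivity from \<open>F\<close>; its Choi matrix is a projection because \<open>F\<close> is unital.  Hence
  \<open>G \<circ> F\<close> has the von Neumann form, which passes back to \<open>F\<close>.\<close>
theorem degradable_von_neumann_form:
  assumes coCP: "coCP m n F" and unital: "unital m n F" and deg: "degradable m n F"
    and tp: "\<And>i j. i < m \<Longrightarrow> j < m \<Longrightarrow> (\<Sum>a<n. coef m F i j a a) = (if i = j then 1 else 0)"
  shows "von_neumann_form m n F"
proof -
  obtain q G where G: "CP n q G" and comp: "complementary m n q F (G \<circ> F)"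
    using deg by (auto simp: degradable_def)
  have CP: "CP m q (G \<circ> F)" using comp by (simp add: complementary_def)
  then have GF: "G \<circ> F \<in> mat_maps m q" by (simp add: CP_def)
  obtain \<beta> where d: "dilation_coefs m n q F (G \<circ> F) \<beta>"
    using comp unfolding complementary_iff_coef by blast
  have "(\<Sum>c<q. coef m (G \<circ> F) i j c c) = (if i = j then 1 else 0)" if ij: "i < m" "j < m" for i j
  proof -
    have "(\<Sum>c<q. coef m (G \<circ> F) i j c c) = (\<Sum>c<q. \<Sum>a<n. \<beta> a c i * cnj (\<beta> a c j))"
      using ij by (simp add: dilation_coefsD(2)[OF d])
    also have "\<dots> = (\<Sum>a<n. \<Sum>c<q. \<beta> a c i * cnj (\<beta> a c j))" by (rule sum.swap)
    also have "\<dots> = (\<Sum>a<n. coef m F i j a a)"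
      using ij by (simp add: dilation_coefsD(1)[OF d])
    finally show ?thesis using tp[OF ij] by simp
  qed
  then have "von_neumann_form m q (G \<circ> F)"
    using choi_projection_von_neumann_form[OF CP coCP_partial_transpose[OF coCP_comp[OF coCP G GF]]]
      complement_choi_projection[OF comp unital] by blast
  then show ?thesis
    using complement_von_neumann_form[OF comp _ coCP_partial_transpose[OF coCP]] by blast
qed

section \<open>Dual maps and \<open>C\<^sup>*\<close>-extreme points\<close>

text \<open>The dual transposes the tensor: it exchanges the input pair with the output pair.\<close>
lemma dual_map_coef:
  assumes F: "F \<in> mat_maps m n"
  shows "dual_map m F \<in> mat_maps n m"
    and "a < n \<Longrightarrow> b < n \<Longrightarrow> i < m \<Longrightarrow> j < m \<Longrightarrow> coef n (dual_map m F) a b j i = coef m F i j b a"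
proof -
  have car: "dual_map m F X \<in> carrier_mat m m" if "X \<in> carrier_mat n n" for X
    by (rule dual_map(1)[OF F that])
  have ent: "dual_map m F X $$ (j, i) = (\<Sum>a<n. \<Sum>b<n. X $$ (a, b) * coef m F i j b a)"
    if X: "X \<in> carrier_mat n n" and ij: "j < m" "i < m" for X i j
  proof -
    have c: "F (mat_unit m i j) \<in> carrier_mat n n" using F by (auto simp: mat_maps_iff)
    have "dual_map m F X $$ (j, i) = mat_trace (dual_map m F X * mat_unit m i j)"
      using mat_trace_mult_unit[OF car[OF X] ij(2,1)] ..
    also have "\<dots> = mat_trace (X * F (mat_unit m i j))"
      by (rule dual_map(2)[OF F X mat_unit_carrier])
    finally show ?thesis unfolding mat_trace_mult_right[OF X c] coef_def .
  qed
  from mat_mapsI[of n "dual_map m F" m "\<lambda>a b j i. coef m F i j b a", OF car ent]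
  show "dual_map m F \<in> mat_maps n m"
    and "a < n \<Longrightarrow> b < n \<Longrightarrow> i < m \<Longrightarrow> j < m \<Longrightarrow> coef n (dual_map m F) a b j i = coef m F i j b a"
    by blast+
qed

lemma eb_form_dual:
  assumes F: "F \<in> mat_maps m n"
  shows "eb_form n m (dual_map m F) N y x \<longleftrightarrow> eb_form m n F N x y"
  using F dual_map_coef[OF F] unfolding eb_form_iff_coef by (auto simp: mult_ac)

lemma eb_form_apply:
  assumes eb: "eb_form m n F N x y" and X: "X \<in> carrier_mat m m" and z: "z \<in> carrier_vec n"
  shows "i < n \<Longrightarrow> (F X *\<^sub>v z) $ i = (\<Sum>k<N. cinner (x k) (X *\<^sub>v x k) * cinner (y k) z * y k $ i)"
    and "cinner z (F X *\<^sub>v z) = (\<Sum>k<N. cinner (x k) (X *\<^sub>v x k) * of_real ((cmod (cinner (y k) z))\<^sup>2))"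
proof -
  have FX: "F X \<in> carrier_mat n n" using eb_formD(1)[OF eb] X by (auto simp: mat_maps_iff)
  have ent: "F X $$ (i, b) = (\<Sum>k<N. cinner (x k) (X *\<^sub>v x k) * (y k $ i * cnj (y k $ b)))" if "i < n" "b < n" for i b
  proof -
    have "F X $$ (i, b) = (\<Sum>k<N. (cinner (x k) (X *\<^sub>v x k) \<cdot>\<^sub>m ketbra (y k) (y k)) $$ (i, b))"
      using eb X that by (simp add: eb_form_def)
    also have "\<dots> = (\<Sum>k<N. cinner (x k) (X *\<^sub>v x k) * (y k $ i * cnj (y k $ b)))"
    proof (intro sum.cong refl)
      fix k assume "k \<in> {..<N}"
      then have y: "y k \<in> carrier_vec n" using eb_formD(3)[OF eb] by simp
      show "(cinner (x k) (X *\<^sub>v x k) \<cdot>\<^sub>m ketbra (y k) (y k)) $$ (i, b) =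
          cinner (x k) (X *\<^sub>v x k) * (y k $ i * cnj (y k $ b))"
        using ketbra_carrier[OF y y] ketbra_entry[OF y y that] that by simp
    qed
    finally show ?thesis .
  qed
  have app: "(F X *\<^sub>v z) $ i = (\<Sum>k<N. cinner (x k) (X *\<^sub>v x k) * cinner (y k) z * y k $ i)" if i: "i < n" for i
  proof -
    have "(F X *\<^sub>v z) $ i = (\<Sum>b<n. \<Sum>k<N. cinner (x k) (X *\<^sub>v x k) * y k $ i * (cnj (y k $ b) * z $ b))"
      unfolding mat_vec_entry[OF FX z i] using i by (intro sum.cong refl) (simp add: ent sum_distrib_left sum_distrib_right mult_ac)
    also have "\<dots> = (\<Sum>k<N. \<Sum>b<n. cinner (x k) (X *\<^sub>v x k) * y k $ i * (cnj (y k $ b) * z $ b))"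
      by (rule sum.swap)
    also have "\<dots> = (\<Sum>k<N. cinner (x k) (X *\<^sub>v x k) * cinner (y k) z * y k $ i)"
      unfolding sum_distrib_left[symmetric]
      using eb_formD(3)[OF eb] z by (intro sum.cong refl) (simp add: cinner_index[of _ n] mult_ac)
    finally show ?thesis .
  qed
  then show "i < n \<Longrightarrow> (F X *\<^sub>v z) $ i = (\<Sum>k<N. cinner (x k) (X *\<^sub>v x k) * cinner (y k) z * y k $ i)" .
  have "cinner z (F X *\<^sub>v z) = (\<Sum>i<n. cnj (z $ i) * (F X *\<^sub>v z) $ i)"
    by (rule cinner_index[OF z mult_mat_vec_carrier[OF FX z]])
  also have "\<dots> = (\<Sum>i<n. \<Sum>k<N. cinner (x k) (X *\<^sub>v x k) * cinner (y k) z * (cnj (z $ i) * y k $ i))"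
    by (intro sum.cong refl) (simp add: app sum_distrib_left mult_ac del: index_mult_mat_vec)
  also have "\<dots> = (\<Sum>k<N. \<Sum>i<n. cinner (x k) (X *\<^sub>v x k) * cinner (y k) z * (cnj (z $ i) * y k $ i))"
    by (rule sum.swap)
  also have "\<dots> = (\<Sum>k<N. cinner (x k) (X *\<^sub>v x k) * (cinner (y k) z * cinner z (y k)))"
    unfolding sum_distrib_left[symmetric]
    using eb_formD(3)[OF eb] z by (intro sum.cong refl) (simp add: cinner_index[of _ n] mult_ac)
  also have "\<dots> = (\<Sum>k<N. cinner (x k) (X *\<^sub>v x k) * of_real ((cmod (cinner (y k) z))\<^sup>2))"
    using eb_formD(3)[OF eb] z
    by (intro sum.cong refl) (simp add: complex_norm_square cinner_cnj[of _ n] del: of_real_power)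
  finally show "cinner z (F X *\<^sub>v z) = (\<Sum>k<N. cinner (x k) (X *\<^sub>v x k) * of_real ((cmod (cinner (y k) z))\<^sup>2))" .
qed

lemma eb_form_Ad_comp:
  assumes eb: "eb_form m n F N x y" and U: "U \<in> carrier_mat n n"
  shows "eb_form m n (\<lambda>X. Ad U (F X)) N x (\<lambda>k. mat_adjoint U *\<^sub>v y k)"
proof -
  note F = eb_formD(1)[OF eb]
  have FX: "F X \<in> carrier_mat n n" if "X \<in> carrier_mat m m" for X using F that by (auto simp: mat_maps_iff)
  let ?c = "\<lambda>i j a b. \<Sum>p<n. \<Sum>q<n. coef m F i j p q * (cnj (U $$ (p, a)) * U $$ (q, b))"
  have car: "Ad U (F X) \<in> carrier_mat n n" if "X \<in> carrier_mat m m" for X by (rule Ad_carrier[OF U FX[OF that]])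
  have ent: "Ad U (F X) $$ (a, b) = (\<Sum>i<m. \<Sum>j<m. X $$ (i, j) * ?c i j a b)"
    if X: "X \<in> carrier_mat m m" and ab: "a < n" "b < n" for X a b
  proof -
    have "Ad U (F X) $$ (a, b) = (\<Sum>p<n. \<Sum>q<n. \<Sum>i<m. \<Sum>j<m.
        X $$ (i, j) * (coef m F i j p q * (cnj (U $$ (p, a)) * U $$ (q, b))))"
      unfolding Ad_entry[OF U FX[OF X] ab]
      by (intro sum.cong refl) (simp add: map_entry[OF F X] sum_distrib_right mult.assoc)
    also have "\<dots> = (\<Sum>i<m. \<Sum>j<m. \<Sum>p<n. \<Sum>q<n.
        X $$ (i, j) * (coef m F i j p q * (cnj (U $$ (p, a)) * U $$ (q, b))))"
      by (rule sum_swap4)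
    finally show ?thesis by (simp only: sum_distrib_left)
  qed
  show ?thesis
    unfolding eb_form_iff_coef
  proof (intro conjI allI impI)
    show "(\<lambda>X. Ad U (F X)) \<in> mat_maps m n" by (rule mat_mapsI(1)[OF car ent])
    fix i j a b assume ij: "i < m" "j < m" and ab: "a < n" "b < n"
    let ?Uy = "\<lambda>k a. \<Sum>p<n. cnj (U $$ (p, a)) * y k $ p"
    have Uy: "(mat_adjoint U *\<^sub>v y k) $ a = ?Uy k a" if "k < N" "a < n" for k a
      using U that eb_formD(3)[OF eb that(1)] by (subst mat_vec_entry[of _ n n]) auto
    have "coef m (\<lambda>X. Ad U (F X)) i j a b = ?c i j a b"
      by (rule mat_mapsI(2)[OF car ent ij ab])
    also have "\<dots> = (\<Sum>p<n. \<Sum>q<n. \<Sum>k<N. cnj (x k $ i) * x k $ j *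
        ((cnj (U $$ (p, a)) * y k $ p) * cnj (cnj (U $$ (q, b)) * y k $ q)))"
      using ij by (intro sum.cong refl) (simp add: eb_formD(4)[OF eb] sum_distrib_left sum_distrib_right mult_ac)
    also have "\<dots> = (\<Sum>k<N. \<Sum>p<n. \<Sum>q<n. cnj (x k $ i) * x k $ j *
        ((cnj (U $$ (p, a)) * y k $ p) * cnj (cnj (U $$ (q, b)) * y k $ q)))"
      by (rule sum_rotate3)
    also have "\<dots> = (\<Sum>k<N. cnj (x k $ i) * x k $ j * (?Uy k a * cnj (?Uy k b)))"
      unfolding cnj_sum sum_product unfolding sum_distrib_left ..
    also have "\<dots> = (\<Sum>k<N. cnj (x k $ i) * x k $ j * (mat_adjoint U *\<^sub>v y k) $ a * cnj ((mat_adjoint U *\<^sub>v y k) $ b))"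
      using ab by (intro sum.cong refl) (simp add: Uy mult.assoc del: index_mult_mat_vec)
    finally show "coef m (\<lambda>X. Ad U (F X)) i j a b = \<dots>" .
  qed (use eb_formD(2,3)[OF eb] mult_mat_vec_carrier[OF mat_adjoint_carrier[OF U]] in auto)
qed

lemma eb_form_adjoint:
  assumes eb: "eb_form m n F N x y" and ij: "i < m" "j < m"
  shows "mat_adjoint (F (mat_unit m i j)) = F (mat_unit m j i)"
proof -
  have c: "F (mat_unit m i j) \<in> carrier_mat n n" for i j
    using eb_formD(1)[OF eb] by (auto simp: mat_maps_iff)
  have ent: "F (mat_unit m i j) $$ (a, b) = (\<Sum>k<N. cnj (x k $ i) * x k $ j * y k $ a * cnj (y k $ b))"
    if "i < m" "j < m" "a < n" "b < n" for i j a b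
    using eb_formD(4)[OF eb that] by (simp add: coef_def)
  show ?thesis
  proof (rule eq_matI)
    fix a b assume "a < dim_row (F (mat_unit m j i))" "b < dim_col (F (mat_unit m j i))"
    then have ab: "a < n" "b < n" using c[of j i] by auto
    have "mat_adjoint (F (mat_unit m i j)) $$ (a, b) = cnj (F (mat_unit m i j) $$ (b, a))"
      using ab c[of i j] by simp
    then show "mat_adjoint (F (mat_unit m i j)) $$ (a, b) = F (mat_unit m j i) $$ (a, b)"
      unfolding ent[OF ij ab(2,1)] ent[OF ij(2,1) ab] by (simp add: mult_ac)
  qed (use c[of i j] c[of j i] in auto)
qed

text \<open>The entries are recovered from the action on \<open>u\<close> by completeness.\<close>
lemma mat_eq_on_orthonormal:
  assumes A: "A \<in> carrier_mat n d" and B: "B \<in> carrier_mat n d" and u: "orthonormal d u"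
    and eq: "\<And>j. j < d \<Longrightarrow> A *\<^sub>v u j = B *\<^sub>v u j"
  shows "A = B"
proof (rule eq_matI)
  have uc: "u j \<in> carrier_vec d" if "j < d" for j using u that by (simp add: orthonormal_def)
  have ent: "C $$ (i, k) = (\<Sum>j<d. (C *\<^sub>v u j) $ i * cnj (u j $ k))"
    if C: "C \<in> carrier_mat n d" and ik: "i < n" "k < d" for C i k
  proof -
    have "(\<Sum>j<d. (C *\<^sub>v u j) $ i * cnj (u j $ k)) = (\<Sum>j<d. \<Sum>l<d. C $$ (i, l) * (u j $ l * cnj (u j $ k)))"
      using mat_vec_entry[OF C uc ik(1)] by (intro sum.cong refl) (simp add: sum_distrib_right mult.assoc)
    also have "\<dots> = (\<Sum>l<d. C $$ (i, l) * (\<Sum>j<d. u j $ l * cnj (u j $ k)))"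
      by (subst sum.swap) (simp add: sum_distrib_left)
    also have "\<dots> = (\<Sum>l<d. if l = k then C $$ (i, k) else 0)"
      using orthonormal_complete[OF u _ ik(2)] by (intro sum.cong refl) auto
    finally show ?thesis using ik by simp
  qed
  fix i k assume "i < dim_row B" "k < dim_col B"
  then have ik: "i < n" "k < d" using B by auto
  show "A $$ (i, k) = B $$ (i, k)"
    unfolding ent[OF A ik] ent[OF B ik] using eq by simp
qed (use A B in auto)

text \<open>With unit vectors \<open>x\<^sub>k\<close> the image of the identity is \<open>\<Sum> |y\<^sub>k><y\<^sub>k|\<close>.\<close>
lemma eb_form_unital_coef:
  assumes eb: "eb_form m n F N x y" and unit: "\<And>k. k < N \<Longrightarrow> cinner (x k) (x k) = 1"
  shows "unital m n F \<longleftrightarrow> (\<forall>a<n. \<forall>b<n. (\<Sum>k<N. y k $ a * cnj (y k $ b)) = (if a = b then 1 else 0))"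
proof -
  have "(\<Sum>i<m. coef m F i i a b) = (\<Sum>k<N. y k $ a * cnj (y k $ b))" if ab: "a < n" "b < n" for a b
  proof -
    have "(\<Sum>i<m. coef m F i i a b) = (\<Sum>k<N. \<Sum>i<m. y k $ a * cnj (y k $ b) * (cnj (x k $ i) * x k $ i))"
      using ab by (subst sum.swap) (simp add: eb_formD(4)[OF eb] mult_ac)
    also have "\<dots> = (\<Sum>k<N. y k $ a * cnj (y k $ b))"
      unfolding sum_distrib_left[symmetric] using unit eb_formD(2)[OF eb]
      by (intro sum.cong refl) (simp add: cinner_index[of _ m])
    finally show ?thesis .
  qed
  then show ?thesis unfolding unital_iff_coef[OF eb_formD(1)[OF eb]] by simp
qed

text \<open>The part \<open>w\<close> of \<open>a\<close> orthogonal to a unit vector \<open>v\<close>.  Nonnegativity of \<open>\<langle>w, w\<rangle>\<close> is the Cauchy-Schwarz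
  inequality, and \<open>w = 0\<close> its equality case.\<close>
lemma unit_component:
  assumes v: "v \<in> carrier_vec d" "cinner v v = 1" and a: "a \<in> carrier_vec d"
  defines "w \<equiv> a + (- cinner v a) \<cdot>\<^sub>v v"
  shows "w \<in> carrier_vec d" "cinner v w = 0" "cinner a w = cinner w w"
    and "cinner w w = cinner a a - of_real ((cmod (cinner v a))\<^sup>2)"
    and "cinner w w = 0 \<Longrightarrow> a = cinner v a \<cdot>\<^sub>v v"
proof -
  show wc: "w \<in> carrier_vec d" using v a by (simp add: w_def)
  have sv: "(- cinner v a) \<cdot>\<^sub>v v \<in> carrier_vec d" using v by simp
  show vw: "cinner v w = 0"
    unfolding w_def using v a by (simp add: cinner_add_right[OF v(1) a sv] cinner_smult_right[of _ d])
  have wa: "cinner w v = 0" using vw cinner_cnj[OF v(1) wc] by simp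
  have "cinner w w = cinner w a"
    using wa cinner_add_right[OF wc a sv] cinner_smult_right[OF wc v(1)] by (simp add: w_def[symmetric])
  then have ww: "cinner w w = cnj (cinner a w)" using cinner_cnj[OF a wc] by simp
  also have "\<dots> = cinner a w" using ww cinner_cnj[OF wc wc] cinner_cnj[OF a wc] cinner_cnj[OF wc a] by (metis complex_cnj_cnj)
  finally show aw: "cinner a w = cinner w w" ..
  have "cinner a w = cinner a a - cinner v a * cinner a v"
    unfolding w_def using v a by (simp add: cinner_add_right[OF a a sv] cinner_smult_right[of _ d])
  then show "cinner w w = cinner a a - of_real ((cmod (cinner v a))\<^sup>2)"
    using aw cinner_cnj[OF v(1) a] by (simp only: complex_norm_square)
  assume "cinner w w = 0"
  then have w0: "w = 0\<^sub>v d" by (rule cinner_self_eq_0[OF wc])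
  show "a = cinner v a \<cdot>\<^sub>v v"
  proof (rule eq_vecI)
    fix i assume "i < dim_vec (cinner v a \<cdot>\<^sub>v v)"
    then have i: "i < d" using v by simp
    then have "w $ i = 0" using w0 by simp
    then show "a $ i = (cinner v a \<cdot>\<^sub>v v) $ i" using i v a by (simp add: w_def)
  qed (use v a in simp)
qed

lemma unitary_adjoint: "unitary d U \<Longrightarrow> unitary d (mat_adjoint U)"
  by (simp add: unitary_def)

lemma unitary_mult:
  assumes "unitary d U" "unitary d V"
  shows "unitary d (U * V)"
proof -
  have c: "U \<in> carrier_mat d d" "V \<in> carrier_mat d d" "mat_adjoint U \<in> carrier_mat d d" "mat_adjoint V \<in> carrier_mat d d"
    using assms by (auto simp: unitary_def)
  have a: "mat_adjoint (U * V) = mat_adjoint V * mat_adjoint U" by (rule mat_adjoint_mult[OF c(1,2)])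
  have UV: "U * V \<in> carrier_mat d d" and VU: "mat_adjoint V * mat_adjoint U \<in> carrier_mat d d"
    using c by auto
  have "mat_adjoint U * (U * V) = V"
    unfolding assoc_mult_mat[OF c(3,1,2), symmetric] using assms c by (simp add: unitary_def)
  then have 1: "mat_adjoint (U * V) * (U * V) = 1\<^sub>m d"
    unfolding a assoc_mult_mat[OF c(4,3) UV] using assms by (simp add: unitary_def)
  have "V * (mat_adjoint V * mat_adjoint U) = mat_adjoint U"
    unfolding assoc_mult_mat[OF c(2,4,3), symmetric] using assms c by (simp add: unitary_def)
  then have 2: "U * V * mat_adjoint (U * V) = 1\<^sub>m d"
    unfolding a assoc_mult_mat[OF c(1,2) VU] using assms by (simp add: unitary_def)
  show ?thesis using 1 2 c by (simp add: unitary_def)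
qed

text \<open>With \<open>u\<^sub>j\<close> and \<open>h\<^sub>j\<close> as columns of two unitaries, \<open>W\<close> is the first times the adjoint of the second.\<close>
lemma unitary_of_orthonormal:
  assumes u: "orthonormal d u" and h: "orthonormal d h"
  obtains W where "unitary d W" "\<And>j. j < d \<Longrightarrow> W *\<^sub>v h j = u j"
    "\<And>j. j < d \<Longrightarrow> mat_adjoint W *\<^sub>v u j = h j"
proof -
  let ?M = "\<lambda>f. mat d d (\<lambda>(i, j). f j $ i) :: complex mat"
  have M: "?M f \<in> carrier_mat d d" and col: "j < d \<Longrightarrow> col (?M f) j = f j" if "orthonormal d f" for f j
    using that by (auto simp: orthonormal_def intro!: eq_vecI)
  have un: "unitary d (?M f)" if "orthonormal d f" for f
  proof -
    have "orthonormal d (col (?M f))" using that col[OF that] by (simp add: orthonormal_def)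
    then show ?thesis using orthonormal_cols_iff_unitary[OF M[OF that]] by simp
  qed
  have step: "(?M f * mat_adjoint (?M g)) *\<^sub>v g j = f j"
    if f: "orthonormal d f" and g: "orthonormal d g" and j: "j < d" for f g j
  proof -
    have gj: "?M g *\<^sub>v unit_vec d j = g j" and fj: "?M f *\<^sub>v unit_vec d j = f j"
      using mult_unit_vec[OF M[OF g] j] mult_unit_vec[OF M[OF f] j] col[OF g j] col[OF f j] by simp_all
    have Ma: "mat_adjoint (?M g) \<in> carrier_mat d d" by (rule mat_adjoint_carrier[OF M[OF g]])
    have gc: "g j \<in> carrier_vec d" using g j by (simp add: orthonormal_def)
    have "mat_adjoint (?M g) *\<^sub>v g j = (mat_adjoint (?M g) * ?M g) *\<^sub>v unit_vec d j"
      unfolding gj[symmetric] by (rule assoc_mult_mat_vec[OF Ma M[OF g] unit_vec_carrier, symmetric])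
    also have "\<dots> = unit_vec d j" using un[OF g] by (simp add: unitary_def)
    finally show ?thesis
      unfolding assoc_mult_mat_vec[OF M[OF f] Ma gc] using fj by simp
  qed
  show ?thesis
  proof (rule that[of "?M u * mat_adjoint (?M h)"])
    show "unitary d (?M u * mat_adjoint (?M h))"
      by (intro unitary_mult unitary_adjoint un u h)
    show "(?M u * mat_adjoint (?M h)) *\<^sub>v h j = u j" if "j < d" for j by (rule step[OF u h that])
    have "mat_adjoint (?M u * mat_adjoint (?M h)) = ?M h * mat_adjoint (?M u)"
      using mat_adjoint_mult[OF M[OF u] mat_adjoint_carrier[OF M[OF h]]] by simp
    then show "mat_adjoint (?M u * mat_adjoint (?M h)) *\<^sub>v u j = h j" if "j < d" for j
      using step[OF h u that] by simp
  qed
qed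

text \<open>This is the polar decomposition \<open>T = W |T|\<close>: \<open>|T|\<close> commutes with the range of \<open>\<Psi>\<close> because \<open>T\<^sup>* T\<close>
  does, so that \<open>G = T \<Psi> T\<^sup>-\<^sup>1 = W \<Psi> W\<^sup>*\<close>.  Diagonalizing \<open>T\<^sup>* T\<close> jointly with the range of \<open>\<Psi>\<close> gives
  \<open>W\<close> without taking square roots of matrices.\<close>
lemma intertwiner_unitary:
  assumes \<Psi>: "eb_form n m \<Psi> N x y" and G: "eb_form n m G N' x' y'"
    and u: "orthonormal m u"
    and \<Psi>u: "\<And>a b j. a < n \<Longrightarrow> b < n \<Longrightarrow> j < m \<Longrightarrow> \<exists>e. \<Psi> (mat_unit n a b) *\<^sub>v u j = e \<cdot>\<^sub>v u j"
    and T: "T \<in> carrier_mat m m" "invertible_mat T"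
    and GT: "\<And>a b. a < n \<Longrightarrow> b < n \<Longrightarrow> G (mat_unit n a b) * T = T * \<Psi> (mat_unit n a b)"
  obtains U where "unitary m U" "\<And>X. X \<in> carrier_mat n n \<Longrightarrow> G X = Ad U (\<Psi> X)"
proof -
  let ?P = "\<lambda>a b. \<Psi> (mat_unit n a b)" and ?G = "\<lambda>a b. G (mat_unit n a b)"
  have Pc: "?P a b \<in> carrier_mat m m" and Gc: "?G a b \<in> carrier_mat m m" for a b
    using eb_formD(1)[OF \<Psi>] eb_formD(1)[OF G] by (auto simp: mat_maps_iff)
  have Ta: "mat_adjoint T \<in> carrier_mat m m" using T by simp
  define M where "M = mat_adjoint T * T"
  have Mc: "M \<in> carrier_mat m m" unfolding M_def by (rule mult_carrier_mat[OF Ta T(1)])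
  have Ma: "mat_adjoint M = M" unfolding M_def using mat_adjoint_mult[OF Ta T(1)] by simp
  have MP: "M * ?P a b = mat_adjoint T * ?G a b * T" if "a < n" "b < n" for a b
  proof -
    have "M * ?P a b = mat_adjoint T * (T * ?P a b)"
      unfolding M_def by (rule assoc_mult_mat[OF Ta T(1) Pc])
    also have "\<dots> = mat_adjoint T * ?G a b * T"
      unfolding GT[OF that, symmetric] by (rule assoc_mult_mat[OF Ta Gc T(1), symmetric])
    finally show ?thesis .
  qed
  have comm: "M * ?P a b = ?P a b * M" if ab: "a < n" "b < n" for a b
  proof -
    have "?P a b * M = mat_adjoint (M * ?P b a)"
      unfolding mat_adjoint_mult[OF Mc Pc] Ma eb_form_adjoint[OF \<Psi> ab(2,1)] ..
    also have "\<dots> = mat_adjoint (mat_adjoint T * ?G b a * T)" using MP[OF ab(2,1)] by simp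
    also have "\<dots> = mat_adjoint T * (?G a b * T)"
      unfolding mat_adjoint_mult[OF mult_carrier_mat[OF Ta Gc] T(1)] mat_adjoint_mult[OF Ta Gc]
        eb_form_adjoint[OF G ab(2,1)] by simp
    also have "\<dots> = M * ?P a b" unfolding MP[OF ab] by (rule assoc_mult_mat[OF Ta Gc T(1), symmetric])
    finally show ?thesis ..
  qed
  have uc: "u j \<in> carrier_vec m" if "j < m" for j using u that by (simp add: orthonormal_def)
  have PP: "?P a b * ?P c d = ?P c d * ?P a b" if abcd: "a < n" "b < n" "c < n" "d < n" for a b c d
  proof (rule mat_eq_on_orthonormal[OF mult_carrier_mat[OF Pc Pc] mult_carrier_mat[OF Pc Pc] u])
    fix j assume j: "j < m"
    obtain e where e: "?P a b *\<^sub>v u j = e \<cdot>\<^sub>v u j" using \<Psi>u abcd j by blast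
    obtain f where f: "?P c d *\<^sub>v u j = f \<cdot>\<^sub>v u j" using \<Psi>u abcd j by blast
    show "(?P a b * ?P c d) *\<^sub>v u j = (?P c d * ?P a b) *\<^sub>v u j"
      unfolding assoc_mult_mat_vec[OF Pc Pc uc[OF j]] e f mult_mat_vec[OF Pc uc[OF j]]
      by (simp add: smult_smult_assoc mult.commute)
  qed
  let ?\<H> = "insert M ((\<lambda>(a, b). ?P a b) ` blocks n n)"
  obtain h where h: "orthonormal m h" and ev: "\<And>H j. H \<in> ?\<H> \<Longrightarrow> j < m \<Longrightarrow> \<exists>e. H *\<^sub>v h j = e \<cdot>\<^sub>v h j"
  proof (rule joint_eigenbasis[of ?\<H> m])
    show "mat_adjoint H \<in> ?\<H>" if "H \<in> ?\<H>" for H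
      using that Ma eb_form_adjoint[OF \<Psi>] by auto
    show "H * K = K * H" if "H \<in> ?\<H>" "K \<in> ?\<H>" for H K
      using that comm PP by (auto simp: comm[symmetric])
  qed (use Mc Pc in auto)
  have hc: "h j \<in> carrier_vec m" if "j < m" for j using h that by (simp add: orthonormal_def)
  have Thc: "T *\<^sub>v h j \<in> carrier_vec m" if "j < m" for j using T hc[OF that] by simp
  have TT: "cinner (T *\<^sub>v h i) (T *\<^sub>v h j) = cinner (h i) (M *\<^sub>v h j)" if "i < m" "j < m" for i j
    using cinner_adjoint[OF Ta hc[OF that(1)] Thc[OF that(2)]] assoc_mult_mat_vec[OF Ta T(1) hc[OF that(2)]]
    by (simp add: M_def)
  have off: "cinner (T *\<^sub>v h i) (T *\<^sub>v h j) = 0" if ij: "i < m" "j < m" "i \<noteq> j" for i j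
  proof -
    obtain e where "M *\<^sub>v h j = e \<cdot>\<^sub>v h j" using ev[of M j] ij by auto
    then show ?thesis using TT ij h hc by (simp add: cinner_smult_right[of _ m] orthonormal_def)
  qed
  have "\<forall>j\<in>{..<m}. \<exists>s::real. s \<noteq> 0 \<and> cinner (of_real (1 / s) \<cdot>\<^sub>v (T *\<^sub>v h j)) (of_real (1 / s) \<cdot>\<^sub>v (T *\<^sub>v h j)) = 1"
  proof
    fix j assume "j \<in> {..<m}"
    then have j: "j < m" by simp
    have "T *\<^sub>v h j \<noteq> 0\<^sub>v m"
    proof
      assume z: "T *\<^sub>v h j = 0\<^sub>v m"
      obtain R where R: "R * T = 1\<^sub>m (dim_row R)" "T * R = 1\<^sub>m (dim_row T)"
        using T(2) by (auto simp: invertible_mat_def inverts_mat_def)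
      have "dim_col R = m" using R(2) T(1) by (metis index_mult_mat(3) index_one_mat(3) carrier_matD(1))
      moreover have "dim_row R = m" using R(1) T(1) by (metis index_mult_mat(3) index_one_mat(3) carrier_matD(2))
      ultimately have Rc: "R \<in> carrier_mat m m" by auto
      have "h j = (R * T) *\<^sub>v h j" using R(1) Rc hc[OF j] by simp
      also have "\<dots> = R *\<^sub>v 0\<^sub>v m" using assoc_mult_mat_vec[OF Rc T(1) hc[OF j]] z by simp
      also have "\<dots> = 0\<^sub>v m" using Rc by (intro eq_vecI) auto
      finally have "cinner (h j) (h j) = 0" by (simp add: cinner_index[of _ m])
      then show False using h j by (simp add: orthonormal_def)
    qed
    then show "\<exists>s::real. s \<noteq> 0 \<and> cinner (of_real (1 / s) \<cdot>\<^sub>v (T *\<^sub>v h j)) (of_real (1 / s) \<cdot>\<^sub>v (T *\<^sub>v h j)) = 1"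
      using normalizing_scalar[OF Thc[OF j]] by metis
  qed
  then obtain s :: "nat \<Rightarrow> real" where s: "\<And>j. j < m \<Longrightarrow> s j \<noteq> 0"
    "\<And>j. j < m \<Longrightarrow> cinner (of_real (1 / s j) \<cdot>\<^sub>v (T *\<^sub>v h j)) (of_real (1 / s j) \<cdot>\<^sub>v (T *\<^sub>v h j)) = 1"
    unfolding bchoice_iff by auto
  define f where "f j = of_real (1 / s j) \<cdot>\<^sub>v (T *\<^sub>v h j)" for j
  have f: "orthonormal m f"
    using s(2) off Thc
    by (auto simp: orthonormal_def f_def cinner_smult_left[of _ m] cinner_smult_right[of _ m])
  have fc: "f j \<in> carrier_vec m" if "j < m" for j using f that by (simp add: orthonormal_def)
  obtain W where W: "unitary m W" and Wh: "\<And>j. j < m \<Longrightarrow> W *\<^sub>v h j = f j"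
    and Wf: "\<And>j. j < m \<Longrightarrow> mat_adjoint W *\<^sub>v f j = h j"
    by (rule unitary_of_orthonormal[OF f h]) blast
  have Wc: "W \<in> carrier_mat m m" and Wac: "mat_adjoint W \<in> carrier_mat m m" using W by (auto simp: unitary_def)
  have unit_eq: "?G a b = Ad (mat_adjoint W) (?P a b)" if ab: "a < n" "b < n" for a b
  proof (rule mat_eq_on_orthonormal[OF Gc Ad_carrier[OF Wac Pc] f])
    fix j assume j: "j < m"
    have "?P a b \<in> ?\<H>" using ab by (intro insertI2 image_eqI[of _ _ "(a, b)"]) auto
    then obtain e where e: "?P a b *\<^sub>v h j = e \<cdot>\<^sub>v h j" using ev j by blast
    have "?G a b *\<^sub>v (T *\<^sub>v h j) = (?G a b * T) *\<^sub>v h j"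
      by (rule assoc_mult_mat_vec[OF Gc T(1) hc[OF j], symmetric])
    also have "\<dots> = T *\<^sub>v (?P a b *\<^sub>v h j)"
      unfolding GT[OF ab] by (rule assoc_mult_mat_vec[OF T(1) Pc hc[OF j]])
    also have "\<dots> = e \<cdot>\<^sub>v (T *\<^sub>v h j)" unfolding e by (rule mult_mat_vec[OF T(1) hc[OF j]])
    finally have "?G a b *\<^sub>v f j = e \<cdot>\<^sub>v f j"
      by (simp add: f_def mult_mat_vec[OF Gc Thc[OF j]] smult_smult_assoc mult.commute)
    moreover have "Ad (mat_adjoint W) (?P a b) *\<^sub>v f j = e \<cdot>\<^sub>v f j"
    proof -
      have "Ad (mat_adjoint W) (?P a b) *\<^sub>v f j = (W * ?P a b) *\<^sub>v (mat_adjoint W *\<^sub>v f j)"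
        unfolding Ad_def mat_adjoint_adjoint by (rule assoc_mult_mat_vec[OF mult_carrier_mat[OF Wc Pc] Wac fc[OF j]])
      also have "\<dots> = W *\<^sub>v (?P a b *\<^sub>v h j)"
        unfolding Wf[OF j] by (rule assoc_mult_mat_vec[OF Wc Pc hc[OF j]])
      also have "\<dots> = e \<cdot>\<^sub>v f j" unfolding e mult_mat_vec[OF Wc hc[OF j]] Wh[OF j] ..
      finally show ?thesis .
    qed
    ultimately show "?G a b *\<^sub>v f j = Ad (mat_adjoint W) (?P a b) *\<^sub>v f j" by simp
  qed
  show ?thesis
  proof (rule that[OF unitary_adjoint[OF W]])
    fix X :: "complex mat" assume X: "X \<in> carrier_mat n n"
    show "G X = Ad (mat_adjoint W) (\<Psi> X)"
      by (rule mat_maps_eqI[OF eb_formD(1)[OF G] eb_formD(1)[OF eb_form_Ad_comp[OF \<Psi> Wac]] X unit_eq])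
  qed
qed

lemma cinner_mat_sum:
  assumes "\<And>i. i < l \<Longrightarrow> A i \<in> carrier_mat d d" and z: "z \<in> carrier_vec d"
  shows "cinner z (mat_sum d d A {..<l} *\<^sub>v z) = (\<Sum>i<l. cinner z (A i *\<^sub>v z))"
proof -
  have "cinner z (mat_sum d d A {..<l} *\<^sub>v z) = (\<Sum>p<d. \<Sum>q<d. \<Sum>i<l. A i $$ (p, q) * (cnj (z $ p) * z $ q))"
    by (subst quadratic_form_entry[OF _ z]) (simp_all add: carrier_matI sum_distrib_right)
  also have "\<dots> = (\<Sum>i<l. \<Sum>p<d. \<Sum>q<d. A i $$ (p, q) * (cnj (z $ p) * z $ q))"
    by (rule sum_rotate3)
  also have "\<dots> = (\<Sum>i<l. cinner z (A i *\<^sub>v z))"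
    using assms by (intro sum.cong refl) (simp add: quadratic_form_entry[of _ d])
  finally show ?thesis .
qed

text \<open>In \<open>\<Psi> = \<Sum> Ad T\<^sub>i \<circ> G\<^sub>i\<close> every summand is dominated by \<open>\<Psi>\<close>.  At the basis vector \<open>u\<^sub>j\<close> the map \<open>\<Psi>\<close> is the
  pure state of \<open>v\<^sub>j\<close>, so every vector \<open>a\<close> that \<open>G\<^sub>i\<close> measures with a nonzero weight at \<open>T\<^sub>i u\<^sub>j\<close> is parallel
  to \<open>v\<^sub>j\<close>.  Hence \<open>G\<^sub>i\<close> acts on \<open>T\<^sub>i u\<^sub>j\<close> as the scalar \<open><v\<^sub>j, Y v\<^sub>j>\<close>.\<close>
theorem von_neumann_form_Cstar_extreme:
  assumes "von_neumann_form m n F"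
  shows "Cstar_extreme_UEB n m (dual_map m F)"
proof -
  obtain u v where u: "orthonormal m u" and v: "\<And>j. j < m \<Longrightarrow> cinner (v j) (v j) = 1"
    and eb: "eb_form m n F m u v"
    using assms by (auto simp: von_neumann_form_def)
  define \<Psi> where "\<Psi> = dual_map m F"
  have \<Psi>: "eb_form n m \<Psi> m v u" using eb eb_form_dual[OF eb_formD(1)[OF eb]] by (simp add: \<Psi>_def)
  note vc = eb_formD(2)[OF \<Psi>] and uc = eb_formD(3)[OF \<Psi>]
  have unital: "unital n m \<Psi>"
    by (rule iffD2[OF eb_form_unital_coef[OF \<Psi> v]]) (use orthonormal_complete[OF u] in blast)+
  have \<Psi>c: "\<Psi> Y \<in> carrier_mat m m" if "Y \<in> carrier_mat n n" for Y
    using eb_formD(1)[OF \<Psi>] that by (auto simp: mat_maps_iff)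
  have \<Psi>u: "\<Psi> Y *\<^sub>v u j = cinner (v j) (Y *\<^sub>v v j) \<cdot>\<^sub>v u j" if Y: "Y \<in> carrier_mat n n" and j: "j < m" for Y j
  proof (rule eq_vecI)
    fix i assume "i < dim_vec (cinner (v j) (Y *\<^sub>v v j) \<cdot>\<^sub>v u j)"
    then have i: "i < m" using uc[OF j] by simp
    have "(\<Psi> Y *\<^sub>v u j) $ i = (\<Sum>k<m. cinner (v k) (Y *\<^sub>v v k) * cinner (u k) (u j) * u k $ i)"
      by (rule eb_form_apply(1)[OF \<Psi> Y uc[OF j] i])
    also have "\<dots> = (\<Sum>k<m. if k = j then cinner (v j) (Y *\<^sub>v v j) * u j $ i else 0)"
      using u j by (intro sum.cong refl) (auto simp: orthonormal_def)
    finally show "(\<Psi> Y *\<^sub>v u j) $ i = (cinner (v j) (Y *\<^sub>v v j) \<cdot>\<^sub>v u j) $ i" using i j uc[OF j] by simp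
  qed (use \<Psi>c[OF Y] uc[OF j] in simp)
  have main: "\<exists>U. unitary m U \<and> (\<forall>X\<in>carrier_mat n n. G i X = Ad U (\<Psi> X))"
    if TG: "\<forall>i<l. T i \<in> carrier_mat m m \<and> invertible_mat (T i) \<and> G i \<in> UEB n m"
      and sum: "\<forall>X\<in>carrier_mat n n. \<Psi> X = mat_sum m m (\<lambda>i. Ad (T i) (G i X)) {..<l}"
      and i: "i < l" for l :: nat and T G i
  proof -
    have T: "T i \<in> carrier_mat m m" "invertible_mat (T i)" if "i < l" for i using TG that by auto
    have Gi: "EB n m (G i)" "unital n m (G i)" using TG i by (auto simp: UEB_def)
    obtain N a b where G: "eb_form n m (G i) N a b" by (rule EB_eb_form[OF Gi(1)])
    note ac = eb_formD(2)[OF G] and bc = eb_formD(3)[OF G]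
    have Gc: "G i Y \<in> carrier_mat m m" if "i < l" "Y \<in> carrier_mat n n" for i Y
      using TG that by (auto simp: UEB_def EB_def CP_def mat_maps_iff)
    have Tu: "T i *\<^sub>v u j \<in> carrier_vec m" if "i < l" "j < m" for i j
      using T(1)[OF that(1)] uc[OF that(2)] by simp
    \<comment> \<open>\<open>\<Psi>\<close> vanishes on \<open>|w><w|\<close> at \<open>u\<^sub>j\<close> whenever \<open>w\<close> is orthogonal to \<open>v\<^sub>j\<close>, hence so does \<open>G i\<close> at \<open>T i u\<^sub>j\<close>.\<close>
    have vanish: "cinner (a k) w = 0 \<or> cinner (b k) (T i *\<^sub>v u j) = 0"
      if w: "w \<in> carrier_vec n" "cinner (v j) w = 0" and j: "j < m" and k: "k < N" for w j k
    proof -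
      let ?Y = "ketbra w w"
      have Yc: "?Y \<in> carrier_mat n n" by (rule ketbra_carrier[OF w(1) w(1)])
      have Yx: "cinner x (?Y *\<^sub>v x) = of_real ((cmod (cinner x w))\<^sup>2)" if x: "x \<in> carrier_vec n" for x
      proof -
        have "cinner x (?Y *\<^sub>v x) = cinner x w * cinner w x"
          using w x by (simp add: quadratic_form_entry[OF Yc x] ketbra_entry[OF w(1) w(1)] cinner_index[of _ n]
              sum_product mult_ac)
        then show ?thesis using cinner_cnj[OF x w(1)] by (simp only: complex_norm_square)
      qed
      have Y0: "cinner (v j) (?Y *\<^sub>v v j) = 0" using Yx[OF vc[OF j]] w(2) by simp
      have psdY: "psd n ?Y" by (rule psd_ketbra[OF w(1)])
      define q where "q i' = cinner (T i' *\<^sub>v u j) (G i' ?Y *\<^sub>v (T i' *\<^sub>v u j))" for i'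
      have "cinner (u j) (\<Psi> ?Y *\<^sub>v u j) = (\<Sum>i<l. cinner (u j) (Ad (T i) (G i ?Y) *\<^sub>v u j))"
        using sum Yc cinner_mat_sum[OF Ad_carrier[OF T(1) Gc] uc[OF j]] by simp
      also have "\<dots> = (\<Sum>i<l. q i)"
        unfolding q_def using T(1) Gc Yc uc[OF j] by (intro sum.cong refl) (simp add: cinner_Ad[of _ m])
      also have "cinner (u j) (\<Psi> ?Y *\<^sub>v u j) = 0"
        unfolding \<Psi>u[OF Yc j] Y0 using uc[OF j] by (simp add: cinner_smult_right[of _ m])
      finally have q0: "(\<Sum>i<l. q i) = 0" ..
      have qpos: "0 \<le> q i'" if i': "i' < l" for i'
      proof -
        have "EB n m (G i')" using TG i' by (simp add: UEB_def)
        then obtain N' x' y' where G': "eb_form n m (G i') N' x' y'" by (rule EB_eb_form)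
        have "q i' = (\<Sum>k<N'. of_real ((cmod (cinner (x' k) w))\<^sup>2) * of_real ((cmod (cinner (y' k) (T i' *\<^sub>v u j)))\<^sup>2))"
          unfolding q_def eb_form_apply(2)[OF G' Yc Tu[OF i' j]]
          using eb_formD(2)[OF G'] by (intro sum.cong refl) (simp add: Yx)
        also have "\<dots> = of_real (\<Sum>k<N'. (cmod (cinner (x' k) w))\<^sup>2 * (cmod (cinner (y' k) (T i' *\<^sub>v u j)))\<^sup>2)"
          by simp
        finally show ?thesis by (simp add: less_eq_complex_def sum_nonneg)
      qed
      have "(\<Sum>i<l. Re (q i)) = 0" using arg_cong[OF q0, of Re] by simp
      then have "Re (q i) = 0"
        using qpos i by (subst (asm) sum_nonneg_eq_0_iff) (auto simp: less_eq_complex_def)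
      moreover have "q i = of_real (\<Sum>k<N. (cmod (cinner (a k) w))\<^sup>2 * (cmod (cinner (b k) (T i *\<^sub>v u j)))\<^sup>2)"
        unfolding q_def eb_form_apply(2)[OF G Yc Tu[OF i j]] of_real_sum of_real_mult
        using ac by (intro sum.cong refl) (simp add: Yx)
      ultimately have "(\<Sum>k<N. (cmod (cinner (a k) w))\<^sup>2 * (cmod (cinner (b k) (T i *\<^sub>v u j)))\<^sup>2) = 0" by simp
      then show ?thesis using k by (simp add: sum_nonneg_eq_0_iff)
    qed
    have parallel: "cinner (a k) (Y *\<^sub>v a k) = cinner (a k) (a k) * cinner (v j) (Y *\<^sub>v v j)"
      if j: "j < m" and k: "k < N" and ne: "cinner (b k) (T i *\<^sub>v u j) \<noteq> 0" and Y: "Y \<in> carrier_mat n n" for j k Y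
    proof -
      note comp = unit_component[OF vc[OF j] v[OF j] ac[OF k]]
      define c where "c = cinner (v j) (a k)"
      have "a k = c \<cdot>\<^sub>v v j"
        using comp(5) vanish[OF comp(1,2) j k] ne comp(3) by (simp add: c_def)
      moreover have "cinner (c \<cdot>\<^sub>v v j) (Y *\<^sub>v (c \<cdot>\<^sub>v v j)) = cnj c * c * cinner (v j) (Y *\<^sub>v v j)"
        using Y vc[OF j] by (simp add: mult_mat_vec[OF Y] cinner_smult_left[of _ n] cinner_smult_right[of _ n])
      moreover have "cinner (c \<cdot>\<^sub>v v j) (c \<cdot>\<^sub>v v j) = cnj c * c"
        using vc[OF j] v[OF j] by (simp add: cinner_smult_left[of _ n] cinner_smult_right[of _ n])
      ultimately show ?thesis by simp
    qed
    have GTu: "G i Y *\<^sub>v (T i *\<^sub>v u j) = cinner (v j) (Y *\<^sub>v v j) \<cdot>\<^sub>v (T i *\<^sub>v u j)"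
      if Y: "Y \<in> carrier_mat n n" and j: "j < m" for Y j
    proof (rule eq_vecI)
      let ?z = "T i *\<^sub>v u j" and ?\<phi> = "cinner (v j) (Y *\<^sub>v v j)"
      have z: "?z \<in> carrier_vec m" by (rule Tu[OF i j])
      fix p assume "p < dim_vec (?\<phi> \<cdot>\<^sub>v ?z)"
      then have p: "p < m" using T(1)[OF i] by auto
      have "(G i Y *\<^sub>v ?z) $ p = (\<Sum>k<N. cinner (a k) (Y *\<^sub>v a k) * cinner (b k) ?z * b k $ p)"
        by (rule eb_form_apply(1)[OF G Y z p])
      also have "\<dots> = (\<Sum>k<N. ?\<phi> * (cinner (a k) (1\<^sub>m n *\<^sub>v a k) * cinner (b k) ?z * b k $ p))"
      proof (intro sum.cong refl)
        fix k assume "k \<in> {..<N}"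
        then show "cinner (a k) (Y *\<^sub>v a k) * cinner (b k) ?z * b k $ p =
            ?\<phi> * (cinner (a k) (1\<^sub>m n *\<^sub>v a k) * cinner (b k) ?z * b k $ p)"
          using parallel[OF j _ _ Y, of k] ac[of k] by (cases "cinner (b k) ?z = 0") auto
      qed
      also have "\<dots> = ?\<phi> * (G i (1\<^sub>m n) *\<^sub>v ?z) $ p"
        using eb_form_apply(1)[OF G one_carrier_mat z p] by (simp add: sum_distrib_left)
      also have "\<dots> = (?\<phi> \<cdot>\<^sub>v ?z) $ p" using Gi(2) z p carrier_vecD[OF z]
        by (simp add: unital_def del: index_mult_mat_vec dim_mult_mat_vec)
      finally show "(G i Y *\<^sub>v ?z) $ p = (?\<phi> \<cdot>\<^sub>v ?z) $ p" .
    qed (use Gc[OF i Y] T(1)[OF i] in simp)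
    have GT: "G i (mat_unit n p q) * T i = T i * \<Psi> (mat_unit n p q)" for p q
    proof (rule mat_eq_on_orthonormal[OF mult_carrier_mat[OF Gc[OF i mat_unit_carrier] T(1)[OF i]]
          mult_carrier_mat[OF T(1)[OF i] \<Psi>c[OF mat_unit_carrier]] u])
      fix j assume j: "j < m"
      show "(G i (mat_unit n p q) * T i) *\<^sub>v u j = (T i * \<Psi> (mat_unit n p q)) *\<^sub>v u j"
        unfolding assoc_mult_mat_vec[OF Gc[OF i mat_unit_carrier] T(1)[OF i] uc[OF j]]
          assoc_mult_mat_vec[OF T(1)[OF i] \<Psi>c[OF mat_unit_carrier] uc[OF j]]
          GTu[OF mat_unit_carrier j] \<Psi>u[OF mat_unit_carrier j] mult_mat_vec[OF T(1)[OF i] uc[OF j]] ..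
    qed
    obtain U where "unitary m U" "\<And>X. X \<in> carrier_mat n n \<Longrightarrow> G i X = Ad U (\<Psi> X)"
      by (rule intertwiner_unitary[OF \<Psi> G u _ T(1)[OF i] T(2)[OF i] GT])
        (use \<Psi>u[OF mat_unit_carrier] in blast)+
    then show ?thesis by blast
  qed
  show ?thesis
    unfolding Cstar_extreme_UEB_def \<Psi>_def[symmetric]
  proof (intro conjI allI impI)
    show "\<Psi> \<in> UEB n m" using eb_form_EB[OF \<Psi>] unital by (simp add: UEB_def)
    fix l :: nat and T G
    assume *: "(\<forall>i<l. T i \<in> carrier_mat m m \<and> invertible_mat (T i) \<and> G i \<in> UEB n m) \<and>
        mat_sum m m (\<lambda>i. mat_adjoint (T i) * T i) {..<l} = 1\<^sub>m m \<and>
        (\<forall>X\<in>carrier_mat n n. \<Psi> X = mat_sum m m (\<lambda>i. Ad (T i) (G i X)) {..<l})"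
    have "\<forall>i\<in>{..<l}. \<exists>U. unitary m U \<and> (\<forall>X\<in>carrier_mat n n. G i X = Ad U (\<Psi> X))"
      using main[of l T G] * by blast
    then show "\<exists>U. \<forall>i<l. unitary m (U i) \<and> (\<forall>X\<in>carrier_mat n n. G i X = Ad (U i) (\<Psi> X))"
      unfolding bchoice_iff by auto
  qed
qed

section \<open>From \<open>C\<^sup>*\<close>-extreme points to projections\<close>

text \<open>The prepared vectors of a unital map, when the measured ones are unit vectors: \<open>\<Sum> |b\<^sub>k><b\<^sub>k| = I\<close>.\<close>
definition parseval_frame :: "nat \<Rightarrow> nat \<Rightarrow> (nat \<Rightarrow> complex vec) \<Rightarrow> bool" where
  "parseval_frame d N b \<longleftrightarrow> (\<forall>k<N. b k \<in> carrier_vec d) \<and>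
     (\<forall>i<d. \<forall>j<d. (\<Sum>k<N. b k $ i * cnj (b k $ j)) = (if i = j then 1 else 0))"

lemma parseval_expansion:
  assumes b: "parseval_frame d N b" and x: "x \<in> carrier_vec d" and i: "i < d"
  shows "(\<Sum>k<N. cinner (b k) x * b k $ i) = x $ i"
proof -
  have "(\<Sum>k<N. cinner (b k) x * b k $ i) = (\<Sum>k<N. \<Sum>j<d. x $ j * (b k $ i * cnj (b k $ j)))"
    using b x by (intro sum.cong refl) (simp add: parseval_frame_def cinner_index[of _ d] sum_distrib_left mult_ac)
  also have "\<dots> = (\<Sum>j<d. x $ j * (\<Sum>k<N. b k $ i * cnj (b k $ j)))"
    by (subst sum.swap) (simp add: sum_distrib_left)
  also have "\<dots> = (\<Sum>j<d. if j = i then x $ i else 0)"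
    using b i by (intro sum.cong refl) (auto simp: parseval_frame_def)
  finally show ?thesis using i by simp
qed

lemma parseval_norm:
  assumes b: "parseval_frame d N b" and x: "x \<in> carrier_vec d"
  shows "(\<Sum>k<N. (cmod (cinner (b k) x))\<^sup>2) = Re (cinner x x)"
proof -
  have "cinner x x = (\<Sum>i<d. cnj (x $ i) * (\<Sum>k<N. cinner (b k) x * b k $ i))"
    using parseval_expansion[OF b x] x by (simp add: cinner_index[of _ d])
  also have "\<dots> = (\<Sum>k<N. \<Sum>i<d. cinner (b k) x * (cnj (x $ i) * b k $ i))"
    unfolding sum_distrib_left by (subst sum.swap) (simp add: mult_ac)
  also have "\<dots> = (\<Sum>k<N. cinner (b k) x * cinner x (b k))"
    unfolding sum_distrib_left[symmetric] using b x
    by (intro sum.cong refl) (simp add: parseval_frame_def cinner_index[of _ d])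
  also have "\<dots> = of_real (\<Sum>k<N. (cmod (cinner (b k) x))\<^sup>2)"
    unfolding of_real_sum complex_norm_square using b x
    by (intro sum.cong refl) (simp add: parseval_frame_def cinner_cnj[of _ d])
  finally show ?thesis by simp
qed

lemma parseval_trace:
  assumes b: "parseval_frame d N b"
  shows "(\<Sum>k<N. Re (cinner (b k) (b k))) = d"
proof -
  have "(\<Sum>k<N. cinner (b k) (b k)) = (\<Sum>k<N. \<Sum>i<d. b k $ i * cnj (b k $ i))"
    using b by (intro sum.cong refl) (simp add: parseval_frame_def cinner_index[of _ d] mult.commute)
  also have "\<dots> = (\<Sum>i<d. \<Sum>k<N. b k $ i * cnj (b k $ i))" by (rule sum.swap)
  also have "\<dots> = of_nat d" using b by (simp add: parseval_frame_def)
  finally have "Re (\<Sum>k<N. cinner (b k) (b k)) = Re (of_nat d)" by (rule arg_cong)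
  then show ?thesis by simp
qed

text \<open>More than \<open>d\<close> vectors of length \<open>d\<close> satisfy a linear relation, which makes one of them redundant.\<close>
lemma spanning_subset:
  fixes b :: "nat \<Rightarrow> complex vec"
  assumes "finite I"
  shows "\<exists>S\<subseteq>I. card S \<le> d \<and> (\<forall>k\<in>I. \<exists>\<gamma>. \<forall>i<d. b k $ i = (\<Sum>l\<in>S. \<gamma> l * b l $ i))"
  using assms
proof (induction "card I" arbitrary: I rule: less_induct)
  case less
  show ?case
  proof (cases "card I \<le> d")
    case True
    have "\<exists>\<gamma>. \<forall>i<d. b k $ i = (\<Sum>l\<in>I. \<gamma> l * b l $ i)" if k: "k \<in> I" for k
    proof -
      have "(\<Sum>l\<in>I. b l $ i * (if l = k then 1 else 0)) = b k $ i" for i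
        by (rule sum_delta_mult[OF less(2) k])
      then show ?thesis by (intro exI[of _ "\<lambda>l. if l = k then 1 else 0"]) (simp add: mult.commute)
    qed
    then show ?thesis using True by blast
  next
    case False
    obtain h where h: "bij_betw h {..<card I} I"
      using ex_bij_betw_nat_finite[OF less(2)] by (auto simp: lessThan_atLeast0)
    obtain x where x: "x \<in> carrier_vec (card I)" "x \<noteq> 0\<^sub>v (card I)"
      and xz: "\<And>r. r < d \<Longrightarrow> (\<Sum>i<card I. b (h i) $ r * x $ i) = 0"
      using homogeneous_system_nontrivial[of d "card I" "\<lambda>r i. b (h i) $ r"] False by auto
    obtain p where p: "p < card I" "x $ p \<noteq> 0" using x by (metis carrier_vecD eq_vecI index_zero_vec)
    define m where "m = h p"
    have m: "m \<in> I" using h p by (auto simp: m_def bij_betw_def)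
    define y where "y l = x $ (the_inv_into {..<card I} h l)" for l
    have yh: "y (h i) = x $ i" if "i < card I" for i
      using that h by (simp add: y_def the_inv_into_f_f bij_betw_def)
    have ym: "y m \<noteq> 0" using yh[OF p(1)] p by (simp add: m_def)
    have rel: "(\<Sum>l\<in>I. y l * b l $ i) = 0" if "i < d" for i
    proof -
      have "(\<Sum>l\<in>I. y l * b l $ i) = (\<Sum>j<card I. y (h j) * b (h j) $ i)"
        by (rule sum.reindex_bij_betw[OF h, symmetric])
      also have "\<dots> = (\<Sum>j<card I. b (h j) $ i * x $ j)" by (intro sum.cong refl) (simp add: yh)
      finally show ?thesis using xz[OF that] by simp
    qed
    have bm: "b m $ i = (\<Sum>l\<in>I - {m}. (- y l / y m) * b l $ i)" if i: "i < d" for i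
    proof -
      have "y m * b m $ i + (\<Sum>l\<in>I - {m}. y l * b l $ i) = 0"
        using rel[OF i] sum.remove[OF less(2) m, of "\<lambda>l. y l * b l $ i"] by simp
      then have "b m $ i = - (\<Sum>l\<in>I - {m}. y l * b l $ i) / y m"
        using ym by (simp add: eq_neg_iff_add_eq_0 field_simps)
      then show ?thesis by (simp add: sum_divide_distrib sum_negf)
    qed
    have "card (I - {m}) < card I" using m less(2) by (intro psubset_card_mono) auto
    then obtain S where S: "S \<subseteq> I - {m}" "card S \<le> d"
      and sp: "\<forall>k\<in>I - {m}. \<exists>\<gamma>. \<forall>i<d. b k $ i = (\<Sum>l\<in>S. \<gamma> l * b l $ i)"
      using less(1)[of "I - {m}"] less(2) by auto
    from sp obtain \<gamma> where \<gamma>: "\<And>k i. k \<in> I - {m} \<Longrightarrow> i < d \<Longrightarrow> b k $ i = (\<Sum>l\<in>S. \<gamma> k l * b l $ i)"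
      unfolding bchoice_iff by auto
    have "b m $ i = (\<Sum>l\<in>S. (\<Sum>k\<in>I - {m}. (- y k / y m) * \<gamma> k l) * b l $ i)" if i: "i < d" for i
    proof -
      have "b m $ i = (\<Sum>k\<in>I - {m}. \<Sum>l\<in>S. (- y k / y m) * \<gamma> k l * b l $ i)"
        unfolding bm[OF i] by (intro sum.cong refl) (simp only: \<gamma>[OF _ i] sum_distrib_left mult.assoc)
      also have "\<dots> = (\<Sum>l\<in>S. \<Sum>k\<in>I - {m}. (- y k / y m) * \<gamma> k l * b l $ i)" by (rule sum.swap)
      finally show ?thesis by (simp only: sum_distrib_right)
    qed
    then have "\<exists>\<gamma>. \<forall>i<d. b m $ i = (\<Sum>l\<in>S. \<gamma> l * b l $ i)"
      by (intro exI[of _ "\<lambda>l. \<Sum>k\<in>I - {m}. (- y k / y m) * \<gamma> k l"]) simp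
    then have "\<forall>k\<in>I. \<exists>\<gamma>. \<forall>i<d. b k $ i = (\<Sum>l\<in>S. \<gamma> l * b l $ i)" using sp by (metis DiffI singletonD)
    then show ?thesis using S by (intro exI[of _ S] conjI) auto
  qed
qed

text \<open>A root \<open>T\<close> of \<open>M = \<Sum> t\<^sub>k |b\<^sub>k><b\<^sub>k|\<close> with its inverse \<open>S\<close>.  If \<open>h\<^sub>j\<close> are the eigenvectors of \<open>M\<close> and \<open>\<mu>\<^sub>j > 0\<close> its
  eigenvalues, then \<open>T = \<Sum> (sqrt \<mu>\<^sub>j) |e\<^sub>j><h\<^sub>j|\<close>.\<close>
lemma weighted_frame_root:
  assumes b: "parseval_frame d N b" and t: "\<And>k. k < N \<Longrightarrow> 0 < (t k :: real)"
  obtains T S where "T \<in> carrier_mat d d" "S \<in> carrier_mat d d" "T * S = 1\<^sub>m d" "S * T = 1\<^sub>m d"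
    "\<And>i j. i < d \<Longrightarrow> j < d \<Longrightarrow> (mat_adjoint T * T) $$ (i, j) = (\<Sum>k<N. of_real (t k) * (b k $ i * cnj (b k $ j)))"
proof -
  define M where "M = mat d d (\<lambda>(i, j). \<Sum>k<N. of_real (t k) * (b k $ i * cnj (b k $ j)))"
  have M: "M \<in> carrier_mat d d" by (simp add: M_def)
  have Ma: "mat_adjoint M = M" by (intro eq_matI) (auto simp: M_def mult.commute)
  obtain h where h: "orthonormal d h" and "\<And>H j. H \<in> {M} \<Longrightarrow> j < d \<Longrightarrow> \<exists>e. H *\<^sub>v h j = e \<cdot>\<^sub>v h j"
    by (rule joint_eigenbasis[of "{M}" d]) (use M Ma in auto)
  then have "\<forall>j\<in>{..<d}. \<exists>e. M *\<^sub>v h j = e \<cdot>\<^sub>v h j" by auto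
  then obtain \<mu> where \<mu>: "\<And>j. j < d \<Longrightarrow> M *\<^sub>v h j = \<mu> j \<cdot>\<^sub>v h j" unfolding bchoice_iff by auto
  have hc: "h j \<in> carrier_vec d" if "j < d" for j using h that by (simp add: orthonormal_def)
  have bc: "b k \<in> carrier_vec d" if "k < N" for k using b that by (simp add: parseval_frame_def)
  define r where "r j = (\<Sum>k<N. t k * (cmod (cinner (b k) (h j)))\<^sup>2)" for j
  have \<mu>r: "\<mu> j = of_real (r j)" if j: "j < d" for j
  proof -
    have "\<mu> j = cinner (h j) (M *\<^sub>v h j)"
      unfolding \<mu>[OF j] using h hc[OF j] j by (simp add: cinner_smult_right[of _ d] orthonormal_def)
    also have "\<dots> = (\<Sum>p<d. \<Sum>q<d. \<Sum>k<N. of_real (t k) * ((cnj (h j $ p) * b k $ p) * (cnj (b k $ q) * h j $ q)))"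
      unfolding quadratic_form_entry[OF M hc[OF j]]
      by (intro sum.cong refl) (simp add: M_def sum_distrib_left sum_distrib_right mult_ac)
    also have "\<dots> = (\<Sum>k<N. \<Sum>p<d. \<Sum>q<d. of_real (t k) * ((cnj (h j $ p) * b k $ p) * (cnj (b k $ q) * h j $ q)))"
      by (rule sum_rotate3)
    also have "\<dots> = (\<Sum>k<N. of_real (t k) * (cinner (h j) (b k) * cinner (b k) (h j)))"
      using hc[OF j] bc by (intro sum.cong refl) (simp add: cinner_index[of _ d], simp only: sum_product, simp only: sum_distrib_left)
    also have "\<dots> = of_real (r j)"
      unfolding r_def of_real_sum of_real_mult complex_norm_square
      using hc[OF j] bc by (intro sum.cong refl) (simp add: cinner_cnj[of _ d] mult.commute)
    finally show ?thesis .
  qed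
  have rpos: "0 < r j" if j: "j < d" for j
  proof (rule ccontr)
    assume "\<not> 0 < r j"
    moreover have nn: "0 \<le> t k * (cmod (cinner (b k) (h j)))\<^sup>2" if "k < N" for k
      using t[OF that] by simp
    moreover have "0 \<le> r j" unfolding r_def by (rule sum_nonneg) (use nn in auto)
    ultimately have "r j = 0" by simp
    then have "t k * (cmod (cinner (b k) (h j)))\<^sup>2 = 0" if "k < N" for k
      unfolding r_def using that nn by (subst (asm) sum_nonneg_eq_0_iff) auto
    then have "cinner (b k) (h j) = 0" if "k < N" for k using that t[OF that] by fastforce
    then have "Re (cinner (h j) (h j)) = 0" using parseval_norm[OF b hc[OF j]] by simp
    then show False using h j by (simp add: orthonormal_def)
  qed
  define s where "s j = sqrt (r j)" for j
  have s: "s j \<noteq> 0" "of_real (s j) * of_real (s j) = \<mu> j" if "j < d" for j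
    using rpos[OF that] \<mu>r[OF that] by (auto simp: s_def of_real_mult[symmetric])
  define T where "T = mat d d (\<lambda>(j, k). of_real (s j) * cnj (h j $ k))"
  define S where "S = mat d d (\<lambda>(i, j). h j $ i / of_real (s j))"
  have T: "T \<in> carrier_mat d d" and S: "S \<in> carrier_mat d d" by (simp_all add: T_def S_def)
  have TS: "T * S = 1\<^sub>m d"
  proof (rule eq_matI)
    fix i j assume "i < dim_row (1\<^sub>m d :: complex mat)" "j < dim_col (1\<^sub>m d :: complex mat)"
    then have ij: "i < d" "j < d" by auto
    have "(T * S) $$ (i, j) = (\<Sum>k<d. of_real (s i) / of_real (s j) * (cnj (h i $ k) * h j $ k))"
      unfolding mat_mult_entry[OF T S ij] using ij by (intro sum.cong refl) (simp add: T_def S_def)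
    also have "\<dots> = of_real (s i) / of_real (s j) * cinner (h i) (h j)"
      using hc ij by (simp add: cinner_index[of _ d] sum_distrib_left)
    finally show "(T * S) $$ (i, j) = 1\<^sub>m d $$ (i, j)" using h ij s by (simp add: orthonormal_def)
  qed (use T S in auto)
  have ST: "S * T = 1\<^sub>m d" by (rule mat_mult_left_right_inverse[OF T S TS])
  have "(mat_adjoint T * T) $$ (i, j) = (\<Sum>k<N. of_real (t k) * (b k $ i * cnj (b k $ j)))"
    if ij: "i < d" "j < d" for i j
  proof -
    have "(mat_adjoint T * T) $$ (i, j) = (\<Sum>k<d. \<mu> k * h k $ i * cnj (h k $ j))"
      unfolding mat_mult_entry[OF mat_adjoint_carrier[OF T] T ij] using ij T
      by (intro sum.cong refl) (simp add: T_def s(2)[symmetric])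
    also have "\<dots> = M $$ (i, j)" by (rule spectral_entry[OF M h \<mu> ij, symmetric])
    finally show ?thesis using ij by (simp add: M_def)
  qed
  then show ?thesis using that[OF T S TS ST] by blast
qed

text \<open>The left-hand side, \<open>\<Sum> tr (F(E\<^sub>p\<^sub>q) F(E\<^sub>q\<^sub>p))\<close>, is defined without \<open>a\<close> and \<open>b\<close>.  So the sum of overlaps on the
  right is the same for all decompositions of \<open>F\<close>.\<close>
lemma eb_form_overlaps:
  assumes eb: "eb_form n m F N a b"
  shows "(\<Sum>p<n. \<Sum>q<n. \<Sum>i<m. \<Sum>j<m. coef n F p q i j * coef n F q p j i) =
    of_real (\<Sum>k<N. \<Sum>l<N. (cmod (cinner (a k) (a l)))\<^sup>2 * (cmod (cinner (b k) (b l)))\<^sup>2)"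
proof -
  note ac = eb_formD(2)[OF eb] and bc = eb_formD(3)[OF eb]
  let ?A = "\<lambda>k l p q. (cnj (a k $ p) * a l $ p) * (cnj (a l $ q) * a k $ q)"
  let ?B = "\<lambda>k l i j. (cnj (b l $ i) * b k $ i) * (cnj (b k $ j) * b l $ j)"
  have "(\<Sum>p<n. \<Sum>q<n. \<Sum>i<m. \<Sum>j<m. coef n F p q i j * coef n F q p j i) =
      (\<Sum>p<n. \<Sum>q<n. \<Sum>i<m. \<Sum>j<m. \<Sum>k<N. \<Sum>l<N. ?A k l p q * ?B k l i j)"
    by (intro sum.cong refl) (simp add: eb_formD(4)[OF eb], simp only: sum_product, simp add: mult_ac)
  also have "\<dots> = (\<Sum>p<n. \<Sum>q<n. \<Sum>k<N. \<Sum>l<N. \<Sum>i<m. \<Sum>j<m. ?A k l p q * ?B k l i j)"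
    by (rule sum.cong[OF refl], rule sum.cong[OF refl], rule sum_swap4)
  also have "\<dots> = (\<Sum>k<N. \<Sum>l<N. \<Sum>p<n. \<Sum>q<n. \<Sum>i<m. \<Sum>j<m. ?A k l p q * ?B k l i j)"
    by (rule sum_swap4)
  also have "\<dots> = (\<Sum>k<N. \<Sum>l<N. of_real ((cmod (cinner (a k) (a l)))\<^sup>2 * (cmod (cinner (b k) (b l)))\<^sup>2))"
  proof (intro sum.cong refl)
    fix k l assume "k \<in> {..<N}" "l \<in> {..<N}"
    then have kl: "k < N" "l < N" by auto
    have "(\<Sum>p<n. \<Sum>q<n. \<Sum>i<m. \<Sum>j<m. ?A k l p q * ?B k l i j) =
        (\<Sum>p<n. \<Sum>q<n. ?A k l p q) * (\<Sum>i<m. \<Sum>j<m. ?B k l i j)"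
      by (simp only: sum_distrib_right, simp only: sum_distrib_left)
    also have "(\<Sum>p<n. \<Sum>q<n. ?A k l p q) = cinner (a k) (a l) * cinner (a l) (a k)"
      using ac kl by (simp add: cinner_index[of _ n] sum_product)
    also have "(\<Sum>i<m. \<Sum>j<m. ?B k l i j) = cinner (b l) (b k) * cinner (b k) (b l)"
      using bc kl by (simp add: cinner_index[of _ m] sum_product)
    also have "cinner (a k) (a l) * cinner (a l) (a k) * (cinner (b l) (b k) * cinner (b k) (b l)) =
        of_real ((cmod (cinner (a k) (a l)))\<^sup>2 * (cmod (cinner (b k) (b l)))\<^sup>2)"
      unfolding of_real_mult complex_norm_square
      by (simp add: cinner_cnj[OF ac[OF kl(1)] ac[OF kl(2)]] cinner_cnj[OF bc[OF kl(1)] bc[OF kl(2)]])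
    finally show "(\<Sum>p<n. \<Sum>q<n. \<Sum>i<m. \<Sum>j<m. ?A k l p q * ?B k l i j) =
        of_real ((cmod (cinner (a k) (a l)))\<^sup>2 * (cmod (cinner (b k) (b l)))\<^sup>2)" .
  qed
  finally show ?thesis by simp
qed

text \<open>Splitting \<open>\<Psi>\<close> with arbitrary weights \<open>t\<^sub>k\<close> and \<open>1 - t\<^sub>k\<close> exhibits it as a \<open>C\<^sup>*\<close>-convex combination of two
  maps, so each of these is unitarily equivalent to \<open>\<Psi>\<close> and has the same overlaps.  The matrix \<open>Q\<close> is the
  inverse adjoint of the root of \<open>\<Sum> t\<^sub>k |b\<^sub>k><b\<^sub>k|\<close>.\<close>
lemma Cstar_extreme_reweighted:
  assumes eb: "eb_form n m \<Psi> N a b" and unit: "\<And>k. k < N \<Longrightarrow> cinner (a k) (a k) = 1"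
    and ext: "Cstar_extreme_UEB n m \<Psi>"
    and t: "\<And>k. k < N \<Longrightarrow> 0 < (t k :: real) \<and> t k < 1"
  obtains Q where "Q \<in> carrier_mat m m"
    "parseval_frame m N (\<lambda>k. of_real (sqrt (t k)) \<cdot>\<^sub>v (Q *\<^sub>v b k))"
    "(\<Sum>k<N. \<Sum>l<N. (cmod (cinner (a k) (a l)))\<^sup>2 *
       (cmod (cinner (of_real (sqrt (t k)) \<cdot>\<^sub>v (Q *\<^sub>v b k)) (of_real (sqrt (t l)) \<cdot>\<^sub>v (Q *\<^sub>v b l))))\<^sup>2) =
     (\<Sum>k<N. \<Sum>l<N. (cmod (cinner (a k) (a l)))\<^sup>2 * (cmod (cinner (b k) (b l)))\<^sup>2)"
proof -
  note ac = eb_formD(2)[OF eb] and bc = eb_formD(3)[OF eb]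
  have "unital n m \<Psi>" using ext by (simp add: Cstar_extreme_UEB_def UEB_def)
  then have par: "parseval_frame m N b"
    using iffD1[OF eb_form_unital_coef[OF eb unit]] bc by (auto simp: parseval_frame_def)
  \<comment> \<open>\<open>R t\<close> is the part of \<open>\<Psi>\<close> with weights \<open>t\<close>.\<close>
  define R where "R t X = mat_sum m m (\<lambda>k. cinner (a k) (X *\<^sub>v a k) \<cdot>\<^sub>m
      ketbra (of_real (sqrt (t k)) \<cdot>\<^sub>v b k) (of_real (sqrt (t k)) \<cdot>\<^sub>v b k)) {..<N}" for t :: "nat \<Rightarrow> real" and X
  have R: "eb_form n m (R t) N a (\<lambda>k. of_real (sqrt (t k)) \<cdot>\<^sub>v b k)" for t
    unfolding eb_form_def R_def using ac bc by auto
  have Rc: "R t X \<in> carrier_mat m m" for t X by (simp add: R_def carrier_matI)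
  have part: "\<exists>T S. T \<in> carrier_mat m m \<and> S \<in> carrier_mat m m \<and> T * S = 1\<^sub>m m \<and> S * T = 1\<^sub>m m \<and>
      (\<forall>i<m. \<forall>j<m. (mat_adjoint T * T) $$ (i, j) = (\<Sum>k<N. of_real (t k) * (b k $ i * cnj (b k $ j)))) \<and>
      parseval_frame m N (\<lambda>k. mat_adjoint S *\<^sub>v (of_real (sqrt (t k)) \<cdot>\<^sub>v b k)) \<and>
      (\<lambda>X. Ad S (R t X)) \<in> UEB n m \<and> (\<forall>X\<in>carrier_mat n n. Ad T (Ad S (R t X)) = R t X)"
    if t: "\<And>k. k < N \<Longrightarrow> 0 < t k" for t :: "nat \<Rightarrow> real"
  proof -
    obtain T S where T: "T \<in> carrier_mat m m" and S: "S \<in> carrier_mat m m"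
      and TS: "T * S = 1\<^sub>m m" "S * T = 1\<^sub>m m"
      and TT: "\<And>i j. i < m \<Longrightarrow> j < m \<Longrightarrow>
        (mat_adjoint T * T) $$ (i, j) = (\<Sum>k<N. of_real (t k) * (b k $ i * cnj (b k $ j)))"
      by (rule weighted_frame_root[OF par t]) blast+
    have Ta: "mat_adjoint T \<in> carrier_mat m m" and Sa: "mat_adjoint S \<in> carrier_mat m m" using T S by auto
    have TSa: "mat_adjoint S * mat_adjoint T = 1\<^sub>m m" "mat_adjoint T * mat_adjoint S = 1\<^sub>m m"
      unfolding mat_adjoint_mult[OF T S, symmetric] mat_adjoint_mult[OF S T, symmetric] TS
      by (auto intro!: eq_matI)
    note G = eb_form_Ad_comp[OF R[of t] S]
    have R1: "R t (1\<^sub>m n) = mat_adjoint T * T"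
    proof (rule eq_matI)
      fix i j assume "i < dim_row (mat_adjoint T * T)" "j < dim_col (mat_adjoint T * T)"
      then have ij: "i < m" "j < m" using T by auto
      have "R t (1\<^sub>m n) $$ (i, j) = (\<Sum>k<N. (cinner (a k) (1\<^sub>m n *\<^sub>v a k) \<cdot>\<^sub>m
          ketbra (of_real (sqrt (t k)) \<cdot>\<^sub>v b k) (of_real (sqrt (t k)) \<cdot>\<^sub>v b k)) $$ (i, j))"
        using ij by (simp add: R_def)
      also have "\<dots> = (\<Sum>k<N. of_real (t k) * (b k $ i * cnj (b k $ j)))"
      proof (intro sum.cong refl)
        fix k assume "k \<in> {..<N}"
        then have k: "k < N" by simp
        have d: "dim_vec (b k) = m" using bc[OF k] by simp
        have "of_real (sqrt (t k)) * of_real (sqrt (t k)) = (of_real (t k) :: complex)"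
          using t[OF k] by (simp add: of_real_mult[symmetric])
        then show "(cinner (a k) (1\<^sub>m n *\<^sub>v a k) \<cdot>\<^sub>m
          ketbra (of_real (sqrt (t k)) \<cdot>\<^sub>v b k) (of_real (sqrt (t k)) \<cdot>\<^sub>v b k)) $$ (i, j) =
          of_real (t k) * (b k $ i * cnj (b k $ j))"
          using ij ac[OF k] unit[OF k] d by (simp add: ketbra_def mult_ac)
      qed
      finally show "R t (1\<^sub>m n) $$ (i, j) = (mat_adjoint T * T) $$ (i, j)" unfolding TT[OF ij] .
    qed (use Rc[of t "1\<^sub>m n"] T in auto)
    have "Ad S (R t (1\<^sub>m n)) = 1\<^sub>m m"
      unfolding Ad_def R1 assoc_mult_mat[OF Sa Ta T, symmetric] TSa using T TS by simp
    then have un: "unital n m (\<lambda>X. Ad S (R t X))" by (simp add: unital_def)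
    have pf: "parseval_frame m N (\<lambda>k. mat_adjoint S *\<^sub>v (of_real (sqrt (t k)) \<cdot>\<^sub>v b k))"
      using iffD1[OF eb_form_unital_coef[OF G unit] un] eb_formD(3)[OF G] by (auto simp: parseval_frame_def)
    have AT: "Ad T (Ad S (R t X)) = R t X" for X
    proof -
      have RS: "R t X * S \<in> carrier_mat m m" by (rule mult_carrier_mat[OF Rc S])
      have "Ad T (Ad S (R t X)) = R t X * S * T"
        unfolding Ad_def assoc_mult_mat[OF Sa Rc S] assoc_mult_mat[OF Ta Sa RS, symmetric] TSa
          left_mult_one_mat[OF RS] ..
      then show ?thesis unfolding assoc_mult_mat[OF Rc S T] TS using Rc[of t X] by simp
    qed
    show ?thesis
      by (rule exI[of _ T], rule exI[of _ S])
        (use T S TS TT pf un AT eb_form_EB[OF G] in \<open>simp add: UEB_def del: index_mult_mat\<close>)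
  qed
  obtain T0 S0 where T0: "T0 \<in> carrier_mat m m" "S0 \<in> carrier_mat m m" "T0 * S0 = 1\<^sub>m m" "S0 * T0 = 1\<^sub>m m"
    "\<forall>i<m. \<forall>j<m. (mat_adjoint T0 * T0) $$ (i, j) = (\<Sum>k<N. of_real (t k) * (b k $ i * cnj (b k $ j)))"
    "parseval_frame m N (\<lambda>k. mat_adjoint S0 *\<^sub>v (of_real (sqrt (t k)) \<cdot>\<^sub>v b k))"
    "(\<lambda>X. Ad S0 (R t X)) \<in> UEB n m" "\<forall>X\<in>carrier_mat n n. Ad T0 (Ad S0 (R t X)) = R t X"
    using part[of t] t by blast
  let ?t = "\<lambda>k. 1 - t k"
  obtain T1 S1 where T1: "T1 \<in> carrier_mat m m" "S1 \<in> carrier_mat m m" "T1 * S1 = 1\<^sub>m m" "S1 * T1 = 1\<^sub>m m"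
    "\<forall>i<m. \<forall>j<m. (mat_adjoint T1 * T1) $$ (i, j) = (\<Sum>k<N. of_real (1 - t k) * (b k $ i * cnj (b k $ j)))"
    "(\<lambda>X. Ad S1 (R ?t X)) \<in> UEB n m" "\<forall>X\<in>carrier_mat n n. Ad T1 (Ad S1 (R ?t X)) = R ?t X"
    using part[of ?t] t by auto
  define T where "T = (\<lambda>i :: nat. if i = 0 then T0 else T1)"
  define G where "G = (\<lambda>i :: nat. if i = 0 then (\<lambda>X. Ad S0 (R t X)) else (\<lambda>X. Ad S1 (R ?t X)))"
  have lt2: "i < 2 \<longleftrightarrow> i = 0 \<or> i = 1" for i :: nat by auto
  have sum2: "(\<Sum>i<2. f i) = f 0 + f 1" for f :: "nat \<Rightarrow> complex" by (simp add: numeral_2_eq_2)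
  have inv: "invertible_mat T0" "invertible_mat T1"
    using T0(1-4) T1(1-4) unfolding invertible_mat_def inverts_mat_def by auto
  have c1: "\<forall>i<2. T i \<in> carrier_mat m m \<and> invertible_mat (T i) \<and> G i \<in> UEB n m"
    using T0 T1 inv by (auto simp: T_def G_def lt2)
  have c2: "mat_sum m m (\<lambda>i. mat_adjoint (T i) * T i) {..<2} = 1\<^sub>m m"
  proof (rule eq_matI)
    fix i j assume "i < dim_row (1\<^sub>m m :: complex mat)" "j < dim_col (1\<^sub>m m :: complex mat)"
    then have ij: "i < m" "j < m" by auto
    have "mat_sum m m (\<lambda>i. mat_adjoint (T i) * T i) {..<2} $$ (i, j) = (\<Sum>k<N. b k $ i * cnj (b k $ j))"
      using ij T0(5) T1(5) by (simp only: mat_sum_index(1)[OF ij] sum2 T_def)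
        (simp add: sum.distrib[symmetric] algebra_simps)
    then show "mat_sum m m (\<lambda>i. mat_adjoint (T i) * T i) {..<2} $$ (i, j) = 1\<^sub>m m $$ (i, j)"
      using par ij by (simp add: parseval_frame_def)
  qed simp_all
  have c3: "\<Psi> X = mat_sum m m (\<lambda>i. Ad (T i) (G i X)) {..<2}" if X: "X \<in> carrier_mat n n" for X
  proof (rule eq_matI)
    fix i j assume "i < dim_row (mat_sum m m (\<lambda>i. Ad (T i) (G i X)) {..<2})"
      "j < dim_col (mat_sum m m (\<lambda>i. Ad (T i) (G i X)) {..<2})"
    then have ij: "i < m" "j < m" by auto
    have Rent: "R t X $$ (i, j) = (\<Sum>k<N. cinner (a k) (X *\<^sub>v a k) * of_real (t k) * (b k $ i * cnj (b k $ j)))"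
      if t: "\<And>k. k < N \<Longrightarrow> 0 < t k" for t :: "nat \<Rightarrow> real"
      unfolding R_def mat_sum_index(1)[OF ij]
    proof (intro sum.cong refl)
      fix k assume "k \<in> {..<N}"
      then have k: "k < N" by simp
      have d: "dim_vec (b k) = m" using bc[OF k] by simp
      have "of_real (sqrt (t k)) * of_real (sqrt (t k)) = (of_real (t k) :: complex)"
        using t[OF k] by (simp add: of_real_mult[symmetric])
      then show "(cinner (a k) (X *\<^sub>v a k) \<cdot>\<^sub>m
          ketbra (of_real (sqrt (t k)) \<cdot>\<^sub>v b k) (of_real (sqrt (t k)) \<cdot>\<^sub>v b k)) $$ (i, j) =
          cinner (a k) (X *\<^sub>v a k) * of_real (t k) * (b k $ i * cnj (b k $ j))"
        using ij d by (simp add: ketbra_def mult_ac)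
    qed
    have "\<Psi> X $$ (i, j) = (\<Sum>k<N. cinner (a k) (X *\<^sub>v a k) * (b k $ i * cnj (b k $ j)))"
    proof -
      have "\<Psi> X $$ (i, j) = (\<Sum>k<N. (cinner (a k) (X *\<^sub>v a k) \<cdot>\<^sub>m ketbra (b k) (b k)) $$ (i, j))"
        using eb X ij by (simp add: eb_form_def)
      then show ?thesis
        using ij ketbra_carrier[OF bc bc] ketbra_entry[OF bc bc ij] carrier_vecD[OF bc] by (simp add: ketbra_def)
    qed
    also have "\<dots> = R t X $$ (i, j) + R ?t X $$ (i, j)"
      using t by (simp add: Rent sum.distrib[symmetric] algebra_simps)
    also have "\<dots> = mat_sum m m (\<lambda>i. Ad (T i) (G i X)) {..<2} $$ (i, j)"
      using T0(8) T1(7) X by (simp add: mat_sum_index(1)[OF ij] sum2 T_def G_def)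
    finally show "\<Psi> X $$ (i, j) = mat_sum m m (\<lambda>i. Ad (T i) (G i X)) {..<2} $$ (i, j)" .
  qed (use eb_formD(1)[OF eb] X in \<open>auto simp: mat_maps_iff\<close>)
  have "\<exists>U. \<forall>i<2. unitary m (U i) \<and> (\<forall>X\<in>carrier_mat n n. G i X = Ad (U i) (\<Psi> X))"
    using ext[unfolded Cstar_extreme_UEB_def, THEN conjunct2, rule_format, of 2 T G] c1 c2 c3 by blast
  then obtain U where U: "unitary m U" and GU: "\<And>X. X \<in> carrier_mat n n \<Longrightarrow> Ad S0 (R t X) = Ad U (\<Psi> X)"
    by (metis G_def lt2)
  have Uc: "U \<in> carrier_mat m m" using U by (simp add: unitary_def)
  define Q where "Q = mat_adjoint S0"
  have Q: "Q \<in> carrier_mat m m" using T0(2) by (simp add: Q_def)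
  let ?\<beta> = "\<lambda>k. of_real (sqrt (t k)) \<cdot>\<^sub>v (Q *\<^sub>v b k)"
  have \<beta>: "mat_adjoint S0 *\<^sub>v (of_real (sqrt (t k)) \<cdot>\<^sub>v b k) = ?\<beta> k" if "k < N" for k
    unfolding Q_def[symmetric] by (rule mult_mat_vec[OF Q bc[OF that]])
  have pf: "parseval_frame m N ?\<beta>"
    using T0(6) by (simp add: parseval_frame_def \<beta>)
  note e1 = eb_form_overlaps[OF eb_form_Ad_comp[OF R[of t] T0(2)]]
  have "eb_form n m (\<lambda>X. Ad S0 (R t X)) N a (\<lambda>k. mat_adjoint U *\<^sub>v b k)"
    using eb_form_Ad_comp[OF eb Uc] GU by (simp add: eb_form_def)
  note e2 = eb_form_overlaps[OF this]
  have Ub: "cinner (mat_adjoint U *\<^sub>v b k) (mat_adjoint U *\<^sub>v b l) = cinner (b k) (b l)" if kl: "k < N" "l < N" for k l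
  proof -
    have "cinner (mat_adjoint U *\<^sub>v b k) (mat_adjoint U *\<^sub>v b l) = cinner (b k) (U *\<^sub>v (mat_adjoint U *\<^sub>v b l))"
      using cinner_adjoint[OF Uc bc[OF kl(1)] mult_mat_vec_carrier[OF mat_adjoint_carrier[OF Uc] bc[OF kl(2)]]] ..
    also have "U *\<^sub>v (mat_adjoint U *\<^sub>v b l) = (U * mat_adjoint U) *\<^sub>v b l"
      by (rule assoc_mult_mat_vec[OF Uc mat_adjoint_carrier[OF Uc] bc[OF kl(2)], symmetric])
    also have "\<dots> = b l" using U bc[OF kl(2)] by (simp add: unitary_def)
    finally show ?thesis .
  qed
  have "(\<Sum>k<N. \<Sum>l<N. (cmod (cinner (a k) (a l)))\<^sup>2 * (cmod (cinner (?\<beta> k) (?\<beta> l)))\<^sup>2) =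
      (\<Sum>k<N. \<Sum>l<N. (cmod (cinner (a k) (a l)))\<^sup>2 * (cmod (cinner (b k) (b l)))\<^sup>2)"
    using trans[OF e1[symmetric] e2, unfolded of_real_eq_iff] by (simp add: \<beta> Ub)
  then show ?thesis using that[OF Q pf] by blast
qed

text \<open>Put weight \<open>1/2\<close> on at most \<open>m\<close> spanning vectors and weight \<open>\<epsilon>\<close> on the others.  As \<open>\<epsilon>\<close> tends to zero
  the reweighted frame approaches an orthonormal basis, whose overlaps with themselves already add up to \<open>m\<close>.\<close>
lemma Cstar_extreme_overlaps:
  assumes eb: "eb_form n m \<Psi> N a b" and unit: "\<And>k. k < N \<Longrightarrow> cinner (a k) (a k) = 1"
    and ext: "Cstar_extreme_UEB n m \<Psi>" and bc: "\<And>k. k < N \<Longrightarrow> b k \<in> carrier_vec m"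
  shows "real m \<le> (\<Sum>k<N. \<Sum>l<N. (cmod (cinner (a k) (a l)))\<^sup>2 * (cmod (cinner (b k) (b l)))\<^sup>2)" (is "_ \<le> ?g")
proof -
  obtain S where S: "S \<subseteq> {..<N}" "card S \<le> m"
    and sp: "\<forall>k\<in>{..<N}. \<exists>\<gamma>. \<forall>i<m. b k $ i = (\<Sum>l\<in>S. \<gamma> l * b l $ i)"
    using spanning_subset[of "{..<N}" m b] by auto
  have finS: "finite S" using S finite_subset by blast
  from sp obtain \<gamma> where \<gamma>: "\<And>k i. k < N \<Longrightarrow> i < m \<Longrightarrow> b k $ i = (\<Sum>l\<in>S. \<gamma> k l * b l $ i)"
    unfolding bchoice_iff by auto
  \<comment> \<open>\<open>\<epsilon> C\<^sub>k\<close> will bound the squared length of the reweighted \<open>b\<^sub>k\<close> for \<open>k \<notin> S\<close>: the vectors \<open>Q b\<^sub>l\<close> with \<open>l \<in> S\<close> have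
    entries of modulus at most \<open>2\<close>, and \<open>Q b\<^sub>k\<close> is a combination of them.\<close>
  define C where "C k = real m * (2 * (\<Sum>l\<in>S. cmod (\<gamma> k l)))\<^sup>2" for k
  define D where "D = (\<Sum>k<N. C k)"
  have Cpos: "0 \<le> C k" for k by (simp add: C_def)
  have D: "0 \<le> D" unfolding D_def by (rule sum_nonneg) (simp add: Cpos)
  have bound: "real m - 2 * (\<epsilon> * D) \<le> ?g" if \<epsilon>: "0 < \<epsilon>" "\<epsilon> < 1" for \<epsilon>
  proof -
    define t where "t k = (if k \<in> S then 1 / 2 else \<epsilon>)" for k
    have t: "0 < t k \<and> t k < 1" for k using \<epsilon> by (simp add: t_def)
    obtain Q where Q: "Q \<in> carrier_mat m m"
      and pf: "parseval_frame m N (\<lambda>k. of_real (sqrt (t k)) \<cdot>\<^sub>v (Q *\<^sub>v b k))"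
      and ov: "(\<Sum>k<N. \<Sum>l<N. (cmod (cinner (a k) (a l)))\<^sup>2 *
       (cmod (cinner (of_real (sqrt (t k)) \<cdot>\<^sub>v (Q *\<^sub>v b k)) (of_real (sqrt (t l)) \<cdot>\<^sub>v (Q *\<^sub>v b l))))\<^sup>2) = ?g"
      by (rule Cstar_extreme_reweighted[OF eb unit ext, of t]) (use t in blast)+
    define \<beta> where "\<beta> k = of_real (sqrt (t k)) \<cdot>\<^sub>v (Q *\<^sub>v b k)" for k
    have pf: "parseval_frame m N \<beta>" using pf by (simp add: \<beta>_def[abs_def])
    have Qb: "Q *\<^sub>v b k \<in> carrier_vec m" if "k < N" for k using Q bc[OF that] by simp
    have \<beta>c: "\<beta> k \<in> carrier_vec m" if "k < N" for k using Qb[OF that] by (simp add: \<beta>_def)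
    define p where "p k = Re (cinner (\<beta> k) (\<beta> k))" for k
    have \<beta>p: "cinner (\<beta> k) (\<beta> k) = of_real (p k)" and p0: "0 \<le> p k" if "k < N" for k
      unfolding p_def cinner_self[OF \<beta>c[OF that]] by (simp_all add: sum_nonneg)
    have psum: "(\<Sum>k<N. p k) = m" unfolding p_def by (rule parseval_trace[OF pf])
    have p1: "p k \<le> 1" if k: "k < N" for k
    proof -
      have "(cmod (cinner (\<beta> k) (\<beta> k)))\<^sup>2 \<le> (\<Sum>l<N. (cmod (cinner (\<beta> l) (\<beta> k)))\<^sup>2)"
        by (rule member_le_sum[of k "{..<N}" "\<lambda>l. (cmod (cinner (\<beta> l) (\<beta> k)))\<^sup>2"]) (use k in auto)
      also have "\<dots> = p k" unfolding p_def by (rule parseval_norm[OF pf \<beta>c[OF k]])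
      finally have "p k * p k \<le> p k * 1" using p0[OF k] by (simp add: \<beta>p[OF k] power2_eq_square)
      then show ?thesis using p0[OF k] by (cases "p k = 0") (auto simp: mult_le_cancel_left)
    qed
    have pQ: "p k = t k * (\<Sum>i<m. (cmod ((Q *\<^sub>v b k) $ i))\<^sup>2)" if k: "k < N" for k
    proof -
      have "dim_vec (Q *\<^sub>v b k) = m" using Qb[OF k] by (rule carrier_vecD)
      then have "p k = (\<Sum>i<m. (sqrt (t k) * cmod ((Q *\<^sub>v b k) $ i))\<^sup>2)"
        unfolding p_def cinner_self[OF \<beta>c[OF k]] using t[of k]
        by (simp add: \<beta>_def norm_mult del: index_mult_mat_vec dim_mult_mat_vec)
      then show ?thesis using t[of k] by (simp add: power_mult_distrib sum_distrib_left)
    qed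
    have small: "cmod ((Q *\<^sub>v b l) $ i) \<le> 2" if l: "l \<in> S" and i: "i < m" for l i
    proof -
      have lN: "l < N" using l S by auto
      have "(cmod ((Q *\<^sub>v b l) $ i))\<^sup>2 \<le> (\<Sum>i<m. (cmod ((Q *\<^sub>v b l) $ i))\<^sup>2)"
        by (rule member_le_sum[of i "{..<m}" "\<lambda>i. (cmod ((Q *\<^sub>v b l) $ i))\<^sup>2"]) (use i in auto)
      also have "\<dots> \<le> 2\<^sup>2" using pQ[OF lN] p1[OF lN] l by (simp add: t_def)
      finally show ?thesis by (rule power2_le_imp_le) simp
    qed
    have pC: "p k \<le> \<epsilon> * C k" if k: "k < N" "k \<notin> S" for k
    proof -
      have "(cmod ((Q *\<^sub>v b k) $ i))\<^sup>2 \<le> (2 * (\<Sum>l\<in>S. cmod (\<gamma> k l)))\<^sup>2" if i: "i < m" for i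
      proof (rule power_mono)
        have "(Q *\<^sub>v b k) $ i = (\<Sum>j<m. \<Sum>l\<in>S. Q $$ (i, j) * (\<gamma> k l * b l $ j))"
          unfolding mat_vec_entry[OF Q bc[OF k(1)] i]
          by (intro sum.cong refl) (simp only: \<gamma>[OF k(1)] lessThan_iff sum_distrib_left)
        also have "\<dots> = (\<Sum>l\<in>S. \<gamma> k l * (\<Sum>j<m. Q $$ (i, j) * b l $ j))"
          unfolding sum_distrib_left by (subst sum.swap) (simp add: mult_ac)
        also have "\<dots> = (\<Sum>l\<in>S. \<gamma> k l * (Q *\<^sub>v b l) $ i)"
          using mat_vec_entry[OF Q bc i] S by (intro sum.cong refl) auto
        finally have "cmod ((Q *\<^sub>v b k) $ i) \<le> (\<Sum>l\<in>S. cmod (\<gamma> k l * (Q *\<^sub>v b l) $ i))"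
          by (simp only: norm_sum)
        also have "\<dots> \<le> (\<Sum>l\<in>S. cmod (\<gamma> k l) * 2)"
          using small[OF _ i] by (intro sum_mono) (simp add: norm_mult mult_left_mono del: index_mult_mat_vec)
        finally show "cmod ((Q *\<^sub>v b k) $ i) \<le> 2 * (\<Sum>l\<in>S. cmod (\<gamma> k l))"
          by (simp add: sum_distrib_left mult.commute)
      qed simp
      then have "(\<Sum>i<m. (cmod ((Q *\<^sub>v b k) $ i))\<^sup>2) \<le> (\<Sum>i<m. (2 * (\<Sum>l\<in>S. cmod (\<gamma> k l)))\<^sup>2)"
        by (intro sum_mono) simp
      then show ?thesis
        unfolding pQ[OF k(1)] using \<epsilon> k(2) by (simp add: t_def C_def mult_left_mono)
    qed
    let ?r = "\<lambda>k l. (cmod (cinner (a k) (a l)))\<^sup>2" and ?x = "\<lambda>k l. (cmod (cinner (\<beta> k) (\<beta> l)))\<^sup>2"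
    have "real m - 2 * (\<epsilon> * D) \<le> 2 * (real m - (\<Sum>k\<in>{..<N} - S. p k)) - real (card S)"
    proof -
      have "(\<Sum>k\<in>{..<N} - S. p k) \<le> (\<Sum>k\<in>{..<N} - S. \<epsilon> * C k)"
        by (rule sum_mono) (use pC in auto)
      also have "\<dots> \<le> (\<Sum>k<N. \<epsilon> * C k)"
        by (rule sum_mono2) (use \<epsilon> Cpos in auto)
      finally have "(\<Sum>k\<in>{..<N} - S. p k) \<le> \<epsilon> * D" by (simp add: D_def sum_distrib_left)
      moreover have "real (card S) \<le> real m" using S(2) by simp
      moreover have "M - 2 * e \<le> 2 * (M - X) - c" if "X \<le> e" "c \<le> M" for M e X c :: real
        using that by simp
      ultimately show ?thesis by blast
    qed
    also have "real m - (\<Sum>k\<in>{..<N} - S. p k) = (\<Sum>k\<in>S. p k)"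
      using sum.subset_diff[OF S(1), of p] psum by simp
    also have "2 * (\<Sum>k\<in>S. p k) - real (card S) = (\<Sum>k\<in>S. 2 * p k - 1)"
      by (simp add: sum_subtractf sum_distrib_left)
    also have "\<dots> \<le> (\<Sum>k\<in>S. (p k)\<^sup>2)"
    proof (rule sum_mono)
      fix k
      show "2 * p k - 1 \<le> (p k)\<^sup>2" using zero_le_power2[of "p k - 1"] by (simp add: power2_diff)
    qed
    also have "\<dots> = (\<Sum>k\<in>S. ?r k k * ?x k k)"
      using S(1) by (intro sum.cong refl) (auto simp: unit \<beta>p)
    also have "\<dots> \<le> (\<Sum>k<N. ?r k k * ?x k k)"
      by (rule sum_mono2) (use S(1) in auto)
    also have "\<dots> \<le> (\<Sum>k<N. \<Sum>l<N. ?r k l * ?x k l)"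
    proof (rule sum_mono)
      fix k assume "k \<in> {..<N}"
      then show "?r k k * ?x k k \<le> (\<Sum>l<N. ?r k l * ?x k l)"
        by (intro member_le_sum[of k "{..<N}" "\<lambda>l. ?r k l * ?x k l"]) auto
    qed
    finally show ?thesis using ov by (simp add: \<beta>_def)
  qed
  show ?thesis
  proof (rule ccontr)
    assume "\<not> real m \<le> ?g"
    define \<delta> where "\<delta> = real m - ?g"
    have \<delta>: "0 < \<delta>" using \<open>\<not> real m \<le> ?g\<close> by (simp add: \<delta>_def)
    define \<epsilon> where "\<epsilon> = \<delta> / (4 * (D + \<delta>))"
    have "0 < \<epsilon>" "\<epsilon> < 1" using \<delta> D by (auto simp: \<epsilon>_def field_simps)
    from bound[OF this] have "\<delta> \<le> 2 * (\<epsilon> * D)" by (simp add: \<delta>_def)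
    also have "2 * (\<epsilon> * D) \<le> 2 * (\<epsilon> * (D + \<delta>))"
      using \<delta> \<open>0 < \<epsilon>\<close> by simp
    also have "\<dots> = \<delta> / 2"
    proof -
      have "D + \<delta> \<noteq> 0" using \<delta> D by simp
      moreover have "2 * (\<delta> / (4 * s) * s) = \<delta> / 2" if "s \<noteq> 0" for s using that by simp
      ultimately show ?thesis unfolding \<epsilon>_def by blast
    qed
    finally show False using \<delta> by simp
  qed
qed

text \<open>The overlaps \<open>|\<langle>a\<^sub>k, a\<^sub>l\<rangle>|\<^sup>2 |\<langle>b\<^sub>k, b\<^sub>l\<rangle>|\<^sup>2\<close> add up to \<open>m = \<Sum> |\<langle>b\<^sub>k, b\<^sub>l\<rangle>|\<^sup>2\<close>, so \<open>a\<^sub>k\<close> and \<open>a\<^sub>l\<close> are parallel unless \<open>b\<^sub>k\<close> and \<open>b\<^sub>l\<close> are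
  orthogonal.  Then squaring the Choi matrix reproduces it.\<close>
theorem Cstar_extreme_choi_projection:
  assumes F: "F \<in> mat_maps m n" and ext: "Cstar_extreme_UEB n m (dual_map m F)"
  shows "is_projection (choi m n F)"
proof -
  have EB: "EB n m (dual_map m F)" and un: "unital n m (dual_map m F)"
    using ext by (simp_all add: Cstar_extreme_UEB_def UEB_def)
  obtain N0 x0 y0 where e0: "eb_form n m (dual_map m F) N0 x0 y0" by (rule EB_eb_form[OF EB])
  obtain N x y where e1: "eb_form n m (dual_map m F) N x y" and nz: "\<And>k. k < N \<Longrightarrow> x k \<noteq> 0\<^sub>v n \<and> y k \<noteq> 0\<^sub>v m"
    by (rule eb_form_nonzero[OF e0]) blast
  have "eb_form m n F N y x" using e1 eb_form_dual[OF F] by simp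
  then obtain b a where eb: "eb_form m n F N b a" and unit: "\<And>k. k < N \<Longrightarrow> cinner (a k) (a k) = 1"
    by (rule eb_form_unit_right) (use nz in blast)+
  have eb': "eb_form n m (dual_map m F) N a b" using eb eb_form_dual[OF F] by simp
  note bc = eb_formD(2)[OF eb] and ac = eb_formD(3)[OF eb] and c = eb_formD(4)[OF eb]
  have par: "parseval_frame m N b"
    using iffD1[OF eb_form_unital_coef[OF eb' unit] un] bc by (auto simp: parseval_frame_def)
  let ?r = "\<lambda>k l. (cmod (cinner (a k) (a l)))\<^sup>2" and ?y = "\<lambda>k l. (cmod (cinner (b k) (b l)))\<^sup>2"
  have comp: "Re (cinner (a l + (- cinner (a k) (a l)) \<cdot>\<^sub>v a k) (a l + (- cinner (a k) (a l)) \<cdot>\<^sub>v a k)) = 1 - ?r k l"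
    if "k < N" "l < N" for k l
    using unit_component(4)[OF ac[OF that(1)] unit[OF that(1)] ac[OF that(2)]] unit[OF that(2)] by simp
  have r1: "?r k l \<le> 1" if "k < N" "l < N" for k l
  proof -
    have "0 \<le> Re (cinner (a l + (- cinner (a k) (a l)) \<cdot>\<^sub>v a k) (a l + (- cinner (a k) (a l)) \<cdot>\<^sub>v a k))"
      unfolding cinner_self[OF unit_component(1)[OF ac[OF that(1)] unit[OF that(1)] ac[OF that(2)]]]
      by (simp add: sum_nonneg)
    then show ?thesis using comp[OF that] by simp
  qed
  have "(\<Sum>k<N. \<Sum>l<N. (1 - ?r k l) * ?y k l) = (\<Sum>k<N. \<Sum>l<N. ?y k l) - (\<Sum>k<N. \<Sum>l<N. ?r k l * ?y k l)"
    by (simp add: left_diff_distrib sum_subtractf)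
  also have "(\<Sum>k<N. \<Sum>l<N. ?y k l) = (\<Sum>l<N. \<Sum>k<N. ?y k l)" by (rule sum.swap)
  also have "\<dots> = real m"
    using parseval_norm[OF par bc] parseval_trace[OF par] by simp
  finally have le: "(\<Sum>k<N. \<Sum>l<N. (1 - ?r k l) * ?y k l) \<le> 0"
    using Cstar_extreme_overlaps[OF eb' unit ext bc] by simp
  have nn: "0 \<le> (1 - ?r k l) * ?y k l" if "k < N" "l < N" for k l using r1[OF that] by simp
  have parallel: "a l = cinner (a k) (a l) \<cdot>\<^sub>v a k \<and> ?r k l = 1"
    if kl: "k < N" "l < N" and ne: "cinner (b k) (b l) \<noteq> 0" for k l
  proof -
    have "0 \<le> (\<Sum>k<N. \<Sum>l<N. (1 - ?r k l) * ?y k l)" by (intro sum_nonneg) (use nn in auto)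
    then have "(\<Sum>k<N. \<Sum>l<N. (1 - ?r k l) * ?y k l) = 0" using le by simp
    then have "(\<Sum>l<N. (1 - ?r k l) * ?y k l) = 0"
      using kl nn by (subst (asm) sum_nonneg_eq_0_iff) (auto intro!: sum_nonneg)
    then have "(1 - ?r k l) * ?y k l = 0"
      using kl nn by (subst (asm) sum_nonneg_eq_0_iff) auto
    then have r: "?r k l = 1" using ne by simp
    note uc = unit_component[OF ac[OF kl(1)] unit[OF kl(1)] ac[OF kl(2)]]
    have "cinner (a l + (- cinner (a k) (a l)) \<cdot>\<^sub>v a k) (a l + (- cinner (a k) (a l)) \<cdot>\<^sub>v a k) = 0"
      unfolding uc(4) r unit[OF kl(2)] by simp
    then show ?thesis using uc(5) r by blast
  qed
  have psd: "psd_kernel (blocks m n) (choi_kernel m F)"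
    using eb_form_CP[OF eb] by (simp add: CP_iff_choi_kernel)
  have "(\<Sum>j<m. \<Sum>e<n. coef m F i j p e * coef m F j i' e q) = coef m F i i' p q"
    if ii: "i < m" "i' < m" and pq: "p < n" "q < n" for i i' p q
  proof -
    let ?w = "\<lambda>k l. cnj (b k $ i) * a k $ p * (b l $ i' * cnj (a l $ q))"
    have "(\<Sum>j<m. \<Sum>e<n. coef m F i j p e * coef m F j i' e q) =
        (\<Sum>j<m. \<Sum>e<n. \<Sum>k<N. \<Sum>l<N. ?w k l * ((cnj (b l $ j) * b k $ j) * (cnj (a k $ e) * a l $ e)))"
      using ii pq by (intro sum.cong refl) (simp add: c, simp only: sum_product, simp add: mult_ac)
    also have "\<dots> = (\<Sum>k<N. \<Sum>l<N. \<Sum>j<m. \<Sum>e<n. ?w k l * ((cnj (b l $ j) * b k $ j) * (cnj (a k $ e) * a l $ e)))"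
      by (rule sum_swap4)
    also have "\<dots> = (\<Sum>k<N. \<Sum>l<N. cnj (b k $ i) * a k $ p * cnj (a k $ q) * (cinner (b l) (b k) * b l $ i'))"
    proof (intro sum.cong refl)
      fix k l assume "k \<in> {..<N}" "l \<in> {..<N}"
      then have kl: "k < N" "l < N" by auto
      have "(\<Sum>j<m. \<Sum>e<n. ?w k l * ((cnj (b l $ j) * b k $ j) * (cnj (a k $ e) * a l $ e))) =
          ?w k l * (cinner (b l) (b k) * cinner (a k) (a l))"
        using ac bc kl by (simp add: cinner_index[of _ m] cinner_index[of _ n], simp only: sum_product sum_distrib_left[symmetric])
      also have "\<dots> = cnj (b k $ i) * a k $ p * cnj (a k $ q) * (cinner (b l) (b k) * b l $ i')"
      proof (cases "cinner (b l) (b k) = 0")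
        case False
        then have "cinner (b k) (b l) \<noteq> 0" using cinner_cnj[OF bc[OF kl(2)] bc[OF kl(1)]] by auto
        from parallel[OF kl this] have al: "a l = cinner (a k) (a l) \<cdot>\<^sub>v a k" and r: "?r k l = 1" by auto
        have "a l $ q = cinner (a k) (a l) * a k $ q"
          using arg_cong[OF al, of "\<lambda>v. v $ q"] pq ac[OF kl(1)] by simp
        moreover have "cinner (a k) (a l) * cnj (cinner (a k) (a l)) = 1"
          using r by (simp add: complex_norm_square[symmetric])
        ultimately have "cinner (a k) (a l) * cnj (a l $ q) = cnj (a k $ q)"
          by (simp add: mult.assoc[symmetric])
        then show ?thesis by (simp add: mult_ac)
      qed simp
      finally show "(\<Sum>j<m. \<Sum>e<n. ?w k l * ((cnj (b l $ j) * b k $ j) * (cnj (a k $ e) * a l $ e))) =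
          cnj (b k $ i) * a k $ p * cnj (a k $ q) * (cinner (b l) (b k) * b l $ i')" .
    qed
    also have "\<dots> = (\<Sum>k<N. cnj (b k $ i) * a k $ p * cnj (a k $ q) * b k $ i')"
      unfolding sum_distrib_left[symmetric] using parseval_expansion[OF par bc ii(2)] by simp
    also have "\<dots> = coef m F i i' p q" using ii pq by (simp add: c mult_ac)
    finally show ?thesis .
  qed
  then show ?thesis using choi_projection_iff[OF F psd] by blast
qed

section \<open>The equivalence theorem\<close>

theorem theorem4p6:
  fixes d1 d2 :: nat and \<Phi> :: "complex mat \<Rightarrow> complex mat"
  assumes "0 < d1" and "0 < d2"
    and "PPT_channel d1 d2 \<Phi>"
    and "vec_space.rank d2 (\<Phi> (1\<^sub>m d1)) \<le> d1"
  shows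
    "let c1 = is_projection (choi d1 d2 \<Phi>);
         c2 = (EB d1 d2 \<Phi> \<and> ER d1 d2 \<Phi> = d1);
         c3 = Cstar_extreme_UEB d2 d1 (dual_map d1 \<Phi>);
         c4 = (\<exists>v u. (\<forall>j<d1. v j \<in> carrier_vec d2 \<and> cinner (v j) (v j) = 1) \<and>
                 orthonormal_basis d1 u \<and>
                 (\<forall>X\<in>carrier_mat d1 d1.
                    \<Phi> X = mat_sum d2 d2
                      (\<lambda>j. cinner (u j) (X *\<^sub>v u j) \<cdot>\<^sub>m ketbra (v j) (v j)) {..<d1}));
         c5 = (\<exists>A U S. psd d1 A \<and> (\<forall>i<d1. A $$ (i, i) = 1) \<and> unitary d1 U \<and>
                 complementary d1 d1 d2 (schur_map A) S \<and>
                 (\<forall>X\<in>carrier_mat d1 d1. \<Phi> X = S (Ad U X)));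
         c6 = degradable d1 d2 \<Phi>
     in (c1 \<longleftrightarrow> c2) \<and> (c2 \<longleftrightarrow> c3) \<and> (c3 \<longleftrightarrow> c4) \<and> (c4 \<longleftrightarrow> c5) \<and>
        (c2 \<longrightarrow> CR d1 d2 \<Phi> = d1) \<and>
        (d1 = d2 \<and> unital d1 d2 \<Phi> \<longrightarrow>
           (c1 \<longleftrightarrow> c6) \<and> (c2 \<longleftrightarrow> c6) \<and> (c3 \<longleftrightarrow> c6) \<and> (c4 \<longleftrightarrow> c6) \<and> (c5 \<longleftrightarrow> c6))"
proof -
  have CP: "CP d1 d2 \<Phi>" and coCP: "coCP d1 d2 \<Phi>" and "trace_preserving d1 \<Phi>"
    using assms(3) by (auto simp: PPT_channel_def)
  then have \<Phi>: "\<Phi> \<in> mat_maps d1 d2" and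
    tp: "\<And>i j. i < d1 \<Longrightarrow> j < d1 \<Longrightarrow> (\<Sum>a<d2. coef d1 \<Phi> i j a a) = (if i = j then 1 else 0)"
    by (simp_all add: CP_def trace_preserving_coef)
  let ?vN = "von_neumann_form d1 d2 \<Phi>"
  note ppt = coCP_partial_transpose[OF coCP]
  have c1: "is_projection (choi d1 d2 \<Phi>) \<longleftrightarrow> ?vN"
    using choi_projection_von_neumann_form[OF CP ppt tp] von_neumann_form_choi_projection by blast
  have c2: "(EB d1 d2 \<Phi> \<and> ER d1 d2 \<Phi> = d1) \<longleftrightarrow> ?vN"
    using ER_von_neumann_form[OF _ _ tp] von_neumann_form_ranks by blast
  have c3: "Cstar_extreme_UEB d2 d1 (dual_map d1 \<Phi>) \<longleftrightarrow> ?vN"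
    using Cstar_extreme_choi_projection[OF \<Phi>] von_neumann_form_Cstar_extreme c1 by blast
  have c4: "(\<exists>v u. (\<forall>j<d1. v j \<in> carrier_vec d2 \<and> cinner (v j) (v j) = 1) \<and> orthonormal_basis d1 u \<and>
      (\<forall>X\<in>carrier_mat d1 d1. \<Phi> X = mat_sum d2 d2
         (\<lambda>j. cinner (u j) (X *\<^sub>v u j) \<cdot>\<^sub>m ketbra (v j) (v j)) {..<d1})) \<longleftrightarrow> ?vN"
    unfolding von_neumann_form_def eb_form_def orthonormal_basis_iff orthonormal_def by blast
  have c6: "degradable d1 d2 \<Phi> \<longleftrightarrow> ?vN" if "d1 = d2" "unital d1 d2 \<Phi>"
    using degradable_von_neumann_form[OF coCP that(2) _ tp] von_neumann_form_degradable that by blast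
  show ?thesis
    unfolding Let_def c1 c2 c3 c4 von_neumann_form_iff_schur_complement[symmetric]
    using c6 von_neumann_form_ranks(3) by blast
qed

end
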